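(* Let $(\tau,J)$ be a Markov renewal process with kernel $K$ on $(\mathcal{E},\mu)$ satisfying the assumptions listed in the context, with parameter $\alpha\in(0,1)$, slowly varying function $L$ and function $\Phi$. Then, for every $x\in\mathcal{E}$, as $n\to\infty$, the following weak convergence of measures on $\mathcal{E}$ holds: $$\frac{L(n)}{n^{\alpha}}\,U(n,x,dy)\;\to\;\frac{\alpha}{\Gamma(1+\alpha)\Gamma(1-\alpha)}\,\frac{\Pi[dy]}{\mathbf{E}_{\Pi^{(2)}}[\Phi/k]},$$ that is, for every continuous bounded function $f:\mathcal{E}\to\mathbb{R}$ and every fixed $x\in\mathcal{E}$, $$\frac{L(n)}{n^{\alpha}}\int_{\mathcal{E}}U(n,x,dy)f(y)\;\to\;\frac{\alpha}{\Gamma(1+\alpha)\Gamma(1-\alpha)}\,\frac{\int_{\mathcal{E}}f(y)\,\Pi[dy]}{\mathbf{E}_{\Pi^{(2)}}[\Phi/k]}\qquad (n\to\infty).$$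
   Context: **Setting (Markov renewal process).** $\mathcal{E}$ is a compact Polish space with Borel $\sigma$-field $\mathcal{B}(\mathcal{E})$ and a measure $\mu$. A kernel $K_{x,dy}(n)$ ($x,y\in\mathcal{E}$, $n\ge 1$) with values in $[0,1]$ is given: for each $n$, $K_{x,\cdot}(n)$ is a $\sigma$-finite measure on $\mathcal{E}$ for every $x$, and $K_{\cdot,F}(n)$ is Borel for every $F\in\mathcal{B}(\mathcal{E})$. Each $K_{x,dy}(n)$ has a density $k_{x,y}(n)$ with respect to $\mu(dy)$, and $k(x,y):=\sum_{n\ge1}k_{x,y}(n)$. Under $\mathbf{P}_{x_0}$, $J=(J_n)_{n\ge0}$ is a Markov chain on $\mathcal{E}$ with $J_0=x_0$ and $\mathbf{P}_{x_0}[J_{n+1}\in dy\mid J_n=x]=k(x,y)\mu(dy)$; $\tau_0=0$, and conditionally on $J$ the increments $\tau_{n+1}-\tau_n$ are independent with $\mathbf{P}_{x_0}[\tau_{n+1}-\tau_n=m\mid J]=k_{J_n,J_{n+1}}(m)/k(J_n,J_{n+1})$, $m\ge1$. **Assumptions on $K$.** (i) $k(\cdot,\cdot)$ is continuous on $\mathcal{E}^2$. (ii) There exist $\alpha\in(0,1)$, a strictly positive continuous bounded function $\Phi$ on $\mathcal{E}^2$ and a slowly varying function $L$ such that $k_{x,y}(n)\sim\Phi(x,y)L(n)/n^{1+\alpha}$ as $n\to\infty$, uniformly in $(x,y)\in\mathcal{E}^2$. (iii) Non-defectiveness: $\int_{\mathcal{E}}\sum_{n\ge1}k_{x,y}(n)\mu(dy)=1$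 for every $x\in\mathcal{E}$. **Notation.** $u(i,x,dy):=\sum_{k\ge1}\mathbf{P}_x[\tau_k=i,\,J_k\in dy]$ and $U(n,x,dy):=\sum_{i=0}^n u(i,x,dy)$. $\Pi$ is the invariant probability measure of $J$, and $\Pi^{(2)}$ is the invariant measure of the chain $(J_i,J_{i+1})_{i\ge0}$, i.e. $\Pi^{(2)}(du,dv)=\Pi(du)k(u,v)\mu(dv)$, so that $\mathbf{E}_{\Pi^{(2)}}[\Phi/k]=\int_{\mathcal{E}^2}\Phi(u,v)\Pi(du)\mu(dv)$. *)

theory Defs
  imports "HOL-Probability.Probability"
begin

text \<open>
  The kernel is represented by \<open>K n x = K_{x,dy}(n)\<close> and its density by
  \<open>k n x y = k_{x,y}(n)\<close>.  Only \<open>n \<ge> 1\<close> is meaningful: values at \<open>n = 0\<close> are never used, and sums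
  over \<open>n \<ge> 1\<close> are written as sums over all \<open>n :: nat\<close> with argument \<open>Suc n\<close>.
\<close>

definition slowly_varying :: "(real \<Rightarrow> real) \<Rightarrow> bool" where
  "slowly_varying L \<longleftrightarrow>
     (\<exists>X. (\<forall>t\<ge>X. L t > 0) \<and> L \<in> borel_measurable (restrict_space borel {X..})) \<and>
     (\<forall>c>0. ((\<lambda>t. L (c * t) / L t) \<longlongrightarrow> 1) at_top)"

definition total_density :: "(nat \<Rightarrow> 'a \<Rightarrow> 'a \<Rightarrow> real) \<Rightarrow> 'a \<Rightarrow> 'a \<Rightarrow> real" where
  "total_density k x y = (\<Sum>n. k (Suc n) x y)"

text \<open>
  A density of the family \<open>(K n x)\<^sub>x\<close> is taken to be nonnegative and jointly measurable, as is
  needed for \<open>k m (J i) (J (i + 1)) / total_density k (J i) (J (i + 1))\<close> to be a random variable.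
\<close>

definition renewal_kernel ::
  "'a::topological_space measure \<Rightarrow> (nat \<Rightarrow> 'a \<Rightarrow> 'a measure) \<Rightarrow> (nat \<Rightarrow> 'a \<Rightarrow> 'a \<Rightarrow> real) \<Rightarrow> bool"
where
  "renewal_kernel \<mu> K k \<longleftrightarrow>
     sets \<mu> = sets borel \<and>
     (\<forall>n\<ge>1.
        (\<forall>x. sets (K n x) = sets borel \<and> sigma_finite_measure (K n x)) \<and>
        (\<forall>F\<in>sets borel. (\<lambda>x. emeasure (K n x) F) \<in> borel_measurable borel) \<and>
        (\<forall>x. \<forall>F\<in>sets borel. emeasure (K n x) F \<le> 1) \<and>
        (\<lambda>(x, y). k n x y) \<in> borel_measurable (borel \<Otimes>\<^sub>M borel) \<and>
        (\<forall>x y. 0 \<le> k n x y) \<and>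
        (\<forall>x. K n x = density \<mu> (\<lambda>y. ennreal (k n x y))))"

definition jump_kernel ::
  "'a measure \<Rightarrow> (nat \<Rightarrow> 'a \<Rightarrow> 'a \<Rightarrow> real) \<Rightarrow> 'a \<Rightarrow> 'a measure" where
  "jump_kernel \<mu> k x = density \<mu> (\<lambda>y. ennreal (total_density k x y))"

definition cond_prob_given :: "'w measure \<Rightarrow> 'w measure \<Rightarrow> 'w set \<Rightarrow> 'w \<Rightarrow> real" where
  "cond_prob_given P G A = real_cond_exp P G (indicator A)"

definition sigma_past ::
  "'w measure \<Rightarrow> (nat \<Rightarrow> 'w \<Rightarrow> 'a::topological_space) \<Rightarrow> nat \<Rightarrow> 'w measure" where
  "sigma_past P J n =
     vimage_algebra (space P) (\<lambda>\<omega>. \<lambda>i\<in>{..n}. J i \<omega>) (Pi\<^sub>M {..n} (\<lambda>_. borel))"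

definition sigma_chain ::
  "'w measure \<Rightarrow> (nat \<Rightarrow> 'w \<Rightarrow> 'a::topological_space) \<Rightarrow> 'w measure" where
  "sigma_chain P J = vimage_algebra (space P) (\<lambda>\<omega> i. J i \<omega>) (Pi\<^sub>M UNIV (\<lambda>_. borel))"

text \<open>The event that the increment of \<open>\<tau>\<close> from \<open>i\<close> to \<open>i + 1\<close> equals \<open>m\<close>, phrased without the
  truncated subtraction on the natural numbers.\<close>

definition increment_event :: "'w measure \<Rightarrow> (nat \<Rightarrow> 'w \<Rightarrow> nat) \<Rightarrow> nat \<Rightarrow> nat \<Rightarrow> 'w set" where
  "increment_event P \<tau> i m = {\<omega> \<in> space P. \<tau> (Suc i) \<omega> = \<tau> i \<omega> + m}"

text \<open>\<open>P\<close> is the law \<open>\<^bold>P\<^bsub>x\<^esub>\<close>. The last two clauses say that, conditionally on \<open>J\<close>, the increments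
  of \<open>\<tau>\<close> have the prescribed laws and are independent.\<close>

definition markov_renewal_process ::
  "'a::topological_space measure \<Rightarrow> (nat \<Rightarrow> 'a \<Rightarrow> 'a \<Rightarrow> real) \<Rightarrow> 'a \<Rightarrow>
   'w measure \<Rightarrow> (nat \<Rightarrow> 'w \<Rightarrow> nat) \<Rightarrow> (nat \<Rightarrow> 'w \<Rightarrow> 'a) \<Rightarrow> bool"
where
  "markov_renewal_process \<mu> k x P \<tau> J \<longleftrightarrow>
     prob_space P \<and>
     (\<forall>n. J n \<in> measurable P borel) \<and>
     (\<forall>n. \<tau> n \<in> measurable P (count_space UNIV)) \<and>
     (AE \<omega> in P. J 0 \<omega> = x) \<and>
     (AE \<omega> in P. \<tau> 0 \<omega> = 0) \<and>
     (\<forall>n. \<forall>F\<in>sets borel. AE \<omega> in P.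
        cond_prob_given P (sigma_past P J n) {\<omega> \<in> space P. J (Suc n) \<omega> \<in> F} \<omega>
          = measure (jump_kernel \<mu> k (J n \<omega>)) F) \<and>
     (\<forall>i. \<forall>m\<ge>1. AE \<omega> in P.
        cond_prob_given P (sigma_chain P J) (increment_event P \<tau> i m) \<omega>
          = k m (J i \<omega>) (J (Suc i) \<omega>) / total_density k (J i \<omega>) (J (Suc i) \<omega>)) \<and>
     (\<forall>I m. finite I \<and> I \<noteq> {} \<longrightarrow> (AE \<omega> in P.
        cond_prob_given P (sigma_chain P J) (\<Inter>i\<in>I. increment_event P \<tau> i (m i)) \<omega>
          = (\<Prod>i\<in>I. cond_prob_given P (sigma_chain P J) (increment_event P \<tau> i (m i)) \<omega>)))"

text \<open>Below, \<open>P x\<close> is the law of the process started at \<open>x\<close>; \<open>renewal_mass\<close> is \<open>u(i,x,dy)\<close> and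
  \<open>renewal_measure\<close> is \<open>U(n,x,dy)\<close>.\<close>

definition renewal_mass ::
  "('a::topological_space \<Rightarrow> 'w measure) \<Rightarrow> (nat \<Rightarrow> 'w \<Rightarrow> nat) \<Rightarrow> (nat \<Rightarrow> 'w \<Rightarrow> 'a) \<Rightarrow>
   nat \<Rightarrow> 'a \<Rightarrow> 'a measure" where
  "renewal_mass P \<tau> J i x =
     measure_of UNIV (sets borel)
       (\<lambda>F. \<Sum>j. emeasure (P x) {\<omega> \<in> space (P x). \<tau> (Suc j) \<omega> = i \<and> J (Suc j) \<omega> \<in> F})"

definition renewal_measure ::
  "('a::topological_space \<Rightarrow> 'w measure) \<Rightarrow> (nat \<Rightarrow> 'w \<Rightarrow> nat) \<Rightarrow> (nat \<Rightarrow> 'w \<Rightarrow> 'a) \<Rightarrow>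
   nat \<Rightarrow> 'a \<Rightarrow> 'a measure" where
  "renewal_measure P \<tau> J n x =
     measure_of UNIV (sets borel) (\<lambda>F. \<Sum>i=0..n. emeasure (renewal_mass P \<tau> J i x) F)"

definition invariant_probability ::
  "'a::topological_space measure \<Rightarrow> (nat \<Rightarrow> 'a \<Rightarrow> 'a \<Rightarrow> real) \<Rightarrow> 'a measure \<Rightarrow> bool" where
  "invariant_probability \<mu> k \<pi> \<longleftrightarrow>
     prob_space \<pi> \<and> sets \<pi> = sets borel \<and>
     (\<forall>F\<in>sets borel. emeasure \<pi> F = (\<integral>\<^sup>+ x. emeasure (jump_kernel \<mu> k x) F \<partial>\<pi>))"

text \<open>The invariant measure of the chain of pairs, \<open>\<pi>(du) k(u,v) \<mu>(dv)\<close>.  The product \<open>\<pi> \<Otimes>\<^sub>M \<mu>\<close> is the genuine one, since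
  non-defectiveness together with a continuous and, by the tail assumption, strictly positive \<open>total_density\<close> on a compact
  space forces \<open>\<mu>\<close> to be finite.\<close>

definition pair_invariant ::
  "'a measure \<Rightarrow> (nat \<Rightarrow> 'a \<Rightarrow> 'a \<Rightarrow> real) \<Rightarrow> 'a measure \<Rightarrow> ('a \<times> 'a) measure" where
  "pair_invariant \<mu> k \<pi> = density (\<pi> \<Otimes>\<^sub>M \<mu>) (\<lambda>(u, v). ennreal (total_density k u v))"

end

theory Submission
  imports Defs
begin

text \<open>Fix the starting point \<open>x\<close>, and for \<open>l > 0\<close> put \<open>V\<^sub>l(f) = \<Sum>\<^sub>j E\<^sub>x[exp(-l \<tau>\<^sub>j) f(J\<^sub>j)]\<close>; up to the
term \<open>j = 0\<close> this is the Laplace transform of the renewal measure integrated against \<open>f\<close>.  Let \<open>Q\<^sub>l\<close>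
be the discounted kernel \<open>Q\<^sub>l f(u) = \<integral> \<Sum>\<^sub>n exp(-l n) k\<^sub>n(u,v) f(v) \<mu>(dv)\<close>, so that \<open>Q\<^sub>0\<close> is the
transition operator of \<open>J\<close>.  The Markov renewal property says that
\<open>V\<^sub>l(f) = f(x) + V\<^sub>l(Q\<^sub>l f)\<close>, and this single identity determines \<open>V\<^sub>l(f)\<close> as \<open>l \<rightarrow> 0\<close>.

Let \<open>\<delta>\<^sub>l = 1 - Q\<^sub>l 1\<close> be the mass killed by discounting one step.  The identity for \<open>f = 1\<close> reads
\<open>V\<^sub>l(\<delta>\<^sub>l) = 1\<close>.  By the tail assumption and an Abelian theorem, \<open>\<delta>\<^sub>l / (l\<^sup>\<alpha> L(1/l))\<close> converges
uniformly to \<open>d(u) = \<Gamma>(1-\<alpha>)/\<alpha> \<integral> \<Phi>(u,v) \<mu>(dv)\<close>, which is bounded below; hence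
\<open>l\<^sup>\<alpha> L(1/l) V\<^sub>l(d) \<rightarrow> 1\<close>.

All other functions are compared with \<open>d\<close>.  The total density is bounded below on the compact
square, so the chain satisfies a Doeblin condition, and every continuous \<open>g\<close> with \<open>\<Pi>(g) = 0\<close> has the
form \<open>g = h - Q\<^sub>0 h\<close> with \<open>h\<close> bounded.  Then \<open>V\<^sub>l(g) = h(x) - V\<^sub>l((Q\<^sub>0 - Q\<^sub>l) h)\<close>, and since
\<open>|(Q\<^sub>0 - Q\<^sub>l) h| \<le> sup |h| \<delta>\<^sub>l\<close>, the last term is at most \<open>sup |h| V\<^sub>l(\<delta>\<^sub>l) = sup |h|\<close>.  So \<open>V\<^sub>l(g)\<close> stays
bounded while \<open>V\<^sub>l(d)\<close> explodes, and with \<open>g = f - (\<Pi>(f)/\<Pi>(d)) d\<close> one gets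
\<open>l\<^sup>\<alpha> L(1/l) V\<^sub>l(f) \<rightarrow> \<Pi>(f)/\<Pi>(d)\<close> (\<open>potential_asymptotics\<close>).

Karamata's Tauberian theorem (\<open>karamata_tauberian\<close>) turns this into the growth of the partial sums
\<open>U(n,x,f)\<close> for \<open>f \<ge> 0\<close>, with the extra factor \<open>1/\<Gamma>(1+\<alpha>)\<close>; adding a constant removes the sign
condition.\<close>

section \<open>Slowly varying functions\<close>

text \<open>The uniform convergence theorem for slowly varying functions, in additive form \<open>h = ln \<circ> L \<circ> exp\<close>.
Pointwise convergence of \<open>h(x + t) - h(x)\<close> gives convergence in measure in \<open>t\<close> on a bounded interval.
A fixed increment \<open>h(x + u) - h(x)\<close> is the difference of the increments from \<open>x\<close> and from \<open>x + u\<close> to a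
common point \<open>x + t\<close>; averaging over \<open>t\<close> bounds it by two such integrals, which do not depend on \<open>u\<close>.\<close>

lemma uniform_convergence_additive:
  fixes h :: "real \<Rightarrow> real"
  assumes [measurable]: "h \<in> borel_measurable borel"
    and lim: "\<And>u. ((\<lambda>x. h (x + u) - h x) \<longlongrightarrow> 0) at_top"
    and "0 < \<epsilon>"
  obtains X where "\<And>x u. X \<le> x \<Longrightarrow> 0 \<le> u \<Longrightarrow> u \<le> 1 \<Longrightarrow> \<bar>h (x + u) - h x\<bar> \<le> \<epsilon>"
proof -
  \<comment> \<open>Truncation at 1 keeps the triangle inequality and makes dominated convergence applicable.\<close>
  define m :: "real \<Rightarrow> real" where "m y = min 1 \<bar>y\<bar>" for y
  have [measurable]: "m \<in> borel_measurable borel" unfolding m_def by measurable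
  have m_bounds: "0 \<le> m y" "m y \<le> 1" for y by (auto simp: m_def)
  have m_tri: "m (a - c) \<le> m (b - a) + m (b - c)" for a b c by (auto simp: m_def)
  define \<phi> where "\<phi> x t = m (h (x + t) - h x)" for x t
  have [measurable]: "\<phi> x \<in> borel_measurable borel" for x unfolding \<phi>_def by measurable
  have \<phi>_bounds: "0 \<le> \<phi> x t" "\<phi> x t \<le> 1" for x t by (auto simp: \<phi>_def m_bounds)
  define I where "I x = (\<integral>t. indicator {0..2} t * \<phi> x t \<partial>lborel)" for x
  have int_ind: "integrable lborel (\<lambda>t. indicator {a..b} t * g t)"
    if [measurable]: "g \<in> borel_measurable borel" and "\<And>t. 0 \<le> g t \<and> g t \<le> 1" for a b :: real and g :: "real \<Rightarrow> real"
  proof (rule Bochner_Integration.integrable_bound[where f = "\<lambda>t. indicator {a..b} t :: real"])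
    show "integrable lborel (indicat_real {a..b})"
      by (rule integrable_real_indicator) (auto simp: emeasure_lborel_Icc_eq)
    show "AE t in lborel. norm (indicator {a..b} t * g t) \<le> norm (indicat_real {a..b} t)"
      using that(2) by (auto intro!: AE_I2 simp: indicator_def)
  qed measurable
  have "(I \<longlongrightarrow> (\<integral>t. 0 \<partial>(lborel::real measure))) at_top"
    unfolding I_def
  proof (rule integral_dominated_convergence_at_top[where w = "\<lambda>t. indicator {0..2} t"])
    have m0: "((\<lambda>x. m (g x)) \<longlongrightarrow> 0) at_top" if "(g \<longlongrightarrow> 0) at_top" for g :: "real \<Rightarrow> real"
    proof -
      have "((\<lambda>x. m (g x)) \<longlongrightarrow> min 1 \<bar>0\<bar>) at_top" unfolding m_def by (intro tendsto_intros that)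
      then show ?thesis by simp
    qed
    show "AE t in lborel. ((\<lambda>x. indicator {0..2} t * \<phi> x t) \<longlongrightarrow> 0) at_top"
      using m0[OF lim] by (auto intro!: AE_I2 tendsto_mult_right_zero simp: \<phi>_def)
    show "\<forall>\<^sub>F x in at_top. AE t in lborel. norm (indicator {0..2} t * \<phi> x t) \<le> indicator {0..2} t"
      using \<phi>_bounds by (auto simp: indicator_def)
  qed (auto intro: \<phi>_bounds)
  then have "(I \<longlongrightarrow> 0) at_top" by simp
  then have "\<forall>\<^sub>F x in at_top. I x < min \<epsilon> 1 / 2"
    using \<open>0 < \<epsilon>\<close> by (intro order_tendstoD) auto
  then obtain X where X: "\<And>x. X \<le> x \<Longrightarrow> I x < min \<epsilon> 1 / 2"
    by (auto simp: eventually_at_top_linorder)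
  have key: "m (h (x + u) - h x) \<le> I (x + u) + I x" if "0 \<le> u" "u \<le> 1" for x u
  proof -
    have "m (h (x + u) - h x) = (\<integral>t. indicator {1..2::real} t * m (h (x + u) - h x) \<partial>lborel)"
      by simp
    also have "\<dots> \<le> (\<integral>t. indicator {u..2+u} t * \<phi> (x + u) (t - u) + indicator {0..2} t * \<phi> x t \<partial>lborel)"
    proof (rule integral_mono)
      fix t :: real
      have "indicator {1..2} t * m (h (x + u) - h x) \<le> indicator {1..2} t * (\<phi> (x + u) (t - u) + \<phi> x t)"
        using m_tri[of "h (x + u)" "h x" "h (x + t)"] by (auto simp: \<phi>_def intro!: mult_left_mono)
      also have "\<dots> \<le> indicator {u..2+u} t * \<phi> (x + u) (t - u) + indicator {0..2} t * \<phi> x t"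
        using that \<phi>_bounds by (auto simp: indicator_def)
      finally show "indicator {1..2} t * m (h (x + u) - h x) \<le>
          indicator {u..2+u} t * \<phi> (x + u) (t - u) + indicator {0..2} t * \<phi> x t" .
    qed (auto intro!: int_ind Bochner_Integration.integrable_add simp: \<phi>_bounds m_bounds)
    also have "\<dots> = (\<integral>t. indicator {u..2+u} t * \<phi> (x + u) (t - u) \<partial>lborel) + I x"
      unfolding I_def
      by (intro Bochner_Integration.integral_add int_ind) (auto simp: \<phi>_bounds)
    also have "(\<integral>t. indicator {u..2+u} t * \<phi> (x + u) (t - u) \<partial>lborel) = I (x + u)"
      unfolding I_def
      by (subst lborel_integral_real_affine[where c = 1 and t = u])
        (auto intro!: Bochner_Integration.integral_cong simp: indicator_def)
    finally show ?thesis .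
  qed
  show ?thesis
  proof
    fix x u :: real assume x: "X \<le> x" "0 \<le> u" "u \<le> 1"
    have "m (h (x + u) - h x) < min \<epsilon> 1"
      using key[of u x] X[of x] X[of "x + u"] x by linarith
    then show "\<bar>h (x + u) - h x\<bar> \<le> \<epsilon>" by (auto simp: m_def split: if_splits)
  qed
qed

text \<open>Summing unit steps gives at most linear growth of \<open>h\<close>, with an arbitrarily small slope.  Multiplicatively
these are the Potter bounds \<open>L(s)/L(t) \<le> C max(s/t, t/s)\<^sup>\<epsilon>\<close>.\<close>

lemma potter_additive:
  fixes h :: "real \<Rightarrow> real"
  assumes "\<And>x u. X \<le> x \<Longrightarrow> 0 \<le> u \<Longrightarrow> u \<le> 1 \<Longrightarrow> \<bar>h (x + u) - h x\<bar> \<le> \<epsilon>"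
    and "X \<le> x" "X \<le> y"
  shows "\<bar>h y - h x\<bar> \<le> \<epsilon> * (\<bar>y - x\<bar> + 1)"
proof -
  have \<epsilon>: "0 \<le> \<epsilon>" using assms(1)[of x 0] assms(2) by auto
  have steps: "\<bar>h (x + real n) - h x\<bar> \<le> \<epsilon> * real n" if "X \<le> x" for n x
  proof (induction n)
    case (Suc n)
    have "\<bar>h (x + real n + 1) - h (x + real n)\<bar> \<le> \<epsilon>"
      using that by (intro assms(1)) auto
    with Suc show ?case by (simp add: algebra_simps abs_if split: if_splits)
  qed simp
  have main: "\<bar>h y - h x\<bar> \<le> \<epsilon> * ((y - x) + 1)" if "X \<le> x" "x \<le> y" for x y
  proof -
    define n where "n = nat \<lfloor>y - x\<rfloor>"
    have n: "real n \<le> y - x" "y - x < real n + 1" using that by (auto simp: n_def)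
    have "\<bar>h y - h (x + real n)\<bar> \<le> \<epsilon>"
      using assms(1)[of "x + real n" "y - x - real n"] n that by auto
    then have "\<bar>h y - h x\<bar> \<le> \<epsilon> * (real n + 1)"
      using steps[OF that(1), of n] by (simp add: algebra_simps)
    also have "\<dots> \<le> \<epsilon> * ((y - x) + 1)" using n \<epsilon> by (intro mult_left_mono) auto
    finally show ?thesis .
  qed
  show ?thesis
    using main[of x y] main[of y x] assms by (cases "x \<le> y") (auto simp: abs_minus_commute)
qed

lemma slowly_varying_uniform:
  assumes "slowly_varying L" "0 < \<epsilon>"
  obtains T where "1 \<le> T" "\<And>t. T \<le> t \<Longrightarrow> 0 < L t"
    "\<And>s t. T \<le> s \<Longrightarrow> T \<le> t \<Longrightarrow> \<bar>ln s - ln t\<bar> \<le> 1 \<Longrightarrow> \<bar>ln (L s) - ln (L t)\<bar> \<le> \<epsilon>"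
    "\<And>s t. T \<le> s \<Longrightarrow> T \<le> t \<Longrightarrow> \<bar>ln (L s) - ln (L t)\<bar> \<le> \<epsilon> * (\<bar>ln s - ln t\<bar> + 1)"
proof -
  from assms(1) obtain X where X: "\<And>t. t \<ge> X \<Longrightarrow> L t > 0"
    and meas: "L \<in> borel_measurable (restrict_space borel {X..})"
    and lim: "\<And>c. c > 0 \<Longrightarrow> ((\<lambda>t. L (c * t) / L t) \<longlongrightarrow> 1) at_top"
    unfolding slowly_varying_def by auto
  define L' where "L' t = (if X \<le> t then L t else 1)" for t
  have L'_pos: "0 < L' t" for t using X by (auto simp: L'_def)
  have [measurable]: "L' \<in> borel_measurable borel"
    using meas unfolding L'_def
    by (subst measurable_If_restrict_space_iff) (auto simp: atLeast_def)
  define h where "h x = ln (L' (exp x))" for x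
  have [measurable]: "h \<in> borel_measurable borel" unfolding h_def by measurable
  have hlim: "((\<lambda>x. h (x + u) - h x) \<longlongrightarrow> 0) at_top" for u
  proof -
    have "((\<lambda>x. L (exp u * exp x) / L (exp x)) \<longlongrightarrow> 1) at_top"
      by (rule filterlim_compose[OF lim exp_at_top]) simp
    then have "((\<lambda>x. ln (L (exp u * exp x) / L (exp x))) \<longlongrightarrow> ln 1) at_top"
      by (rule tendsto_ln) simp
    moreover have "\<forall>\<^sub>F x in at_top. ln (L (exp u * exp x) / L (exp x)) = h (x + u) - h x"
    proof -
      have e1: "\<forall>\<^sub>F x in at_top. X \<le> exp x"
        using exp_at_top by (auto simp: filterlim_at_top)
      have "filterlim (\<lambda>x. exp u * exp x) at_top at_top"
        by (rule filterlim_tendsto_pos_mult_at_top[OF tendsto_const]) (auto intro: exp_at_top)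
      then have e2: "\<forall>\<^sub>F x in at_top. X \<le> exp u * exp x" by (auto simp: filterlim_at_top)
      from e1 e2 show ?thesis
        by eventually_elim (auto simp: h_def L'_def exp_add mult.commute ln_div less_imp_neq X X[THEN less_imp_neq, symmetric])
    qed
    ultimately show ?thesis by (simp add: tendsto_cong)
  qed
  obtain Y where Y: "\<And>x u. Y \<le> x \<Longrightarrow> 0 \<le> u \<Longrightarrow> u \<le> 1 \<Longrightarrow> \<bar>h (x + u) - h x\<bar> \<le> \<epsilon>"
    using uniform_convergence_additive[OF _ hlim assms(2)] by auto
  define T where "T = max 1 (max X (exp Y))"
  have T: "1 \<le> T" "X \<le> T" "exp Y \<le> T" by (auto simp: T_def)
  have hL: "ln (L t) = h (ln t)" if "T \<le> t" for t
    using that T by (auto simp: h_def L'_def)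
  have Yln: "Y \<le> ln t" if "T \<le> t" for t
    using that T by (subst ln_ge_iff) auto
  show ?thesis
  proof
    fix s t assume st: "T \<le> s" "T \<le> t"
    show "\<bar>ln (L s) - ln (L t)\<bar> \<le> \<epsilon> * (\<bar>ln s - ln t\<bar> + 1)"
      using potter_additive[of Y h \<epsilon> "ln t" "ln s"] Y st by (simp add: hL Yln)
    assume "\<bar>ln s - ln t\<bar> \<le> 1"
    then show "\<bar>ln (L s) - ln (L t)\<bar> \<le> \<epsilon>"
      using Y[of "ln t" "ln s - ln t"] Y[of "ln s" "ln t - ln s"] st
      by (cases "ln s \<le> ln t") (auto simp: hL Yln abs_minus_commute)
  qed (use T X in auto)
qed


text \<open>Applied below to \<open>s(t) = \<lfloor>v t\<rfloor>\<close>, where the definition of slow variation alone does not suffice: it only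
treats exact multiples \<open>v t\<close>, and uniformity bridges the gap between \<open>s(t)\<close> and \<open>v t\<close>.\<close>

lemma slowly_varying_ratio:
  assumes L: "slowly_varying L" and s: "((\<lambda>t. s t / t) \<longlongrightarrow> v) at_top" and "0 < v"
  shows "((\<lambda>t. L (s t) / L t) \<longlongrightarrow> 1) at_top"
proof -
  have v_lim: "((\<lambda>t. L (v * t) / L t) \<longlongrightarrow> 1) at_top"
    using L \<open>0 < v\<close> by (auto simp: slowly_varying_def)
  have vt_top: "filterlim (\<lambda>t. v * t) at_top at_top"
    by (rule filterlim_tendsto_pos_mult_at_top[OF tendsto_const \<open>0 < v\<close> filterlim_ident])
  have "filterlim (\<lambda>t. s t / t * t) at_top at_top"
    by (rule filterlim_tendsto_pos_mult_at_top[OF s \<open>0 < v\<close> filterlim_ident])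
  moreover have "\<forall>\<^sub>F t in at_top. s t / t * t = s t"
    using eventually_gt_at_top[of 0] by eventually_elim simp
  ultimately have s_top: "filterlim s at_top at_top"
    by (simp add: filterlim_cong)
  have "((\<lambda>t. s t / t / v) \<longlongrightarrow> v / v) at_top" by (intro tendsto_intros s) (use \<open>0 < v\<close> in auto)
  then have "((\<lambda>t. ln (s t / t / v)) \<longlongrightarrow> ln (v / v)) at_top"
    by (rule tendsto_ln) (use \<open>0 < v\<close> in auto)
  then have ln_lim: "((\<lambda>t. ln (s t / t / v)) \<longlongrightarrow> 0) at_top" using \<open>0 < v\<close> by simp
  have vt_lim: "((\<lambda>t. ln (L (v * t) / L t)) \<longlongrightarrow> ln 1) at_top" by (rule tendsto_ln[OF v_lim]) simp
  have "((\<lambda>t. ln (L (s t)) - ln (L t)) \<longlongrightarrow> 0) at_top"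
  proof (rule tendstoI)
    fix e :: real assume "0 < e"
    then have "0 < e / 2" by simp
    then obtain T where T: "1 \<le> T" "\<And>t. T \<le> t \<Longrightarrow> 0 < L t"
      "\<And>s t. T \<le> s \<Longrightarrow> T \<le> t \<Longrightarrow> \<bar>ln s - ln t\<bar> \<le> 1 \<Longrightarrow> \<bar>ln (L s) - ln (L t)\<bar> \<le> e / 2"
      using slowly_varying_uniform[OF L] by metis
    have "\<forall>\<^sub>F t in at_top. T \<le> v * t" "\<forall>\<^sub>F t in at_top. T \<le> s t"
      using vt_top s_top by (auto simp: filterlim_at_top)
    moreover have "\<forall>\<^sub>F t in at_top. dist (ln (s t / t / v)) 0 < 1"
      by (rule tendstoD[OF ln_lim]) simp
    moreover have "\<forall>\<^sub>F t in at_top. dist (ln (L (v * t) / L t)) (ln 1) < e / 2"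
      by (rule tendstoD[OF vt_lim \<open>0 < e / 2\<close>])
    ultimately show "\<forall>\<^sub>F t in at_top. dist (ln (L (s t)) - ln (L t)) 0 < e"
      using eventually_ge_at_top[of T]
    proof eventually_elim
      case (elim t)
      have pos: "0 < t" "0 < s t" using elim T(1) by auto
      have "\<bar>ln (s t) - ln (v * t)\<bar> \<le> 1"
        using elim(3) pos \<open>0 < v\<close> by (simp add: ln_div ln_mult)
      then have "\<bar>ln (L (s t)) - ln (L (v * t))\<bar> \<le> e / 2" using T(3) elim by blast
      moreover have "ln (L (v * t) / L t) = ln (L (v * t)) - ln (L t)"
        using T(2)[of "v * t"] T(2)[of t] elim by (simp add: ln_div)
      moreover have "\<bar>ln (L (v * t)) - ln (L t)\<bar> < e / 2"
        using elim(4) calculation(2) by (simp add: dist_real_def)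
      ultimately have "\<bar>ln (L (s t)) - ln (L t)\<bar> < e"
        using abs_triangle_ineq4[of "ln (L (s t)) - ln (L (v * t))" "ln (L t) - ln (L (v * t))"]
          abs_minus_commute[of "ln (L t)" "ln (L (v * t))"] by simp
      then show ?case by (simp add: dist_real_def)
    qed
  qed
  then have "((\<lambda>t. exp (ln (L (s t)) - ln (L t))) \<longlongrightarrow> exp 0) at_top" by (rule tendsto_exp)
  moreover obtain T where T: "1 \<le> T" "\<And>t. T \<le> t \<Longrightarrow> 0 < L t"
    using slowly_varying_uniform[OF L zero_less_one] by metis
  have "\<forall>\<^sub>F t in at_top. T \<le> s t" using s_top by (auto simp: filterlim_at_top)
  then have "\<forall>\<^sub>F t in at_top. exp (ln (L (s t)) - ln (L t)) = L (s t) / L t"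
    using eventually_ge_at_top[of T]
    by eventually_elim (simp add: exp_diff T)
  ultimately show ?thesis by (simp add: tendsto_cong)
qed

lemma slowly_varying_sub_powr:
  assumes L: "slowly_varying L" and "0 < \<eta>"
  shows "((\<lambda>t. L t * t powr -\<eta>) \<longlongrightarrow> 0) at_top" "((\<lambda>t. t powr -\<eta> / L t) \<longlongrightarrow> 0) at_top"
proof -
  have "0 < \<eta> / 2" using assms by simp
  then obtain T where T: "1 \<le> T" "\<And>t. T \<le> t \<Longrightarrow> 0 < L t"
    "\<And>s t. T \<le> s \<Longrightarrow> T \<le> t \<Longrightarrow> \<bar>ln (L s) - ln (L t)\<bar> \<le> \<eta> / 2 * (\<bar>ln s - ln t\<bar> + 1)"
    using slowly_varying_uniform[OF L] by metis
  define C where "C = \<bar>ln (L T)\<bar> + \<eta> / 2"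
  have bound: "\<bar>ln (L t)\<bar> \<le> C + \<eta> / 2 * ln t" if "T \<le> t" for t
  proof -
    have "\<bar>ln t - ln T\<bar> \<le> ln t" using that T(1) by simp
    then have "\<eta> / 2 * (\<bar>ln t - ln T\<bar> + 1) \<le> \<eta> / 2 * (ln t + 1)"
      using \<open>0 < \<eta>\<close> by (intro mult_left_mono) auto
    then show ?thesis using T(3)[OF that order_refl] by (simp add: C_def algebra_simps)
  qed
  have lim: "((\<lambda>t. exp C * t powr -(\<eta> / 2)) \<longlongrightarrow> 0) at_top"
    using \<open>0 < \<eta>\<close> by (intro tendsto_mult_right_zero tendsto_neg_powr filterlim_ident) auto
  have le: "exp l * t powr -\<eta> \<le> exp C * t powr -(\<eta> / 2)"
    if "T \<le> t" "l \<le> C + \<eta> / 2 * ln t" for t l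
    using that T(1) by (simp add: powr_def exp_add[symmetric])
  show "((\<lambda>t. L t * t powr -\<eta>) \<longlongrightarrow> 0) at_top"
  proof (rule Lim_null_comparison[OF _ lim])
    show "\<forall>\<^sub>F t in at_top. norm (L t * t powr -\<eta>) \<le> exp C * t powr -(\<eta> / 2)"
      using eventually_ge_at_top[of T]
    proof eventually_elim
      case (elim t)
      then show ?case using le[OF elim, of "ln (L t)"] bound[OF elim] T(2)[OF elim] by simp
    qed
  qed
  show "((\<lambda>t. t powr -\<eta> / L t) \<longlongrightarrow> 0) at_top"
  proof (rule Lim_null_comparison[OF _ lim])
    show "\<forall>\<^sub>F t in at_top. norm (t powr -\<eta> / L t) \<le> exp C * t powr -(\<eta> / 2)"
      using eventually_ge_at_top[of T]
    proof eventually_elim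
      case (elim t)
      then show ?case using le[OF elim, of "- ln (L t)"] bound[OF elim] T(2)[OF elim]
        by (simp add: exp_minus field_simps)
    qed
  qed
qed

section \<open>Abelian asymptotics\<close>

lemma divide_powr_minus:
  fixes x y b :: real
  assumes "0 \<le> x" "0 \<le> y"
  shows "(x / y) powr - b = y powr b / x powr b"
  using assms by (simp add: powr_divide powr_minus field_simps)

text \<open>Sums over \<open>n\<close> are turned into integrals of step functions at scale \<open>t\<close>, so that dominated convergence on
the half-line applies to them.\<close>

lemma nn_integral_step_function:
  fixes G :: "nat \<Rightarrow> real"
  assumes "0 < t" and G: "\<And>n. 0 \<le> G n"
  shows "(\<integral>\<^sup>+ v. ennreal (indicator {0..} v * G (nat \<lfloor>t * v\<rfloor>)) \<partial>lborel) = (\<Sum>n. ennreal (G n / t))"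
proof -
  have "(\<integral>\<^sup>+ v. ennreal (indicator {0..} v * G (nat \<lfloor>t * v\<rfloor>)) \<partial>lborel)
      = (\<integral>\<^sup>+ v. (\<Sum>n. ennreal (G n) * indicator {real n / t..<real (Suc n) / t} v) \<partial>lborel)"
  proof (intro nn_integral_cong)
    fix v :: real
    have "(\<Sum>n. ennreal (G n) * indicator {real n / t..<real (Suc n) / t} v)
        = (\<Sum>n\<in>{nat \<lfloor>t * v\<rfloor>}. ennreal (G n) * indicator {real n / t..<real (Suc n) / t} v)"
    proof (rule suminf_finite)
      fix n assume n: "n \<notin> {nat \<lfloor>t * v\<rfloor>}"
      have "v \<notin> {real n / t..<real (Suc n) / t}"
      proof
        assume "v \<in> {real n / t..<real (Suc n) / t}"
        then have "real n \<le> t * v" "t * v < real n + 1" using \<open>0 < t\<close> by (auto simp: field_simps)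
        then have "\<lfloor>t * v\<rfloor> = int n" by (intro floor_unique) auto
        with n show False by simp
      qed
      then show "ennreal (G n) * indicator {real n / t..<real (Suc n) / t} v = 0" by simp
    qed simp
    also have "\<dots> = ennreal (indicator {0..} v * G (nat \<lfloor>t * v\<rfloor>))"
    proof (cases "0 \<le> v")
      case True
      then have "0 \<le> t * v" using \<open>0 < t\<close> by simp
      then have "real (nat \<lfloor>t * v\<rfloor>) \<le> t * v" "t * v < real (nat \<lfloor>t * v\<rfloor>) + 1" by auto
      then have "v \<in> {real (nat \<lfloor>t * v\<rfloor>) / t..<real (Suc (nat \<lfloor>t * v\<rfloor>)) / t}"
        using \<open>0 < t\<close> by (simp add: field_simps)
      then show ?thesis using True by simp
    next
      case False
      then have "v \<notin> {real n / t..<real (Suc n) / t}" for n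
        using \<open>0 < t\<close> by (smt (verit) atLeastLessThan_iff divide_nonneg_pos of_nat_0_le_iff)
      then show ?thesis using False by simp
    qed
    finally show "ennreal (indicator {0..} v * G (nat \<lfloor>t * v\<rfloor>)) =
      (\<Sum>n. ennreal (G n) * indicator {real n / t..<real (Suc n) / t} v)" by simp
  qed
  also have "\<dots> = (\<Sum>n. \<integral>\<^sup>+ v. ennreal (G n) * indicator {real n / t..<real (Suc n) / t} v \<partial>lborel)"
    by (rule nn_integral_suminf) simp
  also have "\<dots> = (\<Sum>n. ennreal (G n / t))"
  proof (intro suminf_cong)
    fix n
    have "(\<integral>\<^sup>+ v. ennreal (G n) * indicator {real n / t..<real (Suc n) / t} v \<partial>lborel)
        = ennreal (G n) * ennreal (real (Suc n) / t - real n / t)"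
      using \<open>0 < t\<close> by (subst nn_integral_cmult_indicator) (auto simp: divide_right_mono emeasure_lborel_Ico)
    also have "real (Suc n) / t - real n / t = 1 / t" by (simp add: field_simps diff_divide_distrib[symmetric])
    also have "ennreal (G n) * ennreal (1 / t) = ennreal (G n / t)"
      using G[of n] \<open>0 < t\<close> by (simp add: ennreal_mult[symmetric])
    finally show "(\<integral>\<^sup>+ v. ennreal (G n) * indicator {real n / t..<real (Suc n) / t} v \<partial>lborel) = ennreal (G n / t)" .
  qed
  finally show ?thesis .
qed

text \<open>Writing \<open>1 - exp(-v)\<close> as the integral of \<open>exp(-w)\<close> over \<open>0 \<le> w \<le> v\<close> and exchanging the integrals leaves
\<open>\<integral> exp(-w) w\<^sup>-\<^sup>\<alpha>/\<alpha> dw\<close>, a Gamma integral.\<close>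

lemma nn_integral_one_minus_exp:
  assumes \<alpha>: "0 < \<alpha>" "\<alpha> < 1"
  shows "(\<integral>\<^sup>+ v. ennreal (indicator {0<..} v * (1 - exp (- v)) * v powr -(1 + \<alpha>)) \<partial>lborel)
    = ennreal (Gamma (1 - \<alpha>) / \<alpha>)"
proof -
  have G: "0 < Gamma (1 - \<alpha>)" using assms by (simp add: Gamma_real_pos)
  have "(\<integral>\<^sup>+ v. ennreal (indicator {0<..} v * (1 - exp (- v)) * v powr -(1 + \<alpha>)) \<partial>lborel)
    = (\<integral>\<^sup>+ v. (\<integral>\<^sup>+ w. ennreal (indicator {0<..} v * v powr -(1 + \<alpha>)) * ennreal (exp (- w)) * indicator {0..v} w \<partial>lborel) \<partial>lborel)"
  proof (intro nn_integral_cong)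
    fix v :: real
    show "ennreal (indicator {0<..} v * (1 - exp (- v)) * v powr -(1 + \<alpha>)) =
      (\<integral>\<^sup>+ w. ennreal (indicator {0<..} v * v powr -(1 + \<alpha>)) * ennreal (exp (- w)) * indicator {0..v} w \<partial>lborel)"
    proof (cases "0 < v")
      case True
      have "(\<integral>\<^sup>+ w. ennreal (exp (- w)) * indicator {0..v} w \<partial>lborel) = ennreal ((- exp (- v)) - (- exp (- 0)))"
        by (rule nn_integral_FTC_Icc) (use True in \<open>auto intro!: derivative_eq_intros\<close>)
      then show ?thesis
        using True by (subst mult.assoc, subst nn_integral_cmult)
          (auto simp: ennreal_mult[symmetric] mult.commute)
    qed simp
  qed
  also have "\<dots> = (\<integral>\<^sup>+ w. (\<integral>\<^sup>+ v. ennreal (indicator {0<..} v * v powr -(1 + \<alpha>)) * ennreal (exp (- w)) * indicator {0..v} w \<partial>lborel) \<partial>lborel)"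
    by (rule lborel_pair.Fubini') (simp add: indicator_def)
  also have "\<dots> = (\<integral>\<^sup>+ w. ennreal (1 / \<alpha>) * ennreal (indicator {0..} w * w powr ((1 - \<alpha>) - 1) / exp w) \<partial>lborel)"
  proof (rule nn_integral_cong_AE)
    have "AE w in lborel. w \<noteq> (0::real)" by (rule AE_lborel_singleton)
    then show "AE w in lborel. (\<integral>\<^sup>+ v. ennreal (indicator {0<..} v * v powr -(1 + \<alpha>)) * ennreal (exp (- w)) * indicator {0..v} w \<partial>lborel)
        = ennreal (1 / \<alpha>) * ennreal (indicator {0..} w * w powr ((1 - \<alpha>) - 1) / exp w)"
    proof eventually_elim
      case (elim w)
      show ?case
      proof (cases "0 < w")
        case True
        have "(\<integral>\<^sup>+ v. ennreal (indicator {0<..} v * v powr -(1 + \<alpha>)) * ennreal (exp (- w)) * indicator {0..v} w \<partial>lborel)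
          = (\<integral>\<^sup>+ v. ennreal (exp (- w)) * ennreal (indicator {w..} v * v powr -(1 + \<alpha>)) \<partial>lborel)"
          using True by (intro nn_integral_cong) (auto simp: indicator_def mult.commute)
        also have "\<dots> = ennreal (exp (- w)) * (\<integral>\<^sup>+ v. ennreal (indicator {w..} v * v powr -(1 + \<alpha>)) \<partial>lborel)"
          by (rule nn_integral_cmult) simp
        also have "(\<integral>\<^sup>+ v. ennreal (indicator {w..} v * v powr -(1 + \<alpha>)) \<partial>lborel)
            = ennreal (- (w powr (-(1 + \<alpha>) + 1)) / (-(1 + \<alpha>) + 1))"
          using \<alpha> True by (intro nn_integral_has_integral_lebesgue has_integral_powr_to_inf) auto
        also have "- (w powr (-(1 + \<alpha>) + 1)) / (-(1 + \<alpha>) + 1) = w powr -\<alpha> / \<alpha>" by simp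
        also have "ennreal (exp (- w)) * ennreal (w powr -\<alpha> / \<alpha>)
            = ennreal (1 / \<alpha>) * ennreal (indicator {0..} w * w powr ((1 - \<alpha>) - 1) / exp w)"
          using True \<alpha> by (simp add: ennreal_mult[symmetric] exp_minus field_simps)
        finally show ?thesis .
      qed (use elim in simp)
    qed
  qed
  also have "\<dots> = ennreal (1 / \<alpha>) * ennreal (Gamma (1 - \<alpha>))"
    using \<alpha> by (subst nn_integral_cmult) (auto simp: Gamma_conv_nn_integral_real)
  also have "\<dots> = ennreal (Gamma (1 - \<alpha>) / \<alpha>)"
    using \<alpha> G by (simp add: ennreal_mult[symmetric])
  finally show ?thesis .
qed

text \<open>After the substitution \<open>n = \<lfloor>t v\<rfloor>\<close> the normalised sum is the integral over \<open>v\<close> of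
\<open>(1 - exp(-n/t)) (L(n)/L(t)) (n/t)\<^bsup>-1-\<alpha>\<^esup>\<close>, whose integrand tends to \<open>(1 - exp(-v)) v\<^bsup>-1-\<alpha>\<^esup>\<close>.  The
Potter bounds supply a dominating function.  The cut-off \<open>N\<close> discards the indices where \<open>L\<close> is not
controlled; it does not affect the limit.\<close>

lemma abelian_limit:
  assumes L: "slowly_varying L" and \<alpha>: "0 < \<alpha>" "\<alpha> < 1"
  shows "\<forall>\<^sub>F N in sequentially.
    ((\<lambda>t. t powr \<alpha> / L t * (\<Sum>n. indicator {N..} n * (1 - exp (- (real n / t))) * (L (real n) / real n powr (1 + \<alpha>))))
      \<longlongrightarrow> Gamma (1 - \<alpha>) / \<alpha>) at_top"
proof -
  \<comment> \<open>This exponent keeps the dominating function integrable both at 0 and at infinity.\<close>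
  define \<epsilon> where "\<epsilon> = min \<alpha> (1 - \<alpha>) / 2"
  have \<epsilon>: "0 < \<epsilon>" "\<epsilon> < \<alpha>" "\<epsilon> < 1 - \<alpha>" using \<alpha> by (auto simp: \<epsilon>_def min_def field_simps)
  obtain T where T: "1 \<le> T" "\<And>t. T \<le> t \<Longrightarrow> 0 < L t"
    "\<And>s t. T \<le> s \<Longrightarrow> T \<le> t \<Longrightarrow> \<bar>ln (L s) - ln (L t)\<bar> \<le> \<epsilon> * (\<bar>ln s - ln t\<bar> + 1)"
    using slowly_varying_uniform[OF L \<epsilon>(1)] by metis
  show ?thesis
    using eventually_ge_at_top[of "nat \<lceil>T\<rceil>"]
  proof eventually_elim
    case (elim N)
    have N: "T \<le> real n" if "N \<le> n" for n using elim that by linarith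
    have N1: "1 \<le> N" using N[of N] T by simp
    define G where "G t n = indicator {N..} n * (1 - exp (- (real n / t))) * (L (real n) / L t) * (real n / t) powr -(1 + \<alpha>)" for t n
    define C where "C = exp (\<epsilon> * (ln 2 + 1)) * 2 powr (1 + \<alpha>)"
    define W where "W v = indicator {0..1} v * (C * v powr (-\<alpha> - \<epsilon>)) + indicator {1..} v * (C * v powr (-(1 + \<alpha>) + \<epsilon>))" for v :: real
    have C: "0 < C" by (simp add: C_def)
    have G_nonneg: "0 \<le> G t n" if "T \<le> t" for t n
    proof (cases "N \<le> n")
      case True
      have "0 \<le> 1 - exp (- (real n / t))" "0 \<le> L (real n) / L t"
        using T(1) T(2)[OF that] T(2)[OF N[OF True]] that by auto
      then show ?thesis unfolding G_def by (intro mult_nonneg_nonneg) auto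
    qed (simp add: G_def)
    have bound: "G t (nat \<lfloor>t * v\<rfloor>) \<le> W v" if t: "T \<le> t" and v: "0 \<le> v" for t v
    proof (cases "N \<le> nat \<lfloor>t * v\<rfloor>")
      case False
      then show ?thesis using C by (simp add: G_def W_def)
    next
      case True
      define n where "n = nat \<lfloor>t * v\<rfloor>"
      define r where "r = real n / t"
      have tpos: "0 < t" using t T by linarith
      \<comment> \<open>Because \<open>n \<ge> 1\<close>, rounding down loses at most a factor 2: \<open>v/2 \<le> n/t \<le> v\<close>.\<close>
      have n1: "1 \<le> real n" using True N1 by (simp add: n_def)
      have "0 \<le> t * v" using tpos v by simp
      then have n2: "real n \<le> t * v" "t * v < real n + 1" by (auto simp: n_def)
      have v0: "0 < v" using n1 n2 tpos by (smt (verit) mult_nonneg_nonpos)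
      have r: "0 < r" "r \<le> v" "v / 2 \<le> r" using n1 n2 tpos by (auto simp: r_def field_simps)
      have "\<bar>ln r\<bar> \<le> \<bar>ln v\<bar> + ln 2"
      proof -
        have "ln r \<le> ln v" using r v0 by simp
        moreover have "ln (v / 2) \<le> ln r" using r v0 by (subst ln_le_cancel_iff) auto
        ultimately show ?thesis using v0 by (simp add: ln_div)
      qed
      moreover have "ln (real n) - ln t = ln r" using n1 tpos by (simp add: r_def ln_div)
      ultimately have "\<epsilon> * (\<bar>ln (real n) - ln t\<bar> + 1) \<le> \<epsilon> * (\<bar>ln v\<bar> + ln 2 + 1)"
        using \<epsilon> by (intro mult_left_mono) auto
      moreover have "\<bar>ln (L (real n)) - ln (L t)\<bar> \<le> \<epsilon> * (\<bar>ln (real n) - ln t\<bar> + 1)"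
        using T(3)[OF N t] True by (simp add: n_def)
      ultimately have "ln (L (real n)) - ln (L t) \<le> \<epsilon> * (\<bar>ln v\<bar> + ln 2 + 1)" by linarith
      then have "exp (ln (L (real n)) - ln (L t)) \<le> exp (\<epsilon> * (\<bar>ln v\<bar> + ln 2 + 1))" by simp
      moreover have "exp (ln (L (real n)) - ln (L t)) = L (real n) / L t"
        using T(2)[OF t] T(2)[OF N[of n]] True by (simp add: exp_diff n_def)
      ultimately have b1: "L (real n) / L t \<le> exp (\<epsilon> * (ln 2 + 1)) * exp (\<epsilon> * \<bar>ln v\<bar>)"
        by (simp add: exp_add[symmetric] algebra_simps)
      have "r powr -(1 + \<alpha>) \<le> (v / 2) powr -(1 + \<alpha>)" using r v0 \<alpha> by (intro powr_mono2') auto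
      also have "(v / 2) powr -(1 + \<alpha>) = 2 powr (1 + \<alpha>) * v powr -(1 + \<alpha>)"
        unfolding divide_powr_minus[OF less_imp_le[OF v0] zero_le_numeral]
        by (simp only: powr_minus divide_inverse)
      finally have b2: "r powr -(1 + \<alpha>) \<le> 2 powr (1 + \<alpha>) * v powr -(1 + \<alpha>)" .
      have b3: "1 - exp (- r) \<le> min 1 v"
        using exp_ge_add_one_self[of "- r"] r by auto
      have nn: "0 \<le> L (real n) / L t" using T(2)[OF t] T(2)[OF N[of n]] True by (simp add: n_def)
      have "G t n = (1 - exp (- r)) * (L (real n) / L t) * r powr -(1 + \<alpha>)"
        using True by (simp add: G_def n_def r_def)
      also have "\<dots> \<le> min 1 v * (exp (\<epsilon> * (ln 2 + 1)) * exp (\<epsilon> * \<bar>ln v\<bar>)) * (2 powr (1 + \<alpha>) * v powr -(1 + \<alpha>))"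
        using b1 b2 b3 nn v0 by (intro mult_mono) auto
      also have "\<dots> = C * (min 1 v * exp (\<epsilon> * \<bar>ln v\<bar>) * v powr -(1 + \<alpha>))" by (simp add: C_def)
      also have "\<dots> \<le> W v"
      proof (cases "v \<le> 1")
        case True
        have "min 1 v * exp (\<epsilon> * \<bar>ln v\<bar>) * v powr -(1 + \<alpha>) = v powr (-\<alpha> - \<epsilon>)"
        proof -
          have "\<bar>ln v\<bar> = - ln v" using True v0 by simp
          then have "exp (\<epsilon> * \<bar>ln v\<bar>) = v powr -\<epsilon>" using v0 by (simp add: powr_def)
          moreover have "min 1 v = v powr 1" using True v0 by simp
          ultimately show ?thesis by (simp only: powr_add[symmetric]) (rule arg_cong[where f = "(powr) v"], simp)
        qed
        then show ?thesis using True v0 C by (simp add: W_def indicator_def)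
      next
        case False
        have "min 1 v * exp (\<epsilon> * \<bar>ln v\<bar>) * v powr -(1 + \<alpha>) = v powr (-(1 + \<alpha>) + \<epsilon>)"
          using False v0 by (simp add: powr_def exp_add[symmetric] algebra_simps)
        then show ?thesis using False by (simp add: W_def)
      qed
      finally show ?thesis by (simp add: n_def)
    qed
    have W_int: "integrable lborel W"
    proof -
      have 1: "(\<integral>\<^sup>+ v. ennreal (indicator {0..1} v * v powr (-\<alpha> - \<epsilon>)) \<partial>lborel) < \<infinity>"
        using nn_integral_has_integral_lebesgue[OF _ has_integral_powr_from_0[of "-\<alpha> - \<epsilon>" 1]] \<epsilon> \<alpha> by simp
      have 2: "(\<integral>\<^sup>+ v. ennreal (indicator {1..} v * v powr (-(1 + \<alpha>) + \<epsilon>)) \<partial>lborel) < \<infinity>"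
        using nn_integral_has_integral_lebesgue[OF _ has_integral_powr_to_inf[of "-(1 + \<alpha>) + \<epsilon>" 1]] \<epsilon> \<alpha> by simp
      have "integrable lborel (\<lambda>v. C * (indicator {0..1} v * v powr (-\<alpha> - \<epsilon>)))"
        "integrable lborel (\<lambda>v. C * (indicator {1..} v * v powr (-(1 + \<alpha>) + \<epsilon>)))"
        using 1 2 by (auto intro!: integrable_mult_right integrableI_nonneg)
      then show ?thesis unfolding W_def by (simp add: mult.left_commute)
    qed
    define F where "F t v = (if T \<le> t then indicator {0..} v * G t (nat \<lfloor>t * v\<rfloor>) else 0)" for t v
    have F_nn: "0 \<le> F t v" "F t v \<le> W v" for t v
    proof -
      show "0 \<le> F t v" using G_nonneg by (simp add: F_def)
      have "0 \<le> W v" using C by (simp add: W_def)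
      then show "F t v \<le> W v" using bound[of t v] by (auto simp: F_def indicator_def)
    qed
    have F_meas [measurable]: "F t \<in> borel_measurable borel" for t
    proof -
      have "G t \<in> measurable (count_space UNIV) borel" by simp
      then have "(\<lambda>v. G t (nat \<lfloor>t * v\<rfloor>)) \<in> borel_measurable borel" by measurable
      then show ?thesis unfolding F_def[abs_def] by measurable
    qed
    have F_lim: "((\<lambda>t. F t v) \<longlongrightarrow> indicator {0<..} v * (1 - exp (- v)) * v powr -(1 + \<alpha>)) at_top" if "v \<noteq> 0" for v
    proof (cases "0 < v")
      case False
      then have "F t v = 0" for t using that by (auto simp: F_def)
      then show ?thesis using False by simp
    next
      case True
      define s where "s t = real (nat \<lfloor>t * v\<rfloor>)" for t
      have s_bounds: "v - 1 / t \<le> s t / t" "s t / t \<le> v" if "0 < t" for t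
      proof -
        have "0 \<le> t * v" using that True by simp
        then have "s t \<le> t * v" "t * v \<le> s t + 1" unfolding s_def by linarith+
        then have "(t * v - 1) / t \<le> s t / t" "s t / t \<le> v"
          using that by (auto intro: divide_right_mono simp: pos_divide_le_eq mult.commute)
        then show "v - 1 / t \<le> s t / t" "s t / t \<le> v" using that by (simp_all add: diff_divide_distrib)
      qed
      have inv: "((\<lambda>t::real. 1 / t) \<longlongrightarrow> 0) at_top"
        using tendsto_inverse_0_at_top[OF filterlim_ident] by (simp add: inverse_eq_divide)
      have s_lim: "((\<lambda>t. s t / t) \<longlongrightarrow> v) at_top"
      proof (rule tendsto_sandwich)
        show "((\<lambda>t. v - 1 / t) \<longlongrightarrow> v) at_top" using tendsto_diff[OF tendsto_const inv, of v] by simp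
        show "\<forall>\<^sub>F t in at_top. v - 1 / t \<le> s t / t"
          by (rule eventually_mono[OF eventually_gt_at_top[of 0] s_bounds(1)])
        show "\<forall>\<^sub>F t in at_top. s t / t \<le> v"
          by (rule eventually_mono[OF eventually_gt_at_top[of 0] s_bounds(2)])
      qed simp
      have "((\<lambda>t. (1 - exp (- (s t / t))) * (L (s t) / L t) * (s t / t) powr -(1 + \<alpha>))
          \<longlongrightarrow> (1 - exp (- v)) * 1 * v powr -(1 + \<alpha>)) at_top"
        using True by (intro tendsto_intros s_lim slowly_varying_ratio[OF L s_lim]) auto
      moreover have "\<forall>\<^sub>F t in at_top. (1 - exp (- (s t / t))) * (L (s t) / L t) * (s t / t) powr -(1 + \<alpha>) = F t v"
        using eventually_ge_at_top[of T] eventually_ge_at_top[of "(real N + 1) / v"]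
      proof eventually_elim
        case (elim t)
        then have "real N + 1 \<le> t * v" using True by (simp add: field_simps)
        then have "N \<le> nat \<lfloor>t * v\<rfloor>" by linarith
        then show ?case using elim True by (simp add: F_def G_def s_def)
      qed
      ultimately show ?thesis using True by (simp add: tendsto_cong)
    qed
    have "((\<lambda>t. \<integral> v. F t v \<partial>lborel) \<longlongrightarrow> (\<integral> v. indicator {0<..} v * (1 - exp (- v)) * v powr -(1 + \<alpha>) \<partial>lborel)) at_top"
    proof (rule integral_dominated_convergence_at_top[OF _ _ W_int])
      show "AE v in lborel. ((\<lambda>t. F t v) \<longlongrightarrow> indicator {0<..} v * (1 - exp (- v)) * v powr -(1 + \<alpha>)) at_top"
        using AE_lborel_singleton[of 0] by eventually_elim (rule F_lim)
    qed (use F_nn in auto)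
    also have "(\<integral> v. indicator {0<..} v * (1 - exp (- v)) * v powr -(1 + \<alpha>) \<partial>lborel) = Gamma (1 - \<alpha>) / \<alpha>"
    proof -
      have "(\<integral> v. indicator {0<..} v * (1 - exp (- v)) * v powr -(1 + \<alpha>) \<partial>lborel)
          = enn2real (\<integral>\<^sup>+ v. ennreal (indicator {0<..} v * (1 - exp (- v)) * v powr -(1 + \<alpha>)) \<partial>lborel)"
        by (rule integral_eq_nn_integral) (auto simp: indicator_def)
      then show ?thesis
        unfolding nn_integral_one_minus_exp[OF \<alpha>] using \<alpha> Gamma_real_pos[of "1 - \<alpha>"] by simp
    qed
    finally have lim: "((\<lambda>t. \<integral> v. F t v \<partial>lborel) \<longlongrightarrow> Gamma (1 - \<alpha>) / \<alpha>) at_top" .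
    moreover have "\<forall>\<^sub>F t in at_top. (\<integral> v. F t v \<partial>lborel) =
      t powr \<alpha> / L t * (\<Sum>n. indicator {N..} n * (1 - exp (- (real n / t))) * (L (real n) / real n powr (1 + \<alpha>)))"
      using eventually_ge_at_top[of T]
    proof eventually_elim
      case (elim t)
      have tpos: "0 < t" using elim T by linarith
      have nn: "(\<integral>\<^sup>+ v. ennreal (F t v) \<partial>lborel) = (\<Sum>n. ennreal (G t n / t))"
        using nn_integral_step_function[OF tpos, of "G t"] G_nonneg[OF elim] elim by (simp add: F_def)
      have "(\<integral>\<^sup>+ v. ennreal (F t v) \<partial>lborel) \<le> (\<integral>\<^sup>+ v. ennreal (W v) \<partial>lborel)"
        using F_nn by (intro nn_integral_mono ennreal_leI)
      also have "\<dots> < \<infinity>"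
      proof -
        have "(\<integral>\<^sup>+ v. ennreal (W v) \<partial>lborel) = ennreal (\<integral> v. W v \<partial>lborel)"
          by (rule nn_integral_eq_integral[OF W_int]) (use C in \<open>auto simp: W_def\<close>)
        then show ?thesis by simp
      qed
      finally have fin: "(\<Sum>n. ennreal (G t n / t)) \<noteq> \<infinity>" using nn by simp
      have Gt: "0 \<le> G t n / t" for n using G_nonneg[OF elim] tpos by simp
      have sG: "summable (\<lambda>n. G t n / t)"
        using fin Gt by (intro summable_suminf_not_top) auto
      have "(\<integral> v. F t v \<partial>lborel) = enn2real (\<Sum>n. ennreal (G t n / t))"
        using F_nn nn by (subst integral_eq_nn_integral) auto
      also have "\<dots> = (\<Sum>n. G t n / t)"
        by (subst suminf_ennreal2[OF Gt sG], rule enn2real_ennreal, rule suminf_nonneg[OF sG Gt])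
      also have "\<dots> = (\<Sum>n. t powr \<alpha> / L t * (indicator {N..} n * (1 - exp (- (real n / t))) * (L (real n) / real n powr (1 + \<alpha>))))"
      proof (intro suminf_cong)
        fix n
        have "(real n / t) powr -(1 + \<alpha>) = t powr (1 + \<alpha>) / real n powr (1 + \<alpha>)"
          using tpos by (intro divide_powr_minus) auto
        moreover have "t powr (1 + \<alpha>) = t * t powr \<alpha>" using tpos by (simp add: powr_add)
        ultimately show "G t n / t = t powr \<alpha> / L t * (indicator {N..} n * (1 - exp (- (real n / t))) * (L (real n) / real n powr (1 + \<alpha>)))"
          using tpos by (simp add: G_def)
      qed
      also have "\<dots> = t powr \<alpha> / L t * (\<Sum>n. indicator {N..} n * (1 - exp (- (real n / t))) * (L (real n) / real n powr (1 + \<alpha>)))"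
      proof (rule suminf_mult)
        have "summable (\<lambda>n. L t / t powr \<alpha> * (G t n / t))" using sG by (rule summable_mult)
        moreover have "L t / t powr \<alpha> * (G t n / t) = indicator {N..} n * (1 - exp (- (real n / t))) * (L (real n) / real n powr (1 + \<alpha>))" for n
        proof -
          have "(real n / t) powr -(1 + \<alpha>) = t powr (1 + \<alpha>) / real n powr (1 + \<alpha>)"
            using tpos by (intro divide_powr_minus) auto
          moreover have "t powr (1 + \<alpha>) = t * t powr \<alpha>" using tpos by (simp add: powr_add)
          ultimately show ?thesis using tpos T(2)[OF elim] by (simp add: G_def)
        qed
        ultimately show "summable (\<lambda>n. indicator {N..} n * (1 - exp (- (real n / t))) * (L (real n) / real n powr (1 + \<alpha>)))"
          by (simp only:)
      qed
      finally show ?case .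
    qed
    ultimately show ?case by (simp add: tendsto_cong)
  qed
qed


text \<open>A family of sequences whose tails are uniformly equivalent to \<open>\<Phi>(z) L(n) n\<^bsup>-1-\<alpha>\<^esup>\<close> inherits the limit
uniformly: for \<open>n \<ge> N\<close> the error is relative and small, while the finitely many earlier terms contribute
at most \<open>N M / t\<close>, which is negligible against \<open>t\<^sup>-\<^sup>\<alpha> L(t)\<close> because \<open>\<alpha> < 1\<close>.\<close>

lemma abelian_limit_uniform:
  fixes \<kappa> :: "'z \<Rightarrow> nat \<Rightarrow> real" and \<Phi> :: "'z \<Rightarrow> real"
  assumes L: "slowly_varying L" and \<alpha>: "0 < \<alpha>" "\<alpha> < 1"
    and \<Phi>: "\<And>z. 0 < \<Phi> z" "\<And>z. \<Phi> z \<le> B"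
    and \<kappa>: "\<And>z n. 1 \<le> n \<Longrightarrow> 0 \<le> \<kappa> z n" "\<And>z. summable (\<lambda>n. \<kappa> z (Suc n))" "\<And>z. (\<Sum>n. \<kappa> z (Suc n)) \<le> M"
    and unif: "uniform_limit UNIV (\<lambda>n z. \<kappa> z n / (\<Phi> z * L (real n) / real n powr (1 + \<alpha>))) (\<lambda>_. 1) sequentially"
  shows "uniform_limit UNIV
    (\<lambda>t z. t powr \<alpha> / L t * (\<Sum>n. (1 - exp (- (real (Suc n) / t))) * \<kappa> z (Suc n)))
    (\<lambda>z. \<Phi> z * (Gamma (1 - \<alpha>) / \<alpha>)) at_top"
proof (rule uniform_limitI)
  fix e :: real assume "0 < e"
  define g where "g = Gamma (1 - \<alpha>) / \<alpha>"
  have g: "0 < g" using \<alpha> by (simp add: g_def Gamma_real_pos)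
  have B: "0 < B" using \<Phi>[of undefined] by linarith
  define \<epsilon> where "\<epsilon> = min (1 / 2) (e / (3 * B * (g + 1)))"
  have \<epsilon>: "0 < \<epsilon>" "\<epsilon> \<le> 1 / 2" "\<epsilon> * (B * (g + 1)) \<le> e / 3"
  proof -
    have "0 < 3 * B * (g + 1)" using g B by simp
    then show "0 < \<epsilon>" "\<epsilon> \<le> 1 / 2" using \<open>0 < e\<close> by (auto simp: \<epsilon>_def)
    have "\<epsilon> * (B * (g + 1)) \<le> e / (3 * B * (g + 1)) * (B * (g + 1))"
      using g B by (intro mult_right_mono) (auto simp: \<epsilon>_def)
    also have "\<dots> = e / 3" using g B by (simp add: divide_simps)
    finally show "\<epsilon> * (B * (g + 1)) \<le> e / 3" .
  qed
  obtain T where T: "1 \<le> T" "\<And>t. T \<le> t \<Longrightarrow> 0 < L t"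
    using slowly_varying_uniform[OF L zero_less_one] by metis
  define c where "c n = L (real n) / real n powr (1 + \<alpha>)" for n
  define S where "S N t = (\<Sum>n. indicator {N..} n * (1 - exp (- (real n / t))) * c n)" for N t
  have "\<forall>\<^sub>F n in sequentially. \<forall>z\<in>UNIV. dist (\<kappa> z n / (\<Phi> z * L (real n) / real n powr (1 + \<alpha>))) 1 < \<epsilon>"
    by (rule uniform_limitD[OF unif \<epsilon>(1)])
  then have "\<forall>\<^sub>F N in sequentially. \<forall>n\<ge>N. \<forall>z. dist (\<kappa> z n / (\<Phi> z * L (real n) / real n powr (1 + \<alpha>))) 1 < \<epsilon>"
    by (simp add: eventually_all_ge_at_top)
  moreover have "\<forall>\<^sub>F N in sequentially. ((\<lambda>t. t powr \<alpha> / L t * S N t) \<longlongrightarrow> g) at_top"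
    using abelian_limit[OF L \<alpha>] by (simp add: S_def c_def g_def)
  ultimately have "\<forall>\<^sub>F N in sequentially. T \<le> real N \<and> ((\<lambda>t. t powr \<alpha> / L t * S N t) \<longlongrightarrow> g) at_top \<and>
      (\<forall>n\<ge>N. \<forall>z. dist (\<kappa> z n / (\<Phi> z * L (real n) / real n powr (1 + \<alpha>))) 1 < \<epsilon>)"
    using eventually_ge_at_top[of "nat \<lceil>T\<rceil>"] by eventually_elim (auto simp: nat_ceiling_le_eq)
  then obtain N where N: "T \<le> real N" "((\<lambda>t. t powr \<alpha> / L t * S N t) \<longlongrightarrow> g) at_top"
    "\<And>n z. N \<le> n \<Longrightarrow> dist (\<kappa> z n / (\<Phi> z * L (real n) / real n powr (1 + \<alpha>))) 1 < \<epsilon>"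
    by (auto dest: eventually_happens)
  have c_pos: "0 < c n" if "N \<le> n" for n
    using that N(1) T(1) T(2)[of "real n"] by (auto simp: c_def)
  have near: "\<bar>\<kappa> z n - \<Phi> z * c n\<bar> \<le> \<epsilon> * (\<Phi> z * c n)" if "N \<le> n" for z n
  proof -
    have p: "0 < \<Phi> z * c n" using c_pos[OF that] \<Phi>(1)[of z] by simp
    have "\<bar>\<kappa> z n / (\<Phi> z * c n) - 1\<bar> < \<epsilon>" using N(3)[OF that, of z] by (simp add: c_def dist_real_def)
    moreover have "\<kappa> z n / (\<Phi> z * c n) - 1 = (\<kappa> z n - \<Phi> z * c n) / (\<Phi> z * c n)"
      using \<Phi>(1)[of z] c_pos[OF that] by (simp add: diff_divide_distrib)
    ultimately have "\<bar>\<kappa> z n - \<Phi> z * c n\<bar> / (\<Phi> z * c n) < \<epsilon>" using p by (simp add: abs_divide)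
    then show ?thesis using p by (simp add: pos_divide_less_eq)
  qed
  have "((\<lambda>t. real N * M * (t powr -(1 - \<alpha>) / L t)) \<longlongrightarrow> 0) at_top"
    using \<alpha> by (intro tendsto_mult_right_zero slowly_varying_sub_powr(2)[OF L]) auto
  then have "\<forall>\<^sub>F t in at_top. real N * M * (t powr -(1 - \<alpha>) / L t) < e / 3"
    using \<open>0 < e\<close> by (intro order_tendstoD) auto
  moreover have "\<forall>\<^sub>F t in at_top. dist (t powr \<alpha> / L t * S N t) g < min 1 (e / (3 * B))"
    using \<open>0 < e\<close> B by (intro tendstoD[OF N(2)]) auto
  ultimately show "\<forall>\<^sub>F t in at_top. \<forall>z\<in>UNIV.
      dist (t powr \<alpha> / L t * (\<Sum>n. (1 - exp (- (real (Suc n) / t))) * \<kappa> z (Suc n))) (\<Phi> z * (Gamma (1 - \<alpha>) / \<alpha>)) < e"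
    using eventually_ge_at_top[of T]
  proof eventually_elim
    case (elim t)
    show ?case
    proof
      fix z
      have t: "0 < t" "0 < L t" using elim T by auto
      define q where "q = t powr \<alpha> / L t"
      have q: "0 < q" using t by (simp add: q_def)
      define E where "E n = 1 - exp (- (real n / t))" for n
      have E: "0 \<le> E n" "E n \<le> 1" "E n \<le> real n / t" for n
        using t exp_ge_add_one_self[of "- (real n / t)"] by (auto simp: E_def)
      define a where "a n = E (Suc n) * \<kappa> z (Suc n)" for n
      define D where "D n = indicator {N..} (Suc n) * E (Suc n) * c (Suc n)" for n
      have D_nonneg: "0 \<le> D n" for n using E(1)[of "Suc n"] c_pos[of "Suc n"] by (auto simp: D_def indicator_def)
      have sa: "summable a"
        by (rule summable_comparison_test'[OF \<kappa>(2)[of z]])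
          (use E \<kappa>(1) in \<open>auto simp: a_def abs_mult mult_left_le_one_le\<close>)
      have sD: "summable D"
      proof (rule summable_comparison_test'[OF summable_mult[OF \<kappa>(2)[of z], of "2 / \<Phi> z"]])
        fix n
        show "norm (D n) \<le> 2 / \<Phi> z * \<kappa> z (Suc n)"
        proof (cases "N \<le> Suc n")
          case True
          have "\<epsilon> * (\<Phi> z * c (Suc n)) \<le> 1 / 2 * (\<Phi> z * c (Suc n))"
            using \<epsilon> \<Phi>(1)[of z] c_pos[OF True] by (intro mult_right_mono) auto
          then have "\<Phi> z * c (Suc n) \<le> 2 * \<kappa> z (Suc n)"
            using near[OF True, of z] unfolding abs_le_iff by linarith
          then have "c (Suc n) \<le> 2 / \<Phi> z * \<kappa> z (Suc n)"
            using \<Phi>(1)[of z] by (simp add: field_simps)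
          moreover have "D n \<le> c (Suc n)"
            using True c_pos[OF True] E by (simp add: D_def mult_left_le_one_le)
          ultimately show ?thesis using D_nonneg[of n] by simp
        next
          case False
          then show ?thesis using \<kappa>(1)[of "Suc n" z] \<Phi>(1)[of z] by (simp add: D_def)
        qed
      qed
      have SD: "S N t = (\<Sum>n. D n)"
      proof -
        let ?f = "\<lambda>n. indicator {N..} n * E n * c n"
        have "summable ?f" using sD unfolding D_def by (rule summable_Suc_iff[THEN iffD1])
        then have "(\<Sum>n. ?f n) = (\<Sum>n. ?f (Suc n)) + ?f 0" using suminf_split_head[of ?f] by simp
        then show ?thesis by (simp add: S_def D_def E_def)
      qed
      have est: "\<bar>a n - \<Phi> z * D n\<bar> \<le> real N / t * \<kappa> z (Suc n) + \<epsilon> * \<Phi> z * D n" for n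
      proof (cases "N \<le> Suc n")
        case True
        have "a n - \<Phi> z * D n = E (Suc n) * (\<kappa> z (Suc n) - \<Phi> z * c (Suc n))"
          using True by (simp add: a_def D_def algebra_simps)
        then have "\<bar>a n - \<Phi> z * D n\<bar> = E (Suc n) * \<bar>\<kappa> z (Suc n) - \<Phi> z * c (Suc n)\<bar>"
          using E(1) by (simp add: abs_mult)
        also have "\<dots> \<le> E (Suc n) * (\<epsilon> * (\<Phi> z * c (Suc n)))"
          by (intro mult_left_mono near True E)
        also have "\<dots> = \<epsilon> * \<Phi> z * D n" using True by (simp add: D_def)
        also have "\<dots> \<le> real N / t * \<kappa> z (Suc n) + \<epsilon> * \<Phi> z * D n" using t \<kappa>(1)[of "Suc n" z] by simp
        finally show ?thesis .
      next
        case False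
        have "real (Suc n) / t \<le> real N / t" using False t by (intro divide_right_mono) auto
        then have "E (Suc n) \<le> real N / t" using E(3)[of "Suc n"] by linarith
        then have "E (Suc n) * \<kappa> z (Suc n) \<le> real N / t * \<kappa> z (Suc n)"
          using \<kappa>(1)[of "Suc n" z] by (intro mult_right_mono) auto
        then show ?thesis using False E(1)[of "Suc n"] \<kappa>(1)[of "Suc n" z] by (simp add: a_def D_def)
      qed
      have "\<bar>(\<Sum>n. a n) - \<Phi> z * S N t\<bar> = \<bar>\<Sum>n. a n - \<Phi> z * D n\<bar>"
        unfolding SD using sa sD by (subst suminf_diff[symmetric]) (auto intro: summable_mult simp: suminf_mult)
      also have "\<dots> \<le> (\<Sum>n. real N / t * \<kappa> z (Suc n) + \<epsilon> * \<Phi> z * D n)"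
      proof -
        have s2: "summable (\<lambda>n. real N / t * \<kappa> z (Suc n) + \<epsilon> * \<Phi> z * D n)"
          by (intro summable_add summable_mult \<kappa>(2) sD)
        have s1: "summable (\<lambda>n. \<bar>a n - \<Phi> z * D n\<bar>)"
          by (rule summable_comparison_test'[OF s2]) (use est in simp)
        show ?thesis using summable_rabs[OF s1] suminf_le[OF est s1 s2] by linarith
      qed
      also have "\<dots> = real N / t * (\<Sum>n. \<kappa> z (Suc n)) + \<epsilon> * \<Phi> z * S N t"
        unfolding SD using \<kappa>(2)[of z] sD
        by (subst suminf_add[symmetric]) (auto intro: summable_mult simp only: suminf_mult)
      also have "\<dots> \<le> real N / t * M + \<epsilon> * \<Phi> z * S N t"
        using t by (intro add_right_mono mult_left_mono \<kappa>(3)) auto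
      finally have scaled: "q * \<bar>(\<Sum>n. a n) - \<Phi> z * S N t\<bar> \<le> q * (real N / t * M + \<epsilon> * \<Phi> z * S N t)"
        using q by (intro mult_left_mono) auto
      have 1: "\<bar>q * (\<Sum>n. a n) - \<Phi> z * (q * S N t)\<bar> \<le> q * (real N / t * M) + \<epsilon> * \<Phi> z * (q * S N t)"
      proof -
        have "q * (\<Sum>n. a n) - \<Phi> z * (q * S N t) = q * ((\<Sum>n. a n) - \<Phi> z * S N t)"
          by (simp add: right_diff_distrib)
        then show ?thesis
          using scaled q by (simp add: abs_mult distrib_left mult.left_commute mult.assoc)
      qed
      have "t powr \<alpha> / t = t powr -(1 - \<alpha>)" using t powr_diff[of t \<alpha> 1] by simp
      moreover have "q * (real N / t * M) = real N * M * ((t powr \<alpha> / t) / L t)" by (simp add: q_def mult_ac)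
      ultimately have 2: "q * (real N / t * M) < e / 3" using elim(1) by (simp only:)
      have 3: "\<bar>q * S N t - g\<bar> < 1" "\<bar>q * S N t - g\<bar> < e / (3 * B)"
        using elim(2) by (auto simp: q_def dist_real_def)
      have "0 \<le> q * S N t" unfolding SD using q D_nonneg sD by (intro mult_nonneg_nonneg suminf_nonneg) auto
      then have "\<Phi> z * (q * S N t) \<le> B * (g + 1)"
        using 3(1) B \<Phi>(2)[of z] g by (intro mult_mono) auto
      then have "\<epsilon> * (\<Phi> z * (q * S N t)) \<le> \<epsilon> * (B * (g + 1))" using \<epsilon> by (intro mult_left_mono) auto
      then have 4: "\<epsilon> * \<Phi> z * (q * S N t) \<le> e / 3"
        using \<epsilon>(3) unfolding mult.assoc by linarith
      have "\<bar>\<Phi> z * (q * S N t) - \<Phi> z * g\<bar> = \<Phi> z * \<bar>q * S N t - g\<bar>"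
        using \<Phi>(1)[of z] abs_mult[of "\<Phi> z" "q * S N t - g"] by (simp add: right_diff_distrib)
      also have "\<dots> \<le> B * \<bar>q * S N t - g\<bar>" using \<Phi>(2)[of z] by (intro mult_right_mono) auto
      also have "\<dots> < B * (e / (3 * B))" using 3(2) B by (intro mult_strict_left_mono) auto
      finally have 5: "\<bar>\<Phi> z * (q * S N t) - \<Phi> z * g\<bar> < e / 3" using B by simp
      have "\<bar>q * (\<Sum>n. a n) - \<Phi> z * g\<bar> < e" using 1 2 4 5 by linarith
      then show "dist (t powr \<alpha> / L t * (\<Sum>n. (1 - exp (- (real (Suc n) / t))) * \<kappa> z (Suc n))) (\<Phi> z * (Gamma (1 - \<alpha>) / \<alpha>)) < e"
        by (simp add: q_def a_def[abs_def] E_def g_def dist_real_def)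
    qed
  qed
qed

section \<open>The Tauberian theorem of Karamata\<close>

text \<open>The Gamma distribution of shape \<open>\<alpha>\<close>.  The moments of \<open>exp(-v)\<close> under it are \<open>(m + 1)\<^sup>-\<^sup>\<alpha>\<close>, the values
that a Laplace transform behaving like \<open>l\<^sup>-\<^sup>\<alpha>\<close> produces at integer multiples of a small \<open>l\<close>.\<close>

definition gamma_law :: "real \<Rightarrow> real measure" where
  "gamma_law \<alpha> = density lborel (\<lambda>v. ennreal (indicator {0..} v * v powr (\<alpha> - 1) / exp v / Gamma \<alpha>))"

lemma sets_gamma_law [simp, measurable_cong]: "sets (gamma_law \<alpha>) = sets borel"
  by (simp add: gamma_law_def)

lemma space_gamma_law [simp]: "space (gamma_law \<alpha>) = UNIV"
  by (simp add: gamma_law_def)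

lemma nn_integral_gamma_law_exp:
  assumes "0 < \<alpha>" "0 < c"
  shows "(\<integral>\<^sup>+ v. ennreal (exp (- (c - 1) * v)) \<partial>gamma_law \<alpha>) = ennreal (c powr -\<alpha>)"
proof -
  have G: "0 < Gamma \<alpha>" using assms by (simp add: Gamma_real_pos)
  define I where "I = (\<integral>\<^sup>+ v. ennreal (indicator {0..} v * v powr (\<alpha> - 1) / exp (c * v)) \<partial>lborel)"
  have "ennreal (Gamma \<alpha>) = ennreal c * (\<integral>\<^sup>+ v. ennreal (indicator {0..} (c * v) * (c * v) powr (\<alpha> - 1) / exp (c * v)) \<partial>lborel)"
    by (subst Gamma_conv_nn_integral_real[OF assms(1)], subst nn_integral_real_affine[where c = c and t = 0])
      (use assms in auto)
  also have "(\<integral>\<^sup>+ v. ennreal (indicator {0..} (c * v) * (c * v) powr (\<alpha> - 1) / exp (c * v)) \<partial>lborel)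
     = (\<integral>\<^sup>+ v. ennreal (c powr (\<alpha> - 1)) * ennreal (indicator {0..} v * v powr (\<alpha> - 1) / exp (c * v)) \<partial>lborel)"
  proof (intro nn_integral_cong)
    fix v :: real
    have "(c * v) powr (\<alpha> - 1) = c powr (\<alpha> - 1) * v powr (\<alpha> - 1)" if "0 \<le> v"
      using that assms by (simp add: powr_mult)
    then show "ennreal (indicator {0..} (c * v) * (c * v) powr (\<alpha> - 1) / exp (c * v)) =
        ennreal (c powr (\<alpha> - 1)) * ennreal (indicator {0..} v * v powr (\<alpha> - 1) / exp (c * v))"
      using assms by (auto simp: indicator_def ennreal_mult[symmetric] zero_le_mult_iff)
  qed
  also have "\<dots> = ennreal (c powr (\<alpha> - 1)) * I"
    unfolding I_def by (rule nn_integral_cmult) simp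
  also have "ennreal c * (ennreal (c powr (\<alpha> - 1)) * I) = ennreal (c powr \<alpha>) * I"
  proof -
    have "c * c powr (\<alpha> - 1) = c powr \<alpha>" using assms by (simp add: powr_mult_base)
    then show ?thesis using assms by (simp add: mult.assoc[symmetric] ennreal_mult[symmetric])
  qed
  finally have I: "ennreal (Gamma \<alpha>) = ennreal (c powr \<alpha>) * I" .
  have "(\<integral>\<^sup>+ v. ennreal (exp (- (c - 1) * v)) \<partial>gamma_law \<alpha>)
      = (\<integral>\<^sup>+ v. ennreal (1 / Gamma \<alpha>) * ennreal (indicator {0..} v * v powr (\<alpha> - 1) / exp (c * v)) \<partial>lborel)"
    unfolding gamma_law_def using G
    by (subst nn_integral_density)
      (auto intro!: nn_integral_cong simp: ennreal_mult[symmetric] exp_diff field_simps)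
  also have "\<dots> = ennreal (1 / Gamma \<alpha>) * I"
    unfolding I_def by (rule nn_integral_cmult) simp
  also have "I = ennreal (c powr -\<alpha>) * (ennreal (c powr \<alpha>) * I)"
    using assms by (simp add: mult.assoc[symmetric] ennreal_mult[symmetric] powr_add[symmetric])
  also have "\<dots> = ennreal (c powr -\<alpha>) * ennreal (Gamma \<alpha>)" using I by simp
  also have "ennreal (1 / Gamma \<alpha>) * (ennreal (c powr -\<alpha>) * ennreal (Gamma \<alpha>)) = ennreal (c powr -\<alpha>)"
    using G by (simp add: ennreal_mult[symmetric])
  finally show ?thesis .
qed

lemma prob_space_gamma_law: "0 < \<alpha> \<Longrightarrow> prob_space (gamma_law \<alpha>)"
  using nn_integral_gamma_law_exp[of \<alpha> 1] by (intro prob_spaceI) simp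

lemma gamma_law_nonneg: "AE v in gamma_law \<alpha>. 0 \<le> v"
  unfolding gamma_law_def by (subst AE_density) (auto simp: indicator_def)

lemma integral_gamma_law_exp:
  assumes "0 < \<alpha>"
  shows "(\<integral> v. exp (- v) ^ m \<partial>gamma_law \<alpha>) = (real m + 1) powr -\<alpha>"
proof -
  have "(\<integral>\<^sup>+ v. ennreal (exp (- v) ^ m) \<partial>gamma_law \<alpha>) = ennreal ((real m + 1) powr -\<alpha>)"
    using nn_integral_gamma_law_exp[OF assms, of "real m + 1"] by (simp add: exp_of_nat_mult[symmetric])
  then show ?thesis by (subst integral_eq_nn_integral) auto
qed

lemma integral_gamma_law_exp_atMost:
  assumes "0 < \<alpha>" "0 \<le> b"
  shows "(\<integral> v. indicator {..b} v * exp v \<partial>gamma_law \<alpha>) = b powr \<alpha> / Gamma (1 + \<alpha>)"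
proof -
  have G: "0 < Gamma \<alpha>" using assms by (simp add: Gamma_real_pos)
  have "(\<integral>\<^sup>+ v. ennreal (indicator {..b} v * exp v) \<partial>gamma_law \<alpha>)
      = (\<integral>\<^sup>+ v. ennreal (1 / Gamma \<alpha>) * ennreal (indicator {0..b} v * v powr (\<alpha> - 1)) \<partial>lborel)"
    unfolding gamma_law_def using G
    by (subst nn_integral_density) (auto intro!: nn_integral_cong simp: ennreal_mult[symmetric] indicator_def)
  also have "\<dots> = ennreal (1 / Gamma \<alpha>) * (\<integral>\<^sup>+ v. ennreal (indicator {0..b} v * v powr (\<alpha> - 1)) \<partial>lborel)"
    by (rule nn_integral_cmult) simp
  also have "(\<integral>\<^sup>+ v. ennreal (indicator {0..b} v * v powr (\<alpha> - 1)) \<partial>lborel) = ennreal (b powr \<alpha> / \<alpha>)"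
    using has_integral_powr_from_0[of "\<alpha> - 1" b] assms
    by (intro nn_integral_has_integral_lebesgue) auto
  also have "ennreal (1 / Gamma \<alpha>) * ennreal (b powr \<alpha> / \<alpha>) = ennreal (b powr \<alpha> / Gamma (1 + \<alpha>))"
    using G assms Gamma_plus1[of \<alpha>]
    by (subst ennreal_mult[symmetric]) (auto simp: add.commute nonpos_Ints_def intro!: arg_cong[where f = ennreal])
  finally show ?thesis
    using assms G by (subst integral_eq_nn_integral) auto
qed

text \<open>The hypothesis on the limits says that the weights \<open>w\<^sub>n a\<^sub>i exp(-i/n)\<close>, placed at the points \<open>exp(-i/n)\<close> of the unit
interval, have moments converging to \<open>C\<close> times those of the image of the Gamma law under \<open>v \<mapsto> exp(-v)\<close>.  By the
theorem of Weierstrass polynomials may be replaced by continuous test functions.\<close>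

lemma weak_convergence_of_exponential_moments:
  fixes a w :: "nat \<Rightarrow> real"
  assumes "0 < \<alpha>" and a: "\<And>i. 0 \<le> a i" and sm: "\<And>l. 0 < l \<Longrightarrow> summable (\<lambda>i. a i * exp (- l * real i))"
    and w: "\<forall>\<^sub>F n in sequentially. 0 \<le> w n"
    and lim: "\<And>m. (\<lambda>n. w n * (\<Sum>i. a i * exp (- ((real m + 1) / real n) * real i)))
                 \<longlonglongrightarrow> C * (real m + 1) powr -\<alpha>"
    and f: "continuous_on UNIV f"
  shows "(\<lambda>n. w n * (\<Sum>i. a i * exp (- (1 / real n) * real i) * f (exp (- (1 / real n) * real i))))
    \<longlonglongrightarrow> C * (\<integral> v. f (exp (- v)) \<partial>gamma_law \<alpha>)"
proof -
  interpret prob_space "gamma_law \<alpha>" by (rule prob_space_gamma_law) fact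
  define B where "B g n = w n * (\<Sum>i. a i * exp (- (1 / real n) * real i) * g (exp (- (1 / real n) * real i)))" for g n
  define E where "E g = (\<integral> v. g (exp (- v)) \<partial>gamma_law \<alpha>)" for g :: "real \<Rightarrow> real"
  have unit: "exp (- (1 / real n) * real i) \<in> {0..1}" for n i by simp
  have sB: "summable (\<lambda>i. a i * exp (- (1 / real n) * real i) * g (exp (- (1 / real n) * real i)))"
    if g: "\<And>s. s \<in> {0..1} \<Longrightarrow> \<bar>g s\<bar> \<le> M" and "0 < n" for g :: "real \<Rightarrow> real" and M n
  proof (rule summable_comparison_test')
    show "summable (\<lambda>i. M * (a i * exp (- (1 / real n) * real i)))"
      using sm[of "1 / real n"] \<open>0 < n\<close> by (intro summable_mult) simp
    fix i
    show "norm (a i * exp (- (1 / real n) * real i) * g (exp (- (1 / real n) * real i)))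
        \<le> M * (a i * exp (- (1 / real n) * real i))"
      using mult_left_mono[OF g[OF unit[of n i]], of "a i * exp (- (1 / real n) * real i)"] a[of i]
      by (simp add: abs_mult mult.commute)
  qed
  have cont_bdd: "\<exists>M. \<forall>s\<in>{0..1}. \<bar>g s\<bar> \<le> M" if "continuous_on UNIV g" for g :: "real \<Rightarrow> real"
    using compact_imp_bounded[OF compact_continuous_image[OF continuous_on_subset[OF that] compact_Icc[of 0 1]]]
    by (auto simp: bounded_iff)
  have exp_unit: "AE v in gamma_law \<alpha>. exp (- v) \<in> {0..1}"
    using gamma_law_nonneg by eventually_elim simp
  have intE: "integrable (gamma_law \<alpha>) (\<lambda>v. g (exp (- v)))" if g: "continuous_on UNIV g" for g :: "real \<Rightarrow> real"
  proof -
    obtain M where M: "\<And>s. s \<in> {0..1} \<Longrightarrow> \<bar>g s\<bar> \<le> M" using cont_bdd[OF g] by blast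
    have [measurable]: "g \<in> borel_measurable borel" using g by (rule borel_measurable_continuous_onI)
    show ?thesis
    proof (rule integrable_const_bound[where B = M])
      show "AE v in gamma_law \<alpha>. norm (g (exp (- v))) \<le> M"
        using exp_unit by eventually_elim (use M in auto)
    qed measurable
  qed
  have poly: "B p \<longlonglongrightarrow> C * E p" if p: "real_polynomial_function p" for p
  proof -
    obtain c d where pd: "p = (\<lambda>x. \<Sum>j\<le>d. c j * x ^ j)"
      using p by (auto simp: real_polynomial_function_iff_sum)
    have mono: "(\<lambda>n. w n * (\<Sum>i. a i * exp (- (1 / real n) * real i) * exp (- (1 / real n) * real i) ^ j))
        \<longlonglongrightarrow> C * (real j + 1) powr -\<alpha>" for j
    proof -
      have "exp (- (1 / real n) * real i) * exp (- (1 / real n) * real i) ^ j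
          = exp (- ((real j + 1) / real n) * real i)" for n i
        by (simp add: exp_of_nat_mult[symmetric] exp_add[symmetric] field_simps add_divide_distrib)
      then show ?thesis using lim[of j] by (simp add: mult.assoc)
    qed
    have "(\<lambda>n. \<Sum>j\<le>d. c j * (w n * (\<Sum>i. a i * exp (- (1 / real n) * real i) * exp (- (1 / real n) * real i) ^ j)))
        \<longlonglongrightarrow> (\<Sum>j\<le>d. c j * (C * (real j + 1) powr -\<alpha>))"
      by (intro tendsto_sum tendsto_mult tendsto_const mono)
    moreover have "(\<Sum>j\<le>d. c j * (C * (real j + 1) powr -\<alpha>)) = C * E p"
    proof -
      have "E p = (\<Sum>j\<le>d. c j * (\<integral> v. exp (- v) ^ j \<partial>gamma_law \<alpha>))"
        unfolding E_def pd
        by (subst Bochner_Integration.integral_sum)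
          (auto intro!: integrable_mult_right intE[of "\<lambda>s. s ^ _"] continuous_intros)
      then show ?thesis
        by (simp add: integral_gamma_law_exp[OF assms(1)] sum_distrib_left mult_ac)
    qed
    moreover have "\<forall>\<^sub>F n in sequentially.
        (\<Sum>j\<le>d. c j * (w n * (\<Sum>i. a i * exp (- (1 / real n) * real i) * exp (- (1 / real n) * real i) ^ j))) = B p n"
      using eventually_gt_at_top[of 0]
    proof eventually_elim
      case (elim n)
      have sj: "summable (\<lambda>i. a i * exp (- (1 / real n) * real i) * exp (- (1 / real n) * real i) ^ j)" for j
        by (rule sB[of "\<lambda>s. s ^ j" 1]) (use elim in \<open>auto simp: abs_if power_le_one\<close>)
      have "(\<Sum>i. a i * exp (- (1 / real n) * real i) * p (exp (- (1 / real n) * real i)))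
          = (\<Sum>i. \<Sum>j\<le>d. c j * (a i * exp (- (1 / real n) * real i) * exp (- (1 / real n) * real i) ^ j))"
        by (simp add: pd sum_distrib_left mult_ac)
      also have "\<dots> = (\<Sum>j\<le>d. c j * (\<Sum>i. a i * exp (- (1 / real n) * real i) * exp (- (1 / real n) * real i) ^ j))"
        by (subst suminf_sum) (intro summable_mult sj, simp only: suminf_mult[OF sj])
      finally show ?case unfolding B_def by (simp add: sum_distrib_left mult_ac)
    qed
    ultimately show ?thesis by (simp add: tendsto_cong)
  qed
  have poly_1: "B (\<lambda>_. 1) \<longlonglongrightarrow> C * E (\<lambda>_. 1)" by (rule poly) (rule real_polynomial_function.intros)
  have "E (\<lambda>_. 1) = 1" using prob_space by (simp add: E_def)
  with poly_1 have B1: "B (\<lambda>_. 1) \<longlonglongrightarrow> C" by simp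
  have B_nonneg: "\<forall>\<^sub>F n in sequentially. 0 \<le> B (\<lambda>_. 1) n"
    using w eventually_gt_at_top[of 0]
  proof eventually_elim
    case (elim n)
    then show ?case unfolding B_def
      using a sB[of "\<lambda>_. 1" 1 n] by (intro mult_nonneg_nonneg suminf_nonneg) auto
  qed
  then have "0 \<le> C" using B1 by (intro tendsto_lowerbound[OF B1]) auto
  have "B f \<longlonglongrightarrow> C * E f"
  proof (rule tendstoI)
    fix e :: real assume "0 < e"
    define e' where "e' = e / (4 * (C + 1))"
    have e': "0 < e'" "e' * C \<le> e / 4" "e' * (C + 1) = e / 4"
      using \<open>0 < e\<close> \<open>0 \<le> C\<close> by (auto simp: e'_def field_simps)
    obtain p where p: "real_polynomial_function p" "\<And>s. s \<in> {0..1} \<Longrightarrow> \<bar>f s - p s\<bar> < e'"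
      using Stone_Weierstrass_real_polynomial_function[OF compact_Icc[of 0 1] continuous_on_subset[OF f] e'(1)] by auto
    have pc: "continuous_on UNIV p"
      using p(1) by (intro continuous_at_imp_continuous_on ballI continuous_real_polymonial_function)
    obtain Mf where Mf: "\<And>s. s \<in> {0..1} \<Longrightarrow> \<bar>f s\<bar> \<le> Mf" using cont_bdd[OF f] by blast
    obtain Mp where Mp: "\<And>s. s \<in> {0..1} \<Longrightarrow> \<bar>p s\<bar> \<le> Mp" using cont_bdd[OF pc] by blast
    have E: "\<bar>E f - E p\<bar> \<le> e'"
    proof -
      have "\<bar>E f - E p\<bar> = \<bar>\<integral> v. f (exp (- v)) - p (exp (- v)) \<partial>gamma_law \<alpha>\<bar>"
        unfolding E_def by (subst Bochner_Integration.integral_diff) (auto intro: intE f pc)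
      also have "\<dots> \<le> (\<integral> v. \<bar>f (exp (- v)) - p (exp (- v))\<bar> \<partial>gamma_law \<alpha>)"
        by (rule integral_abs_bound)
      also have "\<dots> \<le> (\<integral> v. e' \<partial>gamma_law \<alpha>)"
      proof (rule integral_mono_AE)
        show "AE v in gamma_law \<alpha>. \<bar>f (exp (- v)) - p (exp (- v))\<bar> \<le> e'"
          using exp_unit by eventually_elim (use p(2) in \<open>auto intro: less_imp_le\<close>)
      qed (use intE[OF f] intE[OF pc] in auto)
      finally show ?thesis using prob_space by simp
    qed
    have "\<forall>\<^sub>F n in sequentially. dist (B p n) (C * E p) < e / 4"
      using \<open>0 < e\<close> by (intro tendstoD[OF poly[OF p(1)]]) auto
    moreover have "\<forall>\<^sub>F n in sequentially. B (\<lambda>_. 1) n < C + 1"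
      by (rule order_tendstoD[OF B1]) simp
    ultimately show "\<forall>\<^sub>F n in sequentially. dist (B f n) (C * E f) < e"
      using w eventually_gt_at_top[of 0]
    proof eventually_elim
      case (elim n)
      let ?q = "\<lambda>i. exp (- (1 / real n) * real i)"
      have sfp: "summable (\<lambda>i. a i * ?q i * (f (?q i) - p (?q i)))"
        by (rule sB[of "\<lambda>s. f s - p s" e']) (use p(2) elim in \<open>auto intro: less_imp_le\<close>)
      have s1: "summable (\<lambda>i. a i * ?q i)" using sB[of "\<lambda>_. 1" 1 n] elim by simp
      have abs_term: "\<bar>a i * ?q i * (f (?q i) - p (?q i))\<bar> \<le> e' * (a i * ?q i)" for i
        using mult_left_mono[OF less_imp_le[OF p(2)[OF unit[of n i]]], of "a i * ?q i"] a[of i]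
        by (simp add: abs_mult mult.commute)
      have sabs: "summable (\<lambda>i. \<bar>a i * ?q i * (f (?q i) - p (?q i))\<bar>)"
        by (rule summable_comparison_test'[OF summable_mult[OF s1, of e']]) (use abs_term in auto)
      have "B f n - B p n = w n * (\<Sum>i. a i * ?q i * (f (?q i) - p (?q i)))"
        unfolding B_def right_diff_distrib[symmetric]
        using sB[of f Mf n] sB[of p Mp n] Mf Mp elim by (subst suminf_diff) (auto simp: right_diff_distrib)
      then have "\<bar>B f n - B p n\<bar> = w n * \<bar>\<Sum>i. a i * ?q i * (f (?q i) - p (?q i))\<bar>"
        using elim by (simp add: abs_mult)
      also have "\<dots> \<le> w n * (\<Sum>i. \<bar>a i * ?q i * (f (?q i) - p (?q i))\<bar>)"
        using elim by (intro mult_left_mono summable_rabs sabs) auto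
      also have "\<dots> \<le> w n * (\<Sum>i. e' * (a i * ?q i))"
        using elim by (intro mult_left_mono suminf_le abs_term sabs summable_mult s1) auto
      also have "\<dots> = e' * B (\<lambda>_. 1) n" unfolding B_def using s1 by (simp add: suminf_mult mult_ac)
      also have "\<dots> \<le> e' * (C + 1)" using elim e' by (intro mult_left_mono) auto
      finally have "\<bar>B f n - B p n\<bar> \<le> e / 4" using e' by simp
      moreover have "\<bar>C * E f - C * E p\<bar> \<le> e / 4"
        using mult_left_mono[OF E \<open>0 \<le> C\<close>] e'(2) \<open>0 \<le> C\<close>
        by (simp add: abs_mult right_diff_distrib[symmetric] mult.commute)
      ultimately show ?case using elim(1) unfolding dist_real_def abs_le_iff abs_less_iff by linarith
    qed
  qed
  then show ?thesis unfolding B_def[abs_def] E_def .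
qed

text \<open>The partial sum up to \<open>n\<close> integrates the discontinuous test function \<open>1/s\<close> on \<open>s \<ge> exp(-1)\<close>, where
\<open>s = exp(-i/n)\<close>.  It is squeezed between two continuous functions that ramp linearly in \<open>v = - ln s\<close>
between \<open>1 - \<epsilon>\<close>, \<open>1\<close> and \<open>1 + \<epsilon>\<close>; continuity of \<open>b \<mapsto> b\<^sup>\<alpha>\<close> at 1 closes the gap.\<close>

lemma karamata_tauberian:
  fixes a w :: "nat \<Rightarrow> real"
  assumes "0 < \<alpha>" and a: "\<And>i. 0 \<le> a i" and sm: "\<And>l. 0 < l \<Longrightarrow> summable (\<lambda>i. a i * exp (- l * real i))"
    and w: "\<forall>\<^sub>F n in sequentially. 0 \<le> w n"
    and lim: "\<And>m. (\<lambda>n. w n * (\<Sum>i. a i * exp (- ((real m + 1) / real n) * real i)))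
                 \<longlonglongrightarrow> C * (real m + 1) powr -\<alpha>"
  shows "(\<lambda>n. w n * (\<Sum>i=0..n. a i)) \<longlonglongrightarrow> C / Gamma (1 + \<alpha>)"
proof -
  interpret prob_space "gamma_law \<alpha>" by (rule prob_space_gamma_law) fact
  have "0 \<le> C"
  proof -
    have "\<forall>\<^sub>F n in sequentially. 0 \<le> w n * (\<Sum>i. a i * exp (- ((real 0 + 1) / real n) * real i))"
      using w eventually_gt_at_top[of 0]
    proof eventually_elim
      case (elim n)
      then show ?case
        using a sm[of "(real 0 + 1) / real n"] by (intro mult_nonneg_nonneg suminf_nonneg) auto
    qed
    from tendsto_lowerbound[OF lim[of 0] this] show ?thesis by simp
  qed
  define ramp where "ramp b \<epsilon> v = max 0 (min 1 ((b + \<epsilon> - v) / \<epsilon>))" for b \<epsilon> v :: real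
  have ramp_le: "indicator {..b} v \<le> ramp b \<epsilon> v" "ramp b \<epsilon> v \<le> indicator {..b + \<epsilon>} v"
    if "0 < \<epsilon>" for b \<epsilon> v :: real
    using that by (auto simp: ramp_def indicator_def field_simps)
  \<comment> \<open>The cut-off \<open>exp(-(b + \<epsilon>))\<close> is the point where the ramp reaches 0; it makes \<open>f\<close> continuous on the whole line.\<close>
  define f where "f b \<epsilon> s = (let u = max s (exp (- (b + \<epsilon>))) in ramp b \<epsilon> (- ln u) / u)" for b \<epsilon> s
  have f_cont: "continuous_on UNIV (f b \<epsilon>)" for b \<epsilon>
  proof -
    have "continuous_on UNIV (\<lambda>s. ramp b \<epsilon> (- ln (max s (exp (- (b + \<epsilon>))))) / max s (exp (- (b + \<epsilon>))))"
      unfolding ramp_def divide_inverse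
      by (intro continuous_intros) (auto simp: max_def dest: leD)
    then show ?thesis by (simp add: f_def[abs_def] Let_def)
  qed
  have f_exp: "f b \<epsilon> (exp (- v)) = ramp b \<epsilon> v * exp v" if "0 < \<epsilon>" for b \<epsilon> v
  proof (cases "v \<le> b + \<epsilon>")
    case True
    then have m: "max (exp (- v)) (exp (- (b + \<epsilon>))) = exp (- v)" by simp
    have "- ln (exp (- v)) = v" by simp
    then show ?thesis unfolding f_def m Let_def by (simp add: exp_minus divide_inverse)
  next
    case False
    then have m: "max (exp (- v)) (exp (- (b + \<epsilon>))) = exp (- (b + \<epsilon>))" by simp
    have "ramp b \<epsilon> (b + \<epsilon>) = 0" "ramp b \<epsilon> v = 0"
      using False that by (auto simp: ramp_def max_def min_def divide_less_0_iff not_le zero_le_divide_iff)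
    then show ?thesis unfolding f_def m Let_def by (simp add: add.commute)
  qed
  have ramp_lim: "\<exists>l. (\<lambda>n. w n * (\<Sum>i. a i * ramp b \<epsilon> (real i / real n))) \<longlonglongrightarrow> l \<and>
      C * (b powr \<alpha> / Gamma (1 + \<alpha>)) \<le> l \<and> l \<le> C * ((b + \<epsilon>) powr \<alpha> / Gamma (1 + \<alpha>))"
    if "0 < \<epsilon>" "0 \<le> b" for b \<epsilon>
  proof (intro exI conjI)
    let ?l = "\<integral> v. f b \<epsilon> (exp (- v)) \<partial>gamma_law \<alpha>"
    have abs_term: "a i * exp (- (1 / real n) * real i) * f b \<epsilon> (exp (- (1 / real n) * real i))
        = a i * ramp b \<epsilon> (real i / real n)" for i n
      using f_exp[OF that(1), of b "1 / real n * real i"] by (simp add: exp_minus field_simps)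
    show "(\<lambda>n. w n * (\<Sum>i. a i * ramp b \<epsilon> (real i / real n))) \<longlonglongrightarrow> C * ?l"
      using weak_convergence_of_exponential_moments[OF assms f_cont[of b \<epsilon>]]
      unfolding abs_term .
    have int: "integrable (gamma_law \<alpha>) (\<lambda>v. ramp b \<epsilon> v * exp v)"
      "\<And>c. integrable (gamma_law \<alpha>) (\<lambda>v. indicator {..c} v * exp v)"
    proof -
      show int_ind: "integrable (gamma_law \<alpha>) (\<lambda>v. indicator {..c} v * exp v)" for c
        by (rule integrable_const_bound[where B = "exp c"]) (auto simp: indicator_def)
      show "integrable (gamma_law \<alpha>) (\<lambda>v. ramp b \<epsilon> v * exp v)"
      proof (rule Bochner_Integration.integrable_bound[OF int_ind[of "b + \<epsilon>"]])
        show "AE v in gamma_law \<alpha>. norm (ramp b \<epsilon> v * exp v) \<le> norm (indicator {..b + \<epsilon>} v * exp v)"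
          using ramp_le(2)[OF that(1), of b] by (auto simp: abs_mult ramp_def)
      qed (simp add: ramp_def)
    qed
    have "(\<integral> v. indicator {..b} v * exp v \<partial>gamma_law \<alpha>) \<le> ?l" "?l \<le> (\<integral> v. indicator {..b + \<epsilon>} v * exp v \<partial>gamma_law \<alpha>)"
      unfolding f_exp[OF that(1)]
      by (intro integral_mono int mult_right_mono ramp_le that; simp)+
    then show "C * (b powr \<alpha> / Gamma (1 + \<alpha>)) \<le> C * ?l" "C * ?l \<le> C * ((b + \<epsilon>) powr \<alpha> / Gamma (1 + \<alpha>))"
      using integral_gamma_law_exp_atMost[OF assms(1), of b] integral_gamma_law_exp_atMost[OF assms(1), of "b + \<epsilon>"] that \<open>0 \<le> C\<close>
      by (intro mult_left_mono \<open>0 \<le> C\<close>, simp)+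
  qed
  have finite_sum: "(\<Sum>i. a i * g i) = (\<Sum>i\<in>{0..N}. a i * g i)" if "\<And>i. N < i \<Longrightarrow> g i = 0" for g :: "nat \<Rightarrow> real" and N
    using that by (intro suminf_finite) auto
  have ramp_fin: "summable (\<lambda>i. a i * ramp b \<epsilon> (real i / real n))" if "0 < \<epsilon>" "0 < n" for b \<epsilon> n
  proof (rule summable_finite[of "{..nat \<lceil>(b + \<epsilon>) * real n\<rceil>}"])
    fix i assume "i \<notin> {..nat \<lceil>(b + \<epsilon>) * real n\<rceil>}"
    then have "nat \<lceil>(b + \<epsilon>) * real n\<rceil> < i" by simp
    then have "(b + \<epsilon>) * real n < real i" by linarith
    then have "b + \<epsilon> < real i / real n" using that by (simp add: field_simps)
    then have "ramp b \<epsilon> (real i / real n) \<le> 0" using ramp_le(2)[OF that(1), of b "real i / real n"] by simp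
    then show "a i * ramp b \<epsilon> (real i / real n) = 0" by (simp add: ramp_def)
  qed simp
  have ind_sum: "(\<Sum>i=0..n. a i) = (\<Sum>i. a i * indicator {..1} (real i / real n))"
      "summable (\<lambda>i. a i * indicator {..1} (real i / real n))" if "0 < n" for n
  proof -
    show "(\<Sum>i=0..n. a i) = (\<Sum>i. a i * indicator {..1} (real i / real n))"
      using that by (subst finite_sum[of n]) (auto simp: indicator_def)
    show "summable (\<lambda>i. a i * indicator {..1} (real i / real n))"
      using that by (intro summable_finite[of "{..n}"]) (auto simp: indicator_def)
  qed
  show ?thesis
  proof (rule tendstoI)
    fix e :: real assume "0 < e"
    define G where "G b = C * (b powr \<alpha> / Gamma (1 + \<alpha>))" for b
    have "(G \<longlongrightarrow> G 1) (at 1)" unfolding G_def divide_inverse by (intro tendsto_intros) auto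
    then have "\<forall>\<^sub>F b in at 1. dist (G b) (G 1) < e" by (rule tendstoD) fact
    then obtain d where d: "0 < d" "\<And>b. b \<noteq> 1 \<Longrightarrow> dist b 1 < d \<Longrightarrow> dist (G b) (G 1) < e"
      by (auto simp: eventually_at)
    define \<epsilon> where "\<epsilon> = min (d / 2) (1 / 2)"
    have \<epsilon>: "0 < \<epsilon>" "\<epsilon> < d" "\<epsilon> < 1" using d by (auto simp: \<epsilon>_def)
    have G: "G (1 + \<epsilon>) < G 1 + e" "G 1 - e < G (1 - \<epsilon>)"
      using d(2)[of "1 + \<epsilon>"] d(2)[of "1 - \<epsilon>"] \<epsilon> by (auto simp: dist_real_def)
    obtain u where u: "(\<lambda>n. w n * (\<Sum>i. a i * ramp 1 \<epsilon> (real i / real n))) \<longlonglongrightarrow> u" "u \<le> G (1 + \<epsilon>)"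
      using ramp_lim[of \<epsilon> 1] \<epsilon> by (auto simp: G_def)
    obtain l where l: "(\<lambda>n. w n * (\<Sum>i. a i * ramp (1 - \<epsilon>) \<epsilon> (real i / real n))) \<longlonglongrightarrow> l" "G (1 - \<epsilon>) \<le> l"
      using ramp_lim[of \<epsilon> "1 - \<epsilon>"] \<epsilon> by (auto simp: G_def)
    have "\<forall>\<^sub>F n in sequentially. w n * (\<Sum>i. a i * ramp 1 \<epsilon> (real i / real n)) < G 1 + e"
      using G u by (intro order_tendstoD(2)[OF u(1)]) auto
    moreover have "\<forall>\<^sub>F n in sequentially. G 1 - e < w n * (\<Sum>i. a i * ramp (1 - \<epsilon>) \<epsilon> (real i / real n))"
      using G l by (intro order_tendstoD(1)[OF l(1)]) auto
    ultimately show "\<forall>\<^sub>F n in sequentially. dist (w n * (\<Sum>i=0..n. a i)) (C / Gamma (1 + \<alpha>)) < e"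
      using w eventually_gt_at_top[of 0]
    proof eventually_elim
      case (elim n)
      have "(\<Sum>i. a i * ramp (1 - \<epsilon>) \<epsilon> (real i / real n)) \<le> (\<Sum>i=0..n. a i)"
        unfolding ind_sum(1)[OF elim(4)]
        using ramp_le(2)[OF \<epsilon>(1), of "1 - \<epsilon>"] elim(4) \<epsilon>(1) a
        by (intro suminf_le mult_left_mono ramp_fin ind_sum) auto
      moreover have "(\<Sum>i=0..n. a i) \<le> (\<Sum>i. a i * ramp 1 \<epsilon> (real i / real n))"
        unfolding ind_sum(1)[OF elim(4)]
        using ramp_le(1)[OF \<epsilon>(1), of 1] elim(4) \<epsilon>(1) a
        by (intro suminf_le mult_left_mono ramp_fin ind_sum) auto
      ultimately have "w n * (\<Sum>i. a i * ramp (1 - \<epsilon>) \<epsilon> (real i / real n)) \<le> w n * (\<Sum>i=0..n. a i)"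
        "w n * (\<Sum>i=0..n. a i) \<le> w n * (\<Sum>i. a i * ramp 1 \<epsilon> (real i / real n))"
        using elim(3) by (auto intro: mult_left_mono)
      then show ?case using elim(1,2) by (simp add: dist_real_def G_def abs_less_iff)
    qed
  qed
qed

section \<open>The modulated chain and its Poisson equation\<close>

text \<open>Strict positivity of the total density is a hypothesis here; for the renewal theorem it is a consequence
of the tail assumption.  Compactness then makes the density bounded away from 0 and \<open>\<mu>\<close> finite.\<close>

locale ergodic_kernel =
  fixes \<mu> \<pi> :: "'a::polish_space measure" and k :: "nat \<Rightarrow> 'a \<Rightarrow> 'a \<Rightarrow> real"
  assumes compact_UNIV: "compact (UNIV :: 'a set)"
    and sets_\<mu> [measurable_cong]: "sets \<mu> = sets borel"
    and k_measurable: "\<And>n. (\<lambda>(x, y). k (Suc n) x y) \<in> borel_measurable (borel \<Otimes>\<^sub>M borel)"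
    and k_nonneg: "\<And>n x y. 0 \<le> k (Suc n) x y"
    and k_summable: "\<And>x y. summable (\<lambda>n. k (Suc n) x y)"
    and total_continuous: "continuous_on UNIV (\<lambda>(x, y). total_density k x y)"
    and total_pos: "\<And>x y. 0 < total_density k x y"
    and nondefective: "\<And>x. (\<integral>\<^sup>+ y. (\<Sum>n. ennreal (k (Suc n) x y)) \<partial>\<mu>) = 1"
    and invariant: "invariant_probability \<mu> k \<pi>"
begin

abbreviation "tot \<equiv> total_density k"

lemma space_\<mu> [simp]: "space \<mu> = UNIV"
  using sets_eq_imp_space_eq[OF sets_\<mu>] by simp

lemma sets_\<pi> [measurable_cong]: "sets \<pi> = sets borel"
  using invariant by (simp add: invariant_probability_def)

lemma space_\<pi> [simp]: "space \<pi> = UNIV"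
  using sets_eq_imp_space_eq[OF sets_\<pi>] by simp

sublocale inv: prob_space \<pi>
  using invariant by (simp add: invariant_probability_def)

lemma total_measurable [measurable]: "(\<lambda>(x, y). tot x y) \<in> borel_measurable (borel \<Otimes>\<^sub>M borel)"
  using borel_measurable_continuous_onI[OF total_continuous] by (simp add: borel_prod)

lemma ennreal_total: "ennreal (tot x y) = (\<Sum>n. ennreal (k (Suc n) x y))"
  unfolding total_density_def using k_nonneg k_summable by (simp add: suminf_ennreal2)

lemma nn_integral_total: "(\<integral>\<^sup>+ y. ennreal (tot x y) \<partial>\<mu>) = 1"
  using nondefective by (simp add: ennreal_total)

lemma section_measurable:
  fixes q :: "'a \<Rightarrow> 'a \<Rightarrow> real"
  assumes q: "continuous_on UNIV (\<lambda>(x, y). q x y)"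
  shows "(\<lambda>y. q x y) \<in> borel_measurable borel"
proof -
  have "continuous_on UNIV (\<lambda>y. (\<lambda>(x, y). q x y) (x, y))"
    by (rule continuous_on_compose2[OF q]) (auto intro!: continuous_on_Pair continuous_on_const continuous_on_id)
  then show ?thesis by (intro borel_measurable_continuous_onI) simp
qed

lemma continuous_bounds:
  fixes q :: "'a \<Rightarrow> 'a \<Rightarrow> real"
  assumes "continuous_on UNIV (\<lambda>(x, y). q x y)"
  obtains M where "0 \<le> M" "\<And>x y. \<bar>q x y\<bar> \<le> M"
proof -
  have "compact (UNIV :: ('a \<times> 'a) set)"
    using compact_Times[OF compact_UNIV compact_UNIV] by simp
  then have "bounded (range (\<lambda>(x, y). q x y))"
    using assms compact_continuous_image compact_imp_bounded by blast
  then obtain M where "\<And>x y. \<bar>q x y\<bar> \<le> M" by (auto simp: bounded_iff)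
  moreover from this have "0 \<le> M" by (meson abs_ge_zero order_trans)
  ultimately show ?thesis using that by blast
qed

lemma continuous_pos_bound:
  fixes q :: "'a \<Rightarrow> 'a \<Rightarrow> real"
  assumes q: "continuous_on UNIV (\<lambda>(x, y). q x y)" and pos: "\<And>x y. 0 < q x y"
  obtains c where "0 < c" "\<And>x y. c \<le> q x y"
proof -
  have "compact (UNIV :: ('a \<times> 'a) set)"
    using compact_Times[OF compact_UNIV compact_UNIV] by simp
  from continuous_attains_inf[OF this _ q] obtain z where
    "\<And>w. (\<lambda>(x, y). q x y) z \<le> (\<lambda>(x, y). q x y) w" by auto
  then have "0 < q (fst z) (snd z)" "\<And>x y. q (fst z) (snd z) \<le> q x y"
    using pos by (auto simp: case_prod_beta)
  then show ?thesis using that by blast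
qed

lemma continuous_bounded:
  fixes h :: "'a \<Rightarrow> real"
  assumes "continuous_on UNIV h"
  obtains M where "0 \<le> M" "\<And>x. \<bar>h x\<bar> \<le> M"
proof -
  have "continuous_on UNIV (\<lambda>(x, y::'a). h x)"
    using assms by (auto simp: case_prod_beta intro!: continuous_on_compose2[OF assms] continuous_intros)
  then show ?thesis using continuous_bounds[of "\<lambda>x y. h x"] that by metis
qed

lemma finite_measure_\<mu>: "finite_measure \<mu>"
proof
  obtain c where c: "0 < c" "\<And>x y. c \<le> tot x y"
    using continuous_pos_bound[OF total_continuous total_pos] by blast
  have "ennreal c * emeasure \<mu> (space \<mu>) = (\<integral>\<^sup>+ y. ennreal c \<partial>\<mu>)" by simp
  also have "\<dots> \<le> (\<integral>\<^sup>+ y. ennreal (tot undefined y) \<partial>\<mu>)" by (intro nn_integral_mono ennreal_leI c)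
  finally have "ennreal c * emeasure \<mu> (space \<mu>) \<le> 1" by (simp add: nn_integral_total)
  then show "emeasure \<mu> (space \<mu>) \<noteq> \<infinity>"
    using c by (auto simp: ennreal_mult_top top_unique)
qed

sublocale ref: finite_measure \<mu> by (rule finite_measure_\<mu>)

sublocale inv_ref: pair_sigma_finite \<pi> \<mu> ..

lemma total_section_measurable [measurable]: "(\<lambda>y. tot x y) \<in> borel_measurable borel"
  by (rule section_measurable[OF total_continuous])

lemma integrable_\<mu>:
  fixes g :: "'a \<Rightarrow> real"
  assumes "g \<in> borel_measurable borel" "\<And>y. \<bar>g y\<bar> \<le> M"
  shows "integrable \<mu> g"
proof (rule ref.integrable_const_bound[where B = M])
  show "g \<in> borel_measurable \<mu>" using assms(1) by simp
  show "AE y in \<mu>. norm (g y) \<le> M" using assms(2) by (intro AE_I2) simp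
qed

lemma total_bounds: obtains M where "0 \<le> M" "\<And>x y. tot x y \<le> M"
proof -
  obtain M where M: "0 \<le> M" "\<And>x y. \<bar>tot x y\<bar> \<le> M"
    using continuous_bounds[OF total_continuous] by blast
  show ?thesis by (rule that[OF M(1) abs_le_D1[OF M(2)]])
qed

lemma integrable_total_mult:
  fixes g :: "'a \<Rightarrow> real"
  assumes [measurable]: "g \<in> borel_measurable borel" and "\<And>y. \<bar>g y\<bar> \<le> M"
  shows "integrable \<mu> (\<lambda>y. tot x y * g y)"
proof -
  obtain T where T: "0 \<le> T" "\<And>x y. tot x y \<le> T" using total_bounds by blast
  show ?thesis
  proof (rule integrable_\<mu>[where M = "T * M"])
    fix y show "\<bar>tot x y * g y\<bar> \<le> T * M"
      using T assms(2)[of y] total_pos[of x y] by (auto simp: abs_mult intro!: mult_mono)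
  qed measurable
qed

lemma integral_total: "(\<integral> y. tot x y \<partial>\<mu>) = 1"
proof -
  have "(\<integral> y. tot x y \<partial>\<mu>) = enn2real (\<integral>\<^sup>+ y. ennreal (tot x y) \<partial>\<mu>)"
    by (rule integral_eq_nn_integral) (simp_all add: total_pos less_imp_le)
  then show ?thesis by (simp add: nn_integral_total)
qed

lemma measure_\<mu>_pos: "0 < measure \<mu> UNIV"
proof -
  have "emeasure \<mu> (space \<mu>) \<noteq> 0"
  proof
    assume "emeasure \<mu> (space \<mu>) = 0"
    obtain M where M: "\<And>x y. tot x y \<le> M" using total_bounds by blast
    have "(\<integral>\<^sup>+ y. ennreal (tot undefined y) \<partial>\<mu>) \<le> (\<integral>\<^sup>+ y. ennreal M \<partial>\<mu>)"
      by (intro nn_integral_mono ennreal_leI M)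
    also have "\<dots> = 0" using \<open>emeasure \<mu> (space \<mu>) = 0\<close> by simp
    finally have "(\<integral>\<^sup>+ y. ennreal (tot undefined y) \<partial>\<mu>) = 0" by simp
    then show False by (simp add: nn_integral_total)
  qed
  then show ?thesis by (simp add: ref.emeasure_eq_measure zero_less_measure_iff)
qed

lemma continuous_on_integral:
  fixes q :: "'a \<Rightarrow> 'a \<Rightarrow> real"
  assumes q: "continuous_on UNIV (\<lambda>(x, y). q x y)"
  shows "continuous_on UNIV (\<lambda>x. \<integral> y. q x y \<partial>\<mu>)"
proof (rule continuous_on_sequentiallyI)
  fix u :: "nat \<Rightarrow> 'a" and a
  assume u: "u \<longlonglongrightarrow> a"
  obtain M where M: "\<And>x y. \<bar>q x y\<bar> \<le> M" using continuous_bounds[OF q] by blast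
  have [measurable]: "(\<lambda>y. q x y) \<in> borel_measurable borel" for x
    by (rule section_measurable[OF q])
  show "(\<lambda>n. \<integral> y. q (u n) y \<partial>\<mu>) \<longlonglongrightarrow> (\<integral> y. q a y \<partial>\<mu>)"
  proof (rule integral_dominated_convergence[where w = "\<lambda>_. M"])
    show "AE y in \<mu>. (\<lambda>n. q (u n) y) \<longlonglongrightarrow> q a y"
    proof (rule AE_I2)
      fix y :: 'a
      have "(\<lambda>n. (u n, y)) \<longlonglongrightarrow> (a, y)" by (intro tendsto_intros u)
      then have "(\<lambda>n. (\<lambda>(x, y). q x y) (u n, y)) \<longlonglongrightarrow> (\<lambda>(x, y). q x y) (a, y)"
        by (rule continuous_on_tendsto_compose[OF q]) auto
      then show "(\<lambda>n. q (u n) y) \<longlonglongrightarrow> q a y" by simp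
    qed
  qed (use M in auto)
qed

lemma pair_invariant_marginal: "distr (pair_invariant \<mu> k \<pi>) borel snd = \<pi>"
proof (rule measure_eqI)
  fix F assume "F \<in> sets (distr (pair_invariant \<mu> k \<pi>) borel snd)"
  then have F [measurable]: "F \<in> sets borel" by simp
  have "emeasure (distr (pair_invariant \<mu> k \<pi>) borel snd) F
      = (\<integral>\<^sup>+ z. indicator F (snd z) * ennreal (case z of (x, y) \<Rightarrow> tot x y) \<partial>(\<pi> \<Otimes>\<^sub>M \<mu>))"
    unfolding pair_invariant_def
    by (subst nn_integral_indicator[symmetric], simp, subst nn_integral_distr)
      (auto simp: nn_integral_density case_prod_beta mult.commute)
  also have "\<dots> = (\<integral>\<^sup>+ x. \<integral>\<^sup>+ y. indicator F y * ennreal (tot x y) \<partial>\<mu> \<partial>\<pi>)"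
    by (subst ref.nn_integral_fst[symmetric]) (auto simp: case_prod_beta)
  also have "\<dots> = (\<integral>\<^sup>+ x. emeasure (jump_kernel \<mu> k x) F \<partial>\<pi>)"
    unfolding jump_kernel_def by (intro nn_integral_cong) (simp add: emeasure_density mult.commute)
  also have "\<dots> = emeasure \<pi> F" using invariant F by (simp add: invariant_probability_def)
  finally show "emeasure (distr (pair_invariant \<mu> k \<pi>) borel snd) F = emeasure \<pi> F" .
qed (simp add: sets_\<pi>)

lemma integral_pair_invariant:
  fixes g :: "'a \<Rightarrow> 'a \<Rightarrow> real"
  assumes [measurable]: "(\<lambda>(x, y). g x y) \<in> borel_measurable (borel \<Otimes>\<^sub>M borel)" and g: "\<And>x y. \<bar>g x y\<bar> \<le> M"
  shows "(\<integral> z. (case z of (x, y) \<Rightarrow> g x y) \<partial>pair_invariant \<mu> k \<pi>) = (\<integral> x. \<integral> y. tot x y * g x y \<partial>\<mu> \<partial>\<pi>)"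
proof -
  obtain T where T: "0 \<le> T" "\<And>x y. tot x y \<le> T" using total_bounds by blast
  have "finite_measure (\<pi> \<Otimes>\<^sub>M \<mu>)"
    by (rule finite_measure_pair_measure) unfold_locales
  then interpret p: finite_measure "\<pi> \<Otimes>\<^sub>M \<mu>" .
  have int: "integrable (\<pi> \<Otimes>\<^sub>M \<mu>) (\<lambda>(x, y). tot x y * g x y)"
  proof (rule p.integrable_const_bound[where B = "T * M"])
    show "AE z in \<pi> \<Otimes>\<^sub>M \<mu>. norm (case z of (x, y) \<Rightarrow> tot x y * g x y) \<le> T * M"
      using T g total_pos by (auto intro!: AE_I2 mult_mono simp: abs_mult less_imp_le)
  qed measurable
  have "(\<integral> z. (case z of (x, y) \<Rightarrow> g x y) \<partial>pair_invariant \<mu> k \<pi>) = (\<integral> z. (case z of (x, y) \<Rightarrow> tot x y * g x y) \<partial>(\<pi> \<Otimes>\<^sub>M \<mu>))"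
  proof -
    have tm: "(\<lambda>z. tot (fst z) (snd z)) \<in> borel_measurable (\<pi> \<Otimes>\<^sub>M \<mu>)"
      and gm: "(\<lambda>z. g (fst z) (snd z)) \<in> borel_measurable (\<pi> \<Otimes>\<^sub>M \<mu>)"
      using total_measurable assms(1) by (simp_all add: case_prod_beta cong: measurable_cong_sets)
    show ?thesis
      unfolding pair_invariant_def case_prod_beta
      using integral_real_density[OF tm _ gm] total_pos by (simp add: less_imp_le)
  qed
  also have "\<dots> = (\<integral> x. \<integral> y. tot x y * g x y \<partial>\<mu> \<partial>\<pi>)"
    using inv_ref.integral_fst'[OF int] by simp
  finally show ?thesis .
qed

lemma integral_invariant:
  fixes h :: "'a \<Rightarrow> real"
  assumes [measurable]: "h \<in> borel_measurable borel" and h: "\<And>y. \<bar>h y\<bar> \<le> M"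
  shows "(\<integral> x. \<integral> y. tot x y * h y \<partial>\<mu> \<partial>\<pi>) = (\<integral> x. h x \<partial>\<pi>)"
proof -
  have "(\<integral> x. h x \<partial>\<pi>) = (\<integral> z. h (snd z) \<partial>pair_invariant \<mu> k \<pi>)"
    by (subst pair_invariant_marginal[symmetric], subst integral_distr) (auto simp: pair_invariant_def)
  also have "\<dots> = (\<integral> x. \<integral> y. tot x y * h y \<partial>\<mu> \<partial>\<pi>)"
    using integral_pair_invariant[of "\<lambda>x y. h y" M] h by (simp add: case_prod_beta)
  finally show ?thesis by simp
qed

text \<open>With \<open>c > 0\<close> a lower bound of the total density, \<open>(tot u v - c) \<mu>(dv)\<close> has total mass \<open>1 - c \<mu>(UNIV) < 1\<close> and defines a
contraction of the bounded continuous functions.  The fixed point \<open>h = g + (Q\<^sub>0 - c \<mu>) h\<close> satisfies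
\<open>h - Q\<^sub>0 h = g - b\<close> with the constant \<open>b = c \<integral> h d\<mu>\<close>, and integrating against the invariant
law shows \<open>b = 0\<close> when \<open>g\<close> is centred.\<close>

lemma poisson_equation:
  fixes g :: "'a \<Rightarrow> real"
  assumes g: "continuous_on UNIV g" and centred: "(\<integral> x. g x \<partial>\<pi>) = 0"
  obtains h where "continuous_on UNIV h" "\<And>x. g x = h x - (\<integral> y. tot x y * h y \<partial>\<mu>)"
proof -
  obtain c where c: "0 < c" "\<And>x y. c \<le> tot x y"
    using continuous_pos_bound[OF total_continuous total_pos] by blast
  define m where "m = measure \<mu> UNIV"
  have m: "0 < m" unfolding m_def by (rule measure_\<mu>_pos)
  have r_int: "(\<integral> y. tot x y - c \<partial>\<mu>) = 1 - c * m" for x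
    using integrable_total_mult[of "\<lambda>_. 1" 1 x]
    by (subst Bochner_Integration.integral_diff) (auto simp: integral_total m_def)
  have cm: "0 \<le> 1 - c * m"
  proof -
    have "0 \<le> (\<integral> y. tot undefined y - c \<partial>\<mu>)"
      using c by (intro Bochner_Integration.integral_nonneg) simp
    then show ?thesis by (simp only: r_int)
  qed
  have r_cont: "continuous_on UNIV (\<lambda>(x, y). (tot x y - c) * f y)" if "continuous_on UNIV f" for f
    unfolding case_prod_beta
    by (intro continuous_on_mult continuous_on_diff continuous_on_const
      total_continuous[unfolded case_prod_beta]
      continuous_on_compose2[OF that continuous_on_snd[OF continuous_on_id]]) auto
  define A where "A f x = g x + (\<integral> y. (tot x y - c) * f y \<partial>\<mu>)" for f x
  have A_bcont: "A f \<in> bcontfun" if "continuous_on UNIV f" for f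
  proof -
    have "continuous_on UNIV (A f)" unfolding A_def
      by (intro continuous_on_add g continuous_on_integral r_cont that)
    then show ?thesis
      using compact_continuous_image[OF _ compact_UNIV, of "A f"] by (auto simp: bcontfun_def compact_imp_bounded)
  qed
  define \<T> where "\<T> f = Bcontfun (A (apply_bcontfun f))" for f
  have \<T>: "apply_bcontfun (\<T> f) = A (apply_bcontfun f)" for f
    unfolding \<T>_def by (intro Bcontfun_inverse A_bcont) auto
  have "\<exists>!f. \<T> f = f"
  proof (rule banach_fix_type)
    show "0 \<le> 1 - c * m" by (rule cm)
    show "1 - c * m < 1" using c m by simp
    show "\<forall>f f'. dist (\<T> f) (\<T> f') \<le> (1 - c * m) * dist f f'"
    proof (intro allI dist_bound)
      fix f f' :: "'a \<Rightarrow>\<^sub>C real" and x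
      have [measurable]: "apply_bcontfun f \<in> borel_measurable borel" for f :: "'a \<Rightarrow>\<^sub>C real"
        by (rule borel_measurable_continuous_onI) simp
      have int: "integrable \<mu> (\<lambda>y. (tot x y - c) * apply_bcontfun f y)" for f :: "'a \<Rightarrow>\<^sub>C real"
      proof -
        obtain M where M: "\<And>x. \<bar>apply_bcontfun f x\<bar> \<le> M" using continuous_bounded[of "apply_bcontfun f"] by auto
        have "integrable \<mu> (\<lambda>y. tot x y * apply_bcontfun f y)" by (rule integrable_total_mult[OF _ M]) measurable
        moreover have "integrable \<mu> (apply_bcontfun f)" by (rule integrable_\<mu>[OF _ M]) measurable
        ultimately show ?thesis
          unfolding left_diff_distrib by (intro Bochner_Integration.integrable_diff integrable_mult_right)
      qed
      have "dist (\<T> f x) (\<T> f' x) = \<bar>\<integral> y. (tot x y - c) * (f y - f' y) \<partial>\<mu>\<bar>"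
        using int[of f] int[of f'] by (simp add: \<T> A_def dist_real_def right_diff_distrib)
      also have "\<dots> \<le> (\<integral> y. \<bar>(tot x y - c) * (f y - f' y)\<bar> \<partial>\<mu>)"
        by (rule integral_abs_bound)
      also have "\<dots> \<le> (\<integral> y. (tot x y - c) * dist f f' \<partial>\<mu>)"
      proof (rule integral_mono)
        show "integrable \<mu> (\<lambda>y. \<bar>(tot x y - c) * (f y - f' y)\<bar>)"
          using int[of f] int[of f'] by (intro integrable_abs) (simp add: right_diff_distrib)
        show "integrable \<mu> (\<lambda>y. (tot x y - c) * dist f f')"
          using integrable_total_mult[of "\<lambda>_. 1" 1 x] by (intro integrable_mult_left) simp
        fix y
        show "\<bar>(tot x y - c) * (f y - f' y)\<bar> \<le> (tot x y - c) * dist f f'"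
          using c(2)[of x y] dist_bounded[of f y f'] by (auto simp: abs_mult dist_real_def intro!: mult_left_mono)
      qed
      also have "\<dots> = (1 - c * m) * dist f f'" by (simp add: r_int)
      finally show "dist (\<T> f x) (\<T> f' x) \<le> (1 - c * m) * dist f f'" .
    qed
  qed
  then obtain F where F: "\<T> F = F" by blast
  define h where "h = apply_bcontfun F"
  have h_cont: "continuous_on UNIV h" by (simp add: h_def)
  have [measurable]: "h \<in> borel_measurable borel" by (rule borel_measurable_continuous_onI[OF h_cont])
  have [measurable]: "g \<in> borel_measurable borel" by (rule borel_measurable_continuous_onI[OF g])
  obtain H where H: "\<And>x. \<bar>h x\<bar> \<le> H" using continuous_bounded[OF h_cont] by blast
  obtain G where G: "\<And>x. \<bar>g x\<bar> \<le> G" using continuous_bounded[OF g] by blast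
  define b where "b = c * (\<integral> y. h y \<partial>\<mu>)"
  have h_eq: "h x = g x + (\<integral> y. tot x y * h y \<partial>\<mu>) - b" for x
  proof -
    have "h x = A h x" using \<T>[of F] F by (simp add: h_def)
    also have "A h x = g x + (\<integral> y. tot x y * h y \<partial>\<mu>) - b"
    proof -
      have "integrable \<mu> (\<lambda>y. tot x y * h y)" by (rule integrable_total_mult[OF _ H]) measurable
      moreover have "integrable \<mu> h" by (rule integrable_\<mu>[OF _ H]) measurable
      ultimately show ?thesis
        unfolding A_def b_def left_diff_distrib
        by (subst Bochner_Integration.integral_diff) (auto intro: integrable_mult_right)
    qed
    finally show ?thesis .
  qed
  have int_\<pi>: "integrable \<pi> f" if "f \<in> borel_measurable borel" "\<And>x. \<bar>f x\<bar> \<le> M" for f :: "'a \<Rightarrow> real" and M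
    by (rule inv.integrable_const_bound[where B = M]) (use that in auto)
  have Qh: "(\<lambda>x. \<integral> y. tot x y * h y \<partial>\<mu>) = (\<lambda>x. h x - g x + b)" using h_eq by (auto simp: fun_eq_iff algebra_simps)
  have "(\<integral> x. h x \<partial>\<pi>) = (\<integral> x. (\<integral> y. tot x y * h y \<partial>\<mu>) \<partial>\<pi>)"
    using integral_invariant[of h H] H by simp
  also have "\<dots> = (\<integral> x. h x - g x + b \<partial>\<pi>)" unfolding Qh ..
  also have "\<dots> = (\<integral> x. h x \<partial>\<pi>) - (\<integral> x. g x \<partial>\<pi>) + b"
  proof -
    have "integrable \<pi> h" "integrable \<pi> g"
      by (rule int_\<pi>[OF _ H], measurable) (rule int_\<pi>[OF _ G], measurable)
    then show ?thesis using inv.prob_space by simp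
  qed
  finally have "b = 0" using centred by simp
  show ?thesis
  proof (rule that[OF h_cont])
    fix x show "g x = h x - (\<integral> y. tot x y * h y \<partial>\<mu>)" using h_eq[of x] \<open>b = 0\<close> by linarith
  qed
qed

end

section \<open>One step of the Markov renewal process\<close>

text \<open>Conditional probabilities are real-valued conditional expectations; for nonnegative integrands the
\<open>ennreal\<close> version avoids all integrability conditions.  The two agree because a conditional
probability is at most 1 almost everywhere.\<close>

lemma nn_integral_cond_prob:
  assumes "prob_space M" "subalgebra M F" and [measurable]: "B \<in> sets M"
    and c: "AE \<omega> in M. cond_prob_given M F B \<omega> = c \<omega>"
    and [measurable]: "W \<in> borel_measurable F"
  shows "(\<integral>\<^sup>+ \<omega>. W \<omega> * indicator B \<omega> \<partial>M) = (\<integral>\<^sup>+ \<omega>. W \<omega> * ennreal (c \<omega>) \<partial>M)"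
proof -
  interpret prob_space M by fact
  interpret finite_measure_subalgebra M F by unfold_locales fact
  have "(\<lambda>\<omega>. ennreal (- indicator B \<omega>)) = (\<lambda>_. 0)"
    by (auto simp: fun_eq_iff indicator_def ennreal_neg)
  then have rce: "cond_prob_given M F B \<omega> = enn2real (nn_cond_exp M F (\<lambda>\<omega>. ennreal (indicator B \<omega>)) \<omega>)
      - enn2real (nn_cond_exp M F (\<lambda>_. 0) \<omega>)" for \<omega>
    by (simp add: cond_prob_given_def real_cond_exp_def)
  have zero: "AE \<omega> in M. 0 = nn_cond_exp M F (\<lambda>_. 0) \<omega>" by (rule nn_cond_exp_F_meas) simp
  have one: "AE \<omega> in M. 1 = nn_cond_exp M F (\<lambda>_. 1) \<omega>" by (rule nn_cond_exp_F_meas) simp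
  have "AE \<omega> in M. nn_cond_exp M F (\<lambda>\<omega>. ennreal (indicator B \<omega>)) \<omega> \<le> nn_cond_exp M F (\<lambda>_. 1) \<omega>"
    by (rule nn_cond_exp_mono) (auto simp: indicator_def)
  with zero one c have eq: "AE \<omega> in M. nn_cond_exp M F (\<lambda>\<omega>. ennreal (indicator B \<omega>)) \<omega> = ennreal (c \<omega>)"
  proof eventually_elim
    case (elim \<omega>)
    have "nn_cond_exp M F (\<lambda>\<omega>. ennreal (indicator B \<omega>)) \<omega> \<le> 1" using elim(2,4) by simp
    then have "nn_cond_exp M F (\<lambda>\<omega>. ennreal (indicator B \<omega>)) \<omega> < top"
      using ennreal_one_less_top order_le_less_trans by blast
    moreover have "c \<omega> = enn2real (nn_cond_exp M F (\<lambda>\<omega>. ennreal (indicator B \<omega>)) \<omega>)"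
      using elim(1,3) rce[of \<omega>] by simp
    ultimately show ?case by simp
  qed
  have "(\<integral>\<^sup>+ \<omega>. W \<omega> * indicator B \<omega> \<partial>M) = (\<integral>\<^sup>+ \<omega>. W \<omega> * ennreal (indicator B \<omega>) \<partial>M)"
    by (simp add: ennreal_indicator)
  also have "\<dots> = (\<integral>\<^sup>+ \<omega>. W \<omega> * nn_cond_exp M F (\<lambda>\<omega>. ennreal (indicator B \<omega>)) \<omega> \<partial>M)"
    by (rule nn_cond_exp_intg[symmetric]) auto
  also have "\<dots> = (\<integral>\<^sup>+ \<omega>. W \<omega> * ennreal (c \<omega>) \<partial>M)"
    by (rule nn_integral_cong_AE) (use eq in \<open>auto elim: eventually_mono\<close>)
  finally show ?thesis .
qed

lemma prod_indicator_INT: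
  "finite I \<Longrightarrow> (\<Prod>i\<in>I. indicator (E i) \<omega> :: ennreal) = indicator (\<Inter>i\<in>I. E i) \<omega>"
  by (induction rule: finite_induct) (auto simp: indicator_def)

locale markov_renewal = ergodic_kernel \<mu> \<pi> k
  for \<mu> \<pi> :: "'a::polish_space measure" and k +
  fixes x :: 'a and P :: "'w measure" and \<tau> :: "nat \<Rightarrow> 'w \<Rightarrow> nat" and J :: "nat \<Rightarrow> 'w \<Rightarrow> 'a"
  assumes process: "markov_renewal_process \<mu> k x P \<tau> J"
begin

sublocale prob_space P
  using process by (simp add: markov_renewal_process_def)

lemma J_measurable [measurable]: "J n \<in> measurable P borel"
  using process by (simp add: markov_renewal_process_def)

lemma \<tau>_measurable [measurable]: "\<tau> n \<in> measurable P (count_space UNIV)"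
  using process by (simp add: markov_renewal_process_def)

lemma start: "AE \<omega> in P. J 0 \<omega> = x" "AE \<omega> in P. \<tau> 0 \<omega> = 0"
  using process by (simp_all add: markov_renewal_process_def)

lemma measurable_k_compose [measurable (raw)]:
  assumes "f \<in> measurable N borel" "g \<in> measurable N borel"
  shows "(\<lambda>\<omega>. k (Suc n) (f \<omega>) (g \<omega>)) \<in> borel_measurable N"
  using measurable_compose[OF measurable_Pair[OF assms] k_measurable] by simp

lemma measurable_total_compose [measurable (raw)]:
  assumes "f \<in> measurable N borel" "g \<in> measurable N borel"
  shows "(\<lambda>\<omega>. tot (f \<omega>) (g \<omega>)) \<in> borel_measurable N"
  using measurable_compose[OF measurable_Pair[OF assms] total_measurable] by simp

lemma subalgebra_chain: "subalgebra P (sigma_chain P J)"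
  unfolding subalgebra_def sigma_chain_def
proof (intro conjI)
  show "sets (vimage_algebra (space P) (\<lambda>\<omega> i. J i \<omega>) (Pi\<^sub>M UNIV (\<lambda>_. borel))) \<subseteq> sets P"
    by (rule sets_image_in_sets[OF refl]) (rule measurable_PiM_single', auto simp: space_PiM)
qed simp

lemma J_chain_measurable [measurable]: "J i \<in> measurable (sigma_chain P J) borel"
proof -
  have "(\<lambda>\<omega> i. J i \<omega>) \<in> measurable (sigma_chain P J) (Pi\<^sub>M UNIV (\<lambda>_. borel))"
    unfolding sigma_chain_def by (rule measurable_vimage_algebra1) (auto simp: space_PiM)
  from measurable_compose[OF this measurable_component_singleton[of i]] show ?thesis by simp
qed

lemma subalgebra_past: "subalgebra P (sigma_past P J n)"
  unfolding subalgebra_def sigma_past_def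
proof (intro conjI)
  show "sets (vimage_algebra (space P) (\<lambda>\<omega>. \<lambda>i\<in>{..n}. J i \<omega>) (Pi\<^sub>M {..n} (\<lambda>_. borel))) \<subseteq> sets P"
    by (rule sets_image_in_sets[OF refl]) (rule measurable_restrict, rule J_measurable)
qed simp

lemma J_past_measurable [measurable (raw)]:
  assumes "i \<le> n"
  shows "J i \<in> measurable (sigma_past P J n) borel"
proof -
  have "(\<lambda>\<omega>. \<lambda>i\<in>{..n}. J i \<omega>) \<in> measurable (sigma_past P J n) (Pi\<^sub>M {..n} (\<lambda>_. borel))"
    unfolding sigma_past_def by (rule measurable_vimage_algebra1) (auto simp: space_PiM)
  from measurable_compose[OF this measurable_component_singleton[of i]] assms show ?thesis by simp
qed

lemma increment_event_measurable [measurable]: "increment_event P \<tau> i m \<in> sets P"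
proof -
  have [measurable]: "(\<lambda>\<omega>. real (\<tau> i \<omega>)) \<in> borel_measurable P" for i by measurable
  have "increment_event P \<tau> i m = {\<omega> \<in> space P. real (\<tau> (Suc i) \<omega>) = real (\<tau> i \<omega>) + real m}"
    unfolding increment_event_def of_nat_add[symmetric] of_nat_eq_iff ..
  also have "\<dots> \<in> sets P" by measurable
  finally show ?thesis .
qed

text \<open>The conditional probability that an increment equals \<open>Suc m\<close>, given that the chain moves from \<open>u\<close> to
\<open>v\<close>; the shift by one reflects that increments are at least 1.\<close>

definition step_prob :: "nat \<Rightarrow> 'a \<Rightarrow> 'a \<Rightarrow> ennreal" where
  "step_prob m u v = ennreal (k (Suc m) u v / tot u v)"

lemma measurable_step_prob [measurable (raw)]:
  assumes [measurable]: "f \<in> measurable N borel" "g \<in> measurable N borel"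
  shows "(\<lambda>\<omega>. step_prob m (f \<omega>) (g \<omega>)) \<in> borel_measurable N"
  unfolding step_prob_def by measurable

lemma suminf_step_prob: "(\<Sum>m. step_prob m u v) = 1"
proof -
  have "(\<Sum>m. step_prob m u v) = ennreal (\<Sum>m. k (Suc m) u v / tot u v)"
    unfolding step_prob_def using k_nonneg total_pos[of u v] k_summable
    by (intro suminf_ennreal2) (auto intro: summable_divide)
  also have "(\<Sum>m. k (Suc m) u v / tot u v) = tot u v / tot u v"
    unfolding total_density_def by (rule suminf_divide[OF k_summable])
  finally show ?thesis using total_pos[of u v] by simp
qed

lemma increments_given_chain:
  assumes "finite I" and [measurable]: "Y \<in> borel_measurable (sigma_chain P J)"
  shows "(\<integral>\<^sup>+ \<omega>. Y \<omega> * (\<Prod>i\<in>I. indicator (increment_event P \<tau> i (Suc (m i))) \<omega>) \<partial>P)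
    = (\<integral>\<^sup>+ \<omega>. Y \<omega> * (\<Prod>i\<in>I. step_prob (m i) (J i \<omega>) (J (Suc i) \<omega>)) \<partial>P)"
proof (cases "I = {}")
  case False
  have single: "AE \<omega> in P. cond_prob_given P (sigma_chain P J) (increment_event P \<tau> i (Suc (m i))) \<omega>
      = k (Suc (m i)) (J i \<omega>) (J (Suc i) \<omega>) / tot (J i \<omega>) (J (Suc i) \<omega>)" for i
    using process by (simp add: markov_renewal_process_def)
  have "AE \<omega> in P. \<forall>i\<in>I. cond_prob_given P (sigma_chain P J) (increment_event P \<tau> i (Suc (m i))) \<omega>
      = k (Suc (m i)) (J i \<omega>) (J (Suc i) \<omega>) / tot (J i \<omega>) (J (Suc i) \<omega>)"
    using assms(1) single by (simp add: AE_ball_countable countable_finite)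
  moreover have "AE \<omega> in P. cond_prob_given P (sigma_chain P J) (\<Inter>i\<in>I. increment_event P \<tau> i (Suc (m i))) \<omega>
      = (\<Prod>i\<in>I. cond_prob_given P (sigma_chain P J) (increment_event P \<tau> i (Suc (m i))) \<omega>)"
    using process assms(1) False unfolding markov_renewal_process_def by (elim conjE) (erule allE[of _ I], erule allE[of _ "\<lambda>i. Suc (m i)"], blast)
  ultimately have "AE \<omega> in P. cond_prob_given P (sigma_chain P J) (\<Inter>i\<in>I. increment_event P \<tau> i (Suc (m i))) \<omega>
      = (\<Prod>i\<in>I. k (Suc (m i)) (J i \<omega>) (J (Suc i) \<omega>) / tot (J i \<omega>) (J (Suc i) \<omega>))"
    by eventually_elim simp
  moreover have "(\<Inter>i\<in>I. increment_event P \<tau> i (Suc (m i))) \<in> sets P"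
    using assms(1) False by (intro sets.finite_INT) auto
  ultimately have "(\<integral>\<^sup>+ \<omega>. Y \<omega> * indicator (\<Inter>i\<in>I. increment_event P \<tau> i (Suc (m i))) \<omega> \<partial>P)
      = (\<integral>\<^sup>+ \<omega>. Y \<omega> * ennreal (\<Prod>i\<in>I. k (Suc (m i)) (J i \<omega>) (J (Suc i) \<omega>) / tot (J i \<omega>) (J (Suc i) \<omega>)) \<partial>P)"
    by (intro nn_integral_cond_prob[OF prob_space_axioms subalgebra_chain]) auto
  moreover have "ennreal (\<Prod>i\<in>I. k (Suc (m i)) (J i \<omega>) (J (Suc i) \<omega>) / tot (J i \<omega>) (J (Suc i) \<omega>))
      = (\<Prod>i\<in>I. step_prob (m i) (J i \<omega>) (J (Suc i) \<omega>))" for \<omega>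
    unfolding step_prob_def using k_nonneg total_pos by (intro prod_ennreal[symmetric]) (simp add: less_imp_le)
  ultimately show ?thesis by (simp add: prod_indicator_INT[OF assms(1)])
qed simp

text \<open>Increment probabilities are prescribed for the values \<open>m \<ge> 1\<close> only; as they add up to 1, a zero
increment has probability zero.\<close>

lemma increments_positive: "AE \<omega> in P. \<exists>m. \<omega> \<in> increment_event P \<tau> i (Suc m)"
proof -
  have one: "emeasure P (increment_event P \<tau> i (Suc m)) = (\<integral>\<^sup>+ \<omega>. step_prob m (J i \<omega>) (J (Suc i) \<omega>) \<partial>P)" for m
    using increments_given_chain[of "{i}" "\<lambda>_. 1" "\<lambda>_. m"] by simp
  have "disjoint_family (\<lambda>m. increment_event P \<tau> i (Suc m))"
    by (auto simp: disjoint_family_on_def increment_event_def)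
  then have "emeasure P (\<Union>m. increment_event P \<tau> i (Suc m)) = (\<Sum>m. emeasure P (increment_event P \<tau> i (Suc m)))"
    by (intro suminf_emeasure[symmetric]) auto
  also have "\<dots> = (\<integral>\<^sup>+ \<omega>. (\<Sum>m. step_prob m (J i \<omega>) (J (Suc i) \<omega>)) \<partial>P)"
    unfolding one by (rule nn_integral_suminf[symmetric]) measurable
  also have "\<dots> = 1" by (simp add: suminf_step_prob emeasure_space_1)
  finally have "prob (\<Union>m. increment_event P \<tau> i (Suc m)) = 1" by (simp add: emeasure_eq_measure)
  then have "AE \<omega> in P. \<omega> \<in> (\<Union>m. increment_event P \<tau> i (Suc m))" by (subst (asm) prob_eq_1) auto
  then show ?thesis by eventually_elim auto
qed

text \<open>The conditional generating function of one increment given the move from \<open>u\<close> to \<open>v\<close>.\<close>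

definition step_transform :: "real \<Rightarrow> 'a \<Rightarrow> 'a \<Rightarrow> ennreal" where
  "step_transform s u v = (\<Sum>m. ennreal (s ^ Suc m) * step_prob m u v)"

lemma measurable_step_transform [measurable (raw)]:
  assumes [measurable]: "f \<in> measurable N borel" "g \<in> measurable N borel"
  shows "(\<lambda>\<omega>. step_transform s (f \<omega>) (g \<omega>)) \<in> borel_measurable N"
  unfolding step_transform_def by measurable

lemma step_transform_le_1:
  assumes "0 \<le> s" "s \<le> 1"
  shows "step_transform s u v \<le> 1"
proof -
  have "step_transform s u v \<le> (\<Sum>m. step_prob m u v)"
    unfolding step_transform_def
  proof (intro suminf_le)
    fix m
    have "s ^ Suc m \<le> 1" using assms by (rule power_le_one)
    then have "ennreal (s ^ Suc m) \<le> 1" by (simp add: ennreal_le_1)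
    from mult_right_mono[OF this] show "ennreal (s ^ Suc m) * step_prob m u v \<le> step_prob m u v" by simp
  qed auto
  then show ?thesis by (simp add: suminf_step_prob)
qed

lemma measurable_from_chain: "Y \<in> borel_measurable (sigma_chain P J) \<Longrightarrow> Y \<in> borel_measurable P"
  by (rule measurable_from_subalg[OF subalgebra_chain])

text \<open>Conditional independence of the increments given \<open>J\<close> makes the generating function of \<open>\<tau>\<^sub>j\<close> a product.
The increments are split off one at a time, summing over the value of the last one; the set \<open>I\<close> of
further prescribed increments is what the induction over \<open>j\<close> consumes.\<close>

lemma transform_given_chain:
  assumes s: "0 \<le> s"
    and "finite I" "I \<inter> {..<j} = {}" and "Y \<in> borel_measurable (sigma_chain P J)"
  shows "(\<integral>\<^sup>+ \<omega>. ennreal (s ^ \<tau> j \<omega>) * (Y \<omega> * (\<Prod>i\<in>I. indicator (increment_event P \<tau> i (Suc (m i))) \<omega>)) \<partial>P)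
    = (\<integral>\<^sup>+ \<omega>. (\<Prod>i<j. step_transform s (J i \<omega>) (J (Suc i) \<omega>)) *
        (Y \<omega> * (\<Prod>i\<in>I. step_prob (m i) (J i \<omega>) (J (Suc i) \<omega>))) \<partial>P)"
  using assms(2-)
proof (induction j arbitrary: I m)
  case 0
  have "(\<integral>\<^sup>+ \<omega>. ennreal (s ^ \<tau> 0 \<omega>) * (Y \<omega> * (\<Prod>i\<in>I. indicator (increment_event P \<tau> i (Suc (m i))) \<omega>)) \<partial>P)
      = (\<integral>\<^sup>+ \<omega>. Y \<omega> * (\<Prod>i\<in>I. indicator (increment_event P \<tau> i (Suc (m i))) \<omega>) \<partial>P)"
    by (rule nn_integral_cong_AE) (use start(2) in \<open>auto elim: eventually_mono\<close>)
  then show ?case using increments_given_chain[OF 0(1,3)] by simp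
next
  case (Suc j)
  note [measurable] = Suc.prems(3) measurable_from_chain[OF Suc.prems(3)]
  let ?E = "\<lambda>i m. increment_event P \<tau> i (Suc m)"
  let ?G = "\<lambda>\<omega>. \<Prod>i<j. step_transform s (J i \<omega>) (J (Suc i) \<omega>)"
  have jI: "j \<notin> I" using Suc.prems(2) by auto
  have ins: "(\<Prod>i\<in>insert j I. h i ((m(j := l)) i)) = h j l * (\<Prod>i\<in>I. h i (m i))"
    for h :: "nat \<Rightarrow> nat \<Rightarrow> ennreal" and l
  proof -
    have "(\<Prod>i\<in>I. h i ((m(j := l)) i)) = (\<Prod>i\<in>I. h i (m i))"
      using jI by (intro prod.cong) auto
    then show ?thesis using Suc.prems(1) jI by simp
  qed
  have ins_E: "(\<Prod>i\<in>insert j I. indicator (?E i ((m(j := l)) i)) \<omega> :: ennreal)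
      = indicator (?E j l) \<omega> * (\<Prod>i\<in>I. indicator (?E i (m i)) \<omega>)" for l \<omega>
    by (rule ins[of "\<lambda>i l. indicator (?E i l) \<omega>"])
  have ins_p: "(\<Prod>i\<in>insert j I. step_prob ((m(j := l)) i) (J i \<omega>) (J (Suc i) \<omega>))
      = step_prob l (J j \<omega>) (J (Suc j) \<omega>) * (\<Prod>i\<in>I. step_prob (m i) (J i \<omega>) (J (Suc i) \<omega>))" for l \<omega>
    by (rule ins[of "\<lambda>i l. step_prob l (J i \<omega>) (J (Suc i) \<omega>)"])
  have "AE \<omega> in P. ennreal (s ^ \<tau> (Suc j) \<omega>) = (\<Sum>l. ennreal (s ^ Suc l) * (ennreal (s ^ \<tau> j \<omega>) * indicator (?E j l) \<omega>))"
    using increments_positive[of j] AE_space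
  proof eventually_elim
    case (elim \<omega>)
    then obtain l where l: "\<tau> (Suc j) \<omega> = \<tau> j \<omega> + Suc l" by (auto simp: increment_event_def)
    have "(\<Sum>l. ennreal (s ^ Suc l) * (ennreal (s ^ \<tau> j \<omega>) * indicator (?E j l) \<omega>))
        = (\<Sum>l\<in>{l}. ennreal (s ^ Suc l) * (ennreal (s ^ \<tau> j \<omega>) * indicator (?E j l) \<omega>))"
      by (rule suminf_finite) (auto simp: increment_event_def l)
    also have "\<dots> = ennreal (s ^ \<tau> (Suc j) \<omega>)"
      using elim(2) s by (simp add: l increment_event_def ennreal_mult[symmetric] power_add mult_ac)
    finally show ?case by simp
  qed
  then have "(\<integral>\<^sup>+ \<omega>. ennreal (s ^ \<tau> (Suc j) \<omega>) * (Y \<omega> * (\<Prod>i\<in>I. indicator (?E i (m i)) \<omega>)) \<partial>P)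
      = (\<integral>\<^sup>+ \<omega>. (\<Sum>l. ennreal (s ^ Suc l) * (ennreal (s ^ \<tau> j \<omega>) * indicator (?E j l) \<omega>)) *
          (Y \<omega> * (\<Prod>i\<in>I. indicator (?E i (m i)) \<omega>)) \<partial>P)"
    by (intro nn_integral_cong_AE) (auto elim: eventually_mono)
  also have "\<dots> = (\<integral>\<^sup>+ \<omega>. (\<Sum>l. ennreal (s ^ Suc l) * (ennreal (s ^ \<tau> j \<omega>) *
      (Y \<omega> * (\<Prod>i\<in>insert j I. indicator (?E i ((m(j := l)) i)) \<omega>)))) \<partial>P)"
    by (intro nn_integral_cong, simp only: ins_E, subst ennreal_suminf_multc[symmetric]) (simp add: mult_ac)
  also have "\<dots> = (\<Sum>l. \<integral>\<^sup>+ \<omega>. ennreal (s ^ Suc l) * (ennreal (s ^ \<tau> j \<omega>) *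
      (Y \<omega> * (\<Prod>i\<in>insert j I. indicator (?E i ((m(j := l)) i)) \<omega>))) \<partial>P)"
    by (rule nn_integral_suminf) measurable
  also have "\<dots> = (\<Sum>l. ennreal (s ^ Suc l) * (\<integral>\<^sup>+ \<omega>. ennreal (s ^ \<tau> j \<omega>) *
      (Y \<omega> * (\<Prod>i\<in>insert j I. indicator (?E i ((m(j := l)) i)) \<omega>)) \<partial>P))"
    by (intro suminf_cong nn_integral_cmult) measurable
  also have "\<dots> = (\<Sum>l. ennreal (s ^ Suc l) * (\<integral>\<^sup>+ \<omega>. ?G \<omega> *
      (Y \<omega> * (\<Prod>i\<in>insert j I. step_prob ((m(j := l)) i) (J i \<omega>) (J (Suc i) \<omega>))) \<partial>P))"
    using Suc.prems by (intro suminf_cong arg_cong2[where f = "(*)"] refl Suc.IH) auto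
  also have "\<dots> = (\<Sum>l. \<integral>\<^sup>+ \<omega>. ennreal (s ^ Suc l) * (?G \<omega> *
      (Y \<omega> * (\<Prod>i\<in>insert j I. step_prob ((m(j := l)) i) (J i \<omega>) (J (Suc i) \<omega>)))) \<partial>P)"
    by (intro suminf_cong nn_integral_cmult[symmetric]) measurable
  also have "\<dots> = (\<integral>\<^sup>+ \<omega>. (\<Sum>l. ennreal (s ^ Suc l) * (?G \<omega> *
      (Y \<omega> * (\<Prod>i\<in>insert j I. step_prob ((m(j := l)) i) (J i \<omega>) (J (Suc i) \<omega>))))) \<partial>P)"
    by (rule nn_integral_suminf[symmetric]) measurable
  also have "\<dots> = (\<integral>\<^sup>+ \<omega>. (\<Sum>l. ennreal (s ^ Suc l) * step_prob l (J j \<omega>) (J (Suc j) \<omega>)) *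
      (?G \<omega> * (Y \<omega> * (\<Prod>i\<in>I. step_prob (m i) (J i \<omega>) (J (Suc i) \<omega>)))) \<partial>P)"
    by (intro nn_integral_cong, simp only: ins_p, subst ennreal_suminf_multc[symmetric]) (simp add: mult_ac)
  also have "\<dots> = (\<integral>\<^sup>+ \<omega>. (\<Prod>i<Suc j. step_transform s (J i \<omega>) (J (Suc i) \<omega>)) *
      (Y \<omega> * (\<Prod>i\<in>I. step_prob (m i) (J i \<omega>) (J (Suc i) \<omega>))) \<partial>P)"
    by (intro nn_integral_cong) (simp add: step_transform_def mult_ac)
  finally show ?case .
qed

text \<open>The Markov property is given for events \<open>J\<^bsub>n+1\<^esub> \<in> b\<close> only.  Both sides, as functions of \<open>\<phi>\<close>, are integrals
against finite measures on the product space that agree on rectangles, hence everywhere.\<close>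

lemma nn_integral_jump:
  assumes [measurable]: "W \<in> borel_measurable (sigma_past P J n)" and W: "\<And>\<omega>. W \<omega> \<le> 1"
    and [measurable]: "(\<lambda>(u, v). \<phi> u v) \<in> borel_measurable (borel \<Otimes>\<^sub>M borel)"
  shows "(\<integral>\<^sup>+ \<omega>. W \<omega> * \<phi> (J n \<omega>) (J (Suc n) \<omega>) \<partial>P)
    = (\<integral>\<^sup>+ \<omega>. W \<omega> * (\<integral>\<^sup>+ y. \<phi> (J n \<omega>) y * ennreal (tot (J n \<omega>) y) \<partial>\<mu>) \<partial>P)"
proof -
  have [measurable]: "W \<in> borel_measurable P"
    by (rule measurable_from_subalg[OF subalgebra_past]) fact
  define B :: "('a \<times> 'a) measure" where "B = borel \<Otimes>\<^sub>M borel"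
  define D where "D = distr (density P W) borel (J n)"
  have [measurable_cong]: "sets D = sets borel" by (simp add: D_def)
  define M1 where "M1 = distr (density P W) B (\<lambda>\<omega>. (J n \<omega>, J (Suc n) \<omega>))"
  define M2 where "M2 = density (D \<Otimes>\<^sub>M \<mu>) (\<lambda>(u, v). ennreal (tot u v))"
  have sets_M2: "sets M2 = sets B"
    unfolding M2_def B_def sets_density by (rule sets_pair_measure_cong) (simp_all add: D_def sets_\<mu>)
  have M1: "(\<integral>\<^sup>+ z. h z \<partial>M1) = (\<integral>\<^sup>+ \<omega>. W \<omega> * h (J n \<omega>, J (Suc n) \<omega>) \<partial>P)"
    if h: "h \<in> borel_measurable (borel \<Otimes>\<^sub>M borel)" for h
    unfolding M1_def B_def using h by (subst nn_integral_distr, simp, simp, subst nn_integral_density) auto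
  have M2: "(\<integral>\<^sup>+ z. h z \<partial>M2) = (\<integral>\<^sup>+ \<omega>. W \<omega> * (\<integral>\<^sup>+ y. h (J n \<omega>, y) * ennreal (tot (J n \<omega>) y) \<partial>\<mu>) \<partial>P)"
    if h [measurable]: "h \<in> borel_measurable (borel \<Otimes>\<^sub>M borel)" for h
  proof -
    have "(\<integral>\<^sup>+ z. h z \<partial>M2) = (\<integral>\<^sup>+ z. h z * ennreal (tot (fst z) (snd z)) \<partial>(D \<Otimes>\<^sub>M \<mu>))"
      unfolding M2_def by (subst nn_integral_density) (auto simp: case_prod_beta mult.commute)
    also have "\<dots> = (\<integral>\<^sup>+ u. \<integral>\<^sup>+ y. h (u, y) * ennreal (tot u y) \<partial>\<mu> \<partial>D)"
      by (subst ref.nn_integral_fst[symmetric]) auto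
    also have "\<dots> = (\<integral>\<^sup>+ \<omega>. W \<omega> * (\<integral>\<^sup>+ y. h (J n \<omega>, y) * ennreal (tot (J n \<omega>) y) \<partial>\<mu>) \<partial>P)"
      unfolding D_def by (subst nn_integral_distr, simp, simp, subst nn_integral_density) auto
    finally show ?thesis .
  qed
  have "M1 = M2"
  proof (rule measure_eqI_generator_eq[OF Int_stable_pair_measure_generator[of borel borel], of UNIV _ _ "\<lambda>_. UNIV"])
    show "sets M1 = sigma_sets UNIV {a \<times> b |a b. a \<in> sets borel \<and> b \<in> sets borel}"
      by (simp add: M1_def B_def sets_pair_measure)
    show "sets M2 = sigma_sets UNIV {a \<times> b |a b. a \<in> sets borel \<and> b \<in> sets borel}"
      by (simp add: sets_M2 B_def sets_pair_measure)
    show "range (\<lambda>_::nat. UNIV) \<subseteq> {a \<times> b |a b. (a::'a set) \<in> sets borel \<and> (b::'a set) \<in> sets borel}"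
      by (auto intro!: exI[of _ UNIV])
    have "emeasure M1 UNIV = (\<integral>\<^sup>+ z. 1 \<partial>M1)" by (simp add: M1_def B_def space_pair_measure)
    also have "\<dots> = (\<integral>\<^sup>+ \<omega>. W \<omega> \<partial>P)" using M1[of "\<lambda>_. 1"] by simp
    also have "\<dots> \<le> (\<integral>\<^sup>+ \<omega>. 1 \<partial>P)" by (intro nn_integral_mono W)
    finally have "emeasure M1 UNIV \<le> 1" by (simp add: emeasure_space_1)
    then show "emeasure M1 UNIV \<noteq> \<infinity>" by (auto simp: top_unique)
    fix X :: "('a \<times> 'a) set" assume "X \<in> {a \<times> b |a b. a \<in> sets borel \<and> b \<in> sets borel}"
    then obtain a b where X: "X = a \<times> b" and [measurable]: "a \<in> sets borel" "b \<in> sets borel" by auto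
    have jump_measure: "ennreal (measure (jump_kernel \<mu> k u) b) = (\<integral>\<^sup>+ y. indicator b y * ennreal (tot u y) \<partial>\<mu>)" for u
    proof -
      have em: "emeasure (jump_kernel \<mu> k u) F = (\<integral>\<^sup>+ y. ennreal (tot u y) * indicator F y \<partial>\<mu>)" if "F \<in> sets borel" for F
        unfolding jump_kernel_def using that by (intro emeasure_density) (auto simp: sets_\<mu>)
      have "emeasure (jump_kernel \<mu> k u) b \<le> (\<integral>\<^sup>+ y. ennreal (tot u y) \<partial>\<mu>)"
        unfolding em[OF \<open>b \<in> sets borel\<close>] by (intro nn_integral_mono) (auto simp: indicator_def)
      then have "emeasure (jump_kernel \<mu> k u) b \<noteq> \<infinity>" by (auto simp: nn_integral_total top_unique)
      then show ?thesis
        using em[OF \<open>b \<in> sets borel\<close>] emeasure_eq_ennreal_measure[of "jump_kernel \<mu> k u" b]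
        by (simp add: mult.commute)
    qed
    have cond: "AE \<omega> in P. cond_prob_given P (sigma_past P J n) {\<omega> \<in> space P. J (Suc n) \<omega> \<in> b} \<omega>
          = measure (jump_kernel \<mu> k (J n \<omega>)) b"
      using process unfolding markov_renewal_process_def by auto
    have "emeasure M1 X = (\<integral>\<^sup>+ z. indicator X z \<partial>M1)" by (simp add: X M1_def B_def)
    also have "\<dots> = (\<integral>\<^sup>+ \<omega>. W \<omega> * indicator X (J n \<omega>, J (Suc n) \<omega>) \<partial>P)" by (rule M1) (simp add: X)
    also have "\<dots> = (\<integral>\<^sup>+ \<omega>. (W \<omega> * indicator a (J n \<omega>)) * indicator {\<omega> \<in> space P. J (Suc n) \<omega> \<in> b} \<omega> \<partial>P)"
      by (intro nn_integral_cong) (auto simp: X indicator_def)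
    also have "\<dots> = (\<integral>\<^sup>+ \<omega>. (W \<omega> * indicator a (J n \<omega>)) * ennreal (measure (jump_kernel \<mu> k (J n \<omega>)) b) \<partial>P)"
      by (rule nn_integral_cond_prob[OF prob_space_axioms subalgebra_past _ cond]) measurable
    also have "\<dots> = (\<integral>\<^sup>+ \<omega>. W \<omega> * (\<integral>\<^sup>+ y. indicator X (J n \<omega>, y) * ennreal (tot (J n \<omega>) y) \<partial>\<mu>) \<partial>P)"
      unfolding jump_measure by (intro nn_integral_cong) (auto simp: X indicator_def)
    also have "\<dots> = (\<integral>\<^sup>+ z. indicator X z \<partial>M2)" by (rule M2[symmetric]) (simp add: X)
    also have "\<dots> = emeasure M2 X" by (rule nn_integral_indicator) (simp add: sets_M2 X B_def)
    finally show "emeasure M1 X = emeasure M2 X" .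
  qed auto
  then show ?thesis using M1[of "\<lambda>(u, v). \<phi> u v"] M2[of "\<lambda>(u, v). \<phi> u v"] by simp
qed

text \<open>The renewal identity in its elementary form: first the increments are integrated out given \<open>J\<close>, then the last
jump given the past, and finally the first \<open>j\<close> increments are put back.\<close>

lemma transform_one_step:
  assumes s: "0 \<le> s" "s \<le> 1" and [measurable]: "f \<in> borel_measurable borel"
  shows "(\<integral>\<^sup>+ \<omega>. ennreal (s ^ \<tau> (Suc j) \<omega>) * f (J (Suc j) \<omega>) \<partial>P)
    = (\<integral>\<^sup>+ \<omega>. ennreal (s ^ \<tau> j \<omega>) * (\<integral>\<^sup>+ y. (\<Sum>m. ennreal (s ^ Suc m * k (Suc m) (J j \<omega>) y)) * f y \<partial>\<mu>) \<partial>P)"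
proof -
  define W where "W \<omega> = (\<Prod>i<j. step_transform s (J i \<omega>) (J (Suc i) \<omega>))" for \<omega>
  have W_meas: "W \<in> borel_measurable (sigma_past P J j)"
    unfolding W_def[abs_def] by (intro borel_measurable_prod_ennreal measurable_step_transform J_past_measurable) auto
  have W_le: "W \<omega> \<le> 1" for \<omega>
    unfolding W_def using step_transform_le_1[OF s] by (intro prod_le_1) auto
  have mult: "ennreal (s ^ Suc m) * step_prob m u v * ennreal (tot u v) = ennreal (s ^ Suc m * k (Suc m) u v)" for m u v
    using s k_nonneg total_pos[of u v]
    by (simp add: step_prob_def ennreal_mult[symmetric] less_imp_neq[symmetric])
  have kernel: "step_transform s u v * ennreal (tot u v) = (\<Sum>m. ennreal (s ^ Suc m * k (Suc m) u v))" for u v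
    unfolding step_transform_def by (subst ennreal_suminf_multc[symmetric]) (simp only: mult)
  have "(\<integral>\<^sup>+ \<omega>. ennreal (s ^ \<tau> (Suc j) \<omega>) * f (J (Suc j) \<omega>) \<partial>P)
      = (\<integral>\<^sup>+ \<omega>. (\<Prod>i<Suc j. step_transform s (J i \<omega>) (J (Suc i) \<omega>)) * f (J (Suc j) \<omega>) \<partial>P)"
    using transform_given_chain[OF s(1), of "{}" "Suc j" "\<lambda>\<omega>. f (J (Suc j) \<omega>)"] by simp
  also have "\<dots> = (\<integral>\<^sup>+ \<omega>. W \<omega> * (step_transform s (J j \<omega>) (J (Suc j) \<omega>) * f (J (Suc j) \<omega>)) \<partial>P)"
    by (simp add: W_def mult.assoc)
  also have "\<dots> = (\<integral>\<^sup>+ \<omega>. W \<omega> * (\<integral>\<^sup>+ y. step_transform s (J j \<omega>) y * f y * ennreal (tot (J j \<omega>) y) \<partial>\<mu>) \<partial>P)"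
    by (rule nn_integral_jump[OF W_meas W_le]) measurable
  also have "\<dots> = (\<integral>\<^sup>+ \<omega>. W \<omega> * (\<integral>\<^sup>+ y. (\<Sum>m. ennreal (s ^ Suc m * k (Suc m) (J j \<omega>) y)) * f y \<partial>\<mu>) \<partial>P)"
    unfolding kernel[symmetric] by (simp add: mult_ac)
  also have "\<dots> = (\<integral>\<^sup>+ \<omega>. ennreal (s ^ \<tau> j \<omega>) * (\<integral>\<^sup>+ y. (\<Sum>m. ennreal (s ^ Suc m * k (Suc m) (J j \<omega>) y)) * f y \<partial>\<mu>) \<partial>P)"
    unfolding W_def
    using transform_given_chain[OF s(1), of "{}" j "\<lambda>\<omega>. \<integral>\<^sup>+ y. (\<Sum>m. ennreal (s ^ Suc m * k (Suc m) (J j \<omega>) y)) * f y \<partial>\<mu>"]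
    by simp
  finally show ?thesis .
qed

end

section \<open>Discounted potentials\<close>

context markov_renewal
begin

lemma \<tau>_ge: "AE \<omega> in P. j \<le> \<tau> j \<omega>"
proof (induction j)
  case (Suc j)
  from Suc increments_positive[of j] show ?case
    by eventually_elim (auto simp: increment_event_def)
qed simp

definition laplace_kernel :: "real \<Rightarrow> 'a \<Rightarrow> 'a \<Rightarrow> real" where
  "laplace_kernel l u v = (\<Sum>m. exp (- l) ^ Suc m * k (Suc m) u v)"

text \<open>The operators \<open>Q\<^sub>l\<close> and the functionals \<open>E\<^sub>x[exp(-l \<tau>\<^sub>j) f(J\<^sub>j)]\<close> and \<open>V\<^sub>l\<close> of the introduction.  Powers of \<open>exp(-l)\<close>
are used instead of \<open>exp(-l n)\<close> so that generating functions with \<open>s = exp(-l)\<close> apply directly.\<close>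

definition discounted_step :: "real \<Rightarrow> ('a \<Rightarrow> real) \<Rightarrow> 'a \<Rightarrow> real" where
  "discounted_step l f u = (\<integral> v. laplace_kernel l u v * f v \<partial>\<mu>)"

definition discounted_mean :: "real \<Rightarrow> ('a \<Rightarrow> real) \<Rightarrow> nat \<Rightarrow> real" where
  "discounted_mean l f j = (\<integral> \<omega>. exp (- l) ^ \<tau> j \<omega> * f (J j \<omega>) \<partial>P)"

definition potential :: "real \<Rightarrow> ('a \<Rightarrow> real) \<Rightarrow> real" where
  "potential l f = (\<Sum>j. discounted_mean l f j)"

definition bounded_borel :: "('a \<Rightarrow> real) \<Rightarrow> bool" where
  "bounded_borel f \<longleftrightarrow> f \<in> borel_measurable borel \<and> (\<exists>M. \<forall>u. \<bar>f u\<bar> \<le> M)"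

lemma bounded_borelI: "f \<in> borel_measurable borel \<Longrightarrow> (\<And>u. \<bar>f u\<bar> \<le> M) \<Longrightarrow> bounded_borel f"
  by (auto simp: bounded_borel_def)

lemma bounded_borel_continuous: "continuous_on UNIV f \<Longrightarrow> bounded_borel f"
proof -
  assume f: "continuous_on UNIV f"
  obtain M where "\<And>u. \<bar>f u\<bar> \<le> M" using continuous_bounded[OF f] by blast
  then show ?thesis by (rule bounded_borelI[OF borel_measurable_continuous_onI[OF f]])
qed

lemma bounded_borel_const: "bounded_borel (\<lambda>_. c)"
  by (rule bounded_borelI[of _ "\<bar>c\<bar>"]) auto

lemma bounded_borel_diff:
  assumes "bounded_borel f" "bounded_borel g"
  shows "bounded_borel (\<lambda>u. f u - g u)"
proof -
  obtain M N where "\<And>u. \<bar>f u\<bar> \<le> M" "\<And>u. \<bar>g u\<bar> \<le> N" using assms by (auto simp: bounded_borel_def)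
  then have "\<bar>f u - g u\<bar> \<le> M + N" for u by (meson abs_triangle_ineq4 add_mono order_trans)
  then show ?thesis using assms by (intro bounded_borelI) (auto simp: bounded_borel_def)
qed

lemma bounded_borel_cmult:
  assumes "bounded_borel f"
  shows "bounded_borel (\<lambda>u. c * f u)"
proof -
  obtain M where "\<And>u. \<bar>f u\<bar> \<le> M" using assms by (auto simp: bounded_borel_def)
  then have "\<bar>c * f u\<bar> \<le> \<bar>c\<bar> * M" for u by (simp add: abs_mult mult_left_mono)
  then show ?thesis using assms by (intro bounded_borelI) (auto simp: bounded_borel_def)
qed

lemma exp_power_bounds:
  fixes l :: real
  assumes "0 \<le> l"
  shows "0 \<le> exp (- l) ^ n" "exp (- l) ^ n \<le> 1"
  using assms by (auto intro: power_le_one)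

lemma laplace_kernel_summable:
  assumes "0 \<le> l"
  shows "summable (\<lambda>m. exp (- l) ^ Suc m * k (Suc m) u v)"
proof (rule summable_comparison_test'[OF k_summable[of u v]])
  fix m
  show "norm (exp (- l) ^ Suc m * k (Suc m) u v) \<le> k (Suc m) u v"
    using mult_right_mono[OF exp_power_bounds(2)[OF assms, of "Suc m"] k_nonneg[of m u v]] k_nonneg[of m u v]
    by (simp add: abs_mult)
qed

lemma laplace_kernel_bounds:
  assumes "0 \<le> l"
  shows "0 \<le> laplace_kernel l u v" "laplace_kernel l u v \<le> tot u v"
proof -
  show "0 \<le> laplace_kernel l u v"
    unfolding laplace_kernel_def using k_nonneg by (intro suminf_nonneg laplace_kernel_summable assms) simp
  show "laplace_kernel l u v \<le> tot u v"
    unfolding laplace_kernel_def total_density_def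
  proof (rule suminf_le[OF _ laplace_kernel_summable[OF assms] k_summable])
    fix m show "exp (- l) ^ Suc m * k (Suc m) u v \<le> k (Suc m) u v"
      using mult_right_mono[OF exp_power_bounds(2)[OF assms, of "Suc m"] k_nonneg[of m u v]] by simp
  qed
qed

lemma measurable_laplace_kernel [measurable (raw)]:
  assumes [measurable]: "f \<in> measurable N borel" "g \<in> measurable N borel"
  shows "(\<lambda>\<omega>. laplace_kernel l (f \<omega>) (g \<omega>)) \<in> borel_measurable N"
  unfolding laplace_kernel_def by measurable

lemma integrable_laplace_kernel:
  assumes "0 \<le> l" "bounded_borel f"
  shows "integrable \<mu> (\<lambda>v. laplace_kernel l u v * f v)"
proof -
  have [measurable]: "f \<in> borel_measurable borel" using assms by (simp add: bounded_borel_def)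
  obtain M where M: "\<And>u. \<bar>f u\<bar> \<le> M" using assms by (auto simp: bounded_borel_def)
  obtain T where T: "0 \<le> T" "\<And>u v. tot u v \<le> T" using total_bounds by blast
  show ?thesis
  proof (rule integrable_\<mu>[where M = "T * M"])
    show "(\<lambda>v. laplace_kernel l u v * f v) \<in> borel_measurable borel" by measurable
    fix v
    have "\<bar>laplace_kernel l u v\<bar> \<le> T"
      using laplace_kernel_bounds[OF assms(1), of u v] T(2)[of u v] by linarith
    then show "\<bar>laplace_kernel l u v * f v\<bar> \<le> T * M"
      using M[of v] T(1) by (simp add: abs_mult mult_mono)
  qed
qed

lemma bounded_borel_discounted_step:
  assumes l: "0 \<le> l" and f: "bounded_borel f"
  shows "bounded_borel (discounted_step l f)"
proof -
  have [measurable]: "f \<in> borel_measurable borel" using f by (simp add: bounded_borel_def)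
  obtain M where M: "\<And>u. \<bar>f u\<bar> \<le> M" using f by (auto simp: bounded_borel_def)
  have M0: "0 \<le> M" using M[of undefined] by linarith
  show ?thesis
  proof (rule bounded_borelI[where M = M])
    have "(\<lambda>u. \<integral> v. laplace_kernel l u v * f v \<partial>\<mu>) \<in> borel_measurable borel"
      by (rule ref.borel_measurable_lebesgue_integral) measurable
    then show "discounted_step l f \<in> borel_measurable borel" by (simp add: discounted_step_def[abs_def])
    fix u
    have "\<bar>discounted_step l f u\<bar> \<le> (\<integral> v. \<bar>laplace_kernel l u v * f v\<bar> \<partial>\<mu>)" unfolding discounted_step_def by (rule integral_abs_bound)
    also have "\<dots> \<le> (\<integral> v. tot u v * M \<partial>\<mu>)"
    proof (rule integral_mono)
      show "integrable \<mu> (\<lambda>v. \<bar>laplace_kernel l u v * f v\<bar>)"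
        by (intro integrable_abs integrable_laplace_kernel l f)
      show "integrable \<mu> (\<lambda>v. tot u v * M)"
        by (rule integrable_total_mult[of "\<lambda>_. M" M]) (use M0 in auto)
      fix v show "\<bar>laplace_kernel l u v * f v\<bar> \<le> tot u v * M"
        using laplace_kernel_bounds[OF l, of u v] M[of v] by (auto simp: abs_mult intro!: mult_mono)
    qed
    also have "\<dots> = M" by (simp add: integral_total)
    finally show "\<bar>discounted_step l f u\<bar> \<le> M" .
  qed
qed

lemma discounted_mean_integrable:
  assumes l: "0 \<le> l" and f: "bounded_borel f"
  shows "integrable P (\<lambda>\<omega>. exp (- l) ^ \<tau> j \<omega> * f (J j \<omega>))"
proof -
  have [measurable]: "f \<in> borel_measurable borel" using f by (simp add: bounded_borel_def)
  obtain M where M: "\<And>u. \<bar>f u\<bar> \<le> M" using f by (auto simp: bounded_borel_def)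
  show ?thesis
  proof (rule integrable_const_bound[where B = M])
    show "AE \<omega> in P. norm (exp (- l) ^ \<tau> j \<omega> * f (J j \<omega>)) \<le> M"
    proof (rule AE_I2)
      fix \<omega>
      have "exp (- l) ^ \<tau> j \<omega> * \<bar>f (J j \<omega>)\<bar> \<le> 1 * M"
        using exp_power_bounds[OF l] M by (intro mult_mono) auto
      then show "norm (exp (- l) ^ \<tau> j \<omega> * f (J j \<omega>)) \<le> M" by (simp add: abs_mult)
    qed
  qed measurable
qed

lemma discounted_mean_diff:
  assumes "0 \<le> l" "bounded_borel f" "bounded_borel g"
  shows "discounted_mean l (\<lambda>u. f u - g u) j = discounted_mean l f j - discounted_mean l g j"
  unfolding discounted_mean_def right_diff_distrib
  by (rule Bochner_Integration.integral_diff) (intro discounted_mean_integrable assms)+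

text \<open>As \<open>\<tau>\<^sub>j \<ge> j\<close>, the discounted means decay geometrically, and \<open>V\<^sub>l\<close> is finite for \<open>l > 0\<close>.\<close>

lemma discounted_mean_bound:
  assumes l: "0 \<le> l" and f: "bounded_borel f" and M: "\<And>u. \<bar>f u\<bar> \<le> M"
  shows "\<bar>discounted_mean l f j\<bar> \<le> exp (- l) ^ j * M"
proof -
  have M0: "0 \<le> M" using M[of undefined] by linarith
  have "\<bar>discounted_mean l f j\<bar> \<le> (\<integral> \<omega>. \<bar>exp (- l) ^ \<tau> j \<omega> * f (J j \<omega>)\<bar> \<partial>P)"
    unfolding discounted_mean_def by (rule integral_abs_bound)
  also have "\<dots> \<le> (\<integral> \<omega>. exp (- l) ^ j * M \<partial>P)"
  proof (rule integral_mono_AE)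
    show "integrable P (\<lambda>\<omega>. \<bar>exp (- l) ^ \<tau> j \<omega> * f (J j \<omega>)\<bar>)"
      by (intro integrable_abs discounted_mean_integrable l f)
    show "AE \<omega> in P. \<bar>exp (- l) ^ \<tau> j \<omega> * f (J j \<omega>)\<bar> \<le> exp (- l) ^ j * M"
      using \<tau>_ge[of j]
    proof eventually_elim
      case (elim \<omega>)
      have "exp (- l) ^ \<tau> j \<omega> \<le> exp (- l) ^ j" using l elim by (intro power_decreasing) auto
      then show ?case using M[of "J j \<omega>"] M0 by (auto simp: abs_mult intro!: mult_mono)
    qed
  qed simp
  finally show ?thesis by (simp add: prob_space)
qed

lemma discounted_mean_summable:
  assumes l: "0 < l" and f: "bounded_borel f"
  shows "summable (discounted_mean l f)"
proof -
  obtain M where M: "\<And>u. \<bar>f u\<bar> \<le> M" using f by (auto simp: bounded_borel_def)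
  have "summable (\<lambda>j. exp (- l) ^ j * M)" using l by (intro summable_mult2 summable_geometric) simp
  then show ?thesis
    by (rule summable_comparison_test') (use discounted_mean_bound[OF less_imp_le[OF l] f M] in simp)
qed

lemma potential_diff:
  assumes "0 < l" "bounded_borel f" "bounded_borel g"
  shows "potential l (\<lambda>u. f u - g u) = potential l f - potential l g"
proof -
  have "discounted_mean l (\<lambda>u. f u - g u) = (\<lambda>j. discounted_mean l f j - discounted_mean l g j)"
    using discounted_mean_diff[OF less_imp_le[OF assms(1)] assms(2,3)] by (simp add: fun_eq_iff)
  then show ?thesis
    unfolding potential_def
    using suminf_diff[OF discounted_mean_summable[OF assms(1,2)] discounted_mean_summable[OF assms(1,3)]] by simp
qed

lemma potential_cmult:
  assumes "0 < l" "bounded_borel f"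
  shows "potential l (\<lambda>u. c * f u) = c * potential l f"
proof -
  have "discounted_mean l (\<lambda>u. c * f u) = (\<lambda>j. c * discounted_mean l f j)"
    by (simp add: discounted_mean_def fun_eq_iff mult.left_commute)
  then show ?thesis unfolding potential_def using suminf_mult[OF discounted_mean_summable[OF assms]] by simp
qed

lemma potential_mono:
  assumes "0 < l" "bounded_borel f" "bounded_borel g" "\<And>u. f u \<le> g u"
  shows "potential l f \<le> potential l g"
  unfolding potential_def
proof (rule suminf_le[OF _ discounted_mean_summable[OF assms(1,2)] discounted_mean_summable[OF assms(1,3)]])
  fix j show "discounted_mean l f j \<le> discounted_mean l g j"
    unfolding discounted_mean_def using assms by (intro integral_mono discounted_mean_integrable mult_left_mono) auto
qed

lemma potential_abs_le:
  assumes "0 < l" "bounded_borel f" "bounded_borel g" "\<And>u. \<bar>f u\<bar> \<le> g u"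
  shows "\<bar>potential l f\<bar> \<le> potential l g"
proof -
  have "potential l f \<le> potential l g"
    using assms by (intro potential_mono) (auto intro: abs_le_D1)
  moreover have "potential l (\<lambda>u. - 1 * f u) \<le> potential l g"
    using assms by (intro potential_mono bounded_borel_cmult) (auto intro: abs_le_D2)
  ultimately show ?thesis using assms by (simp only: potential_cmult)
qed

text \<open>The generating function identity holds for nonnegative functions; adding a constant extends it to all bounded
ones.\<close>

lemma discounted_mean_step:
  assumes l: "0 \<le> l" and f: "bounded_borel f"
  shows "discounted_mean l f (Suc j) = discounted_mean l (discounted_step l f) j"
proof -
  have nonneg: "discounted_mean l g (Suc j) = discounted_mean l (discounted_step l g) j" if g: "bounded_borel g" and g0: "\<And>u. 0 \<le> g u" for g
  proof -
    have [measurable]: "g \<in> borel_measurable borel" using g by (simp add: bounded_borel_def)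
    have Qg0: "0 \<le> discounted_step l g u" for u
      unfolding discounted_step_def using laplace_kernel_bounds(1)[OF l] g0 by (intro Bochner_Integration.integral_nonneg) simp
    have discounted_mean_nn: "ennreal (discounted_mean l h i) = (\<integral>\<^sup>+ \<omega>. ennreal (exp (- l) ^ \<tau> i \<omega>) * ennreal (h (J i \<omega>)) \<partial>P)"
      if "bounded_borel h" "\<And>u. 0 \<le> h u" for h i
      unfolding discounted_mean_def using that
      by (subst nn_integral_eq_integral[OF discounted_mean_integrable[OF l], symmetric]) (auto simp: ennreal_mult)
    have inner: "(\<integral>\<^sup>+ v. (\<Sum>m. ennreal (exp (- l) ^ Suc m * k (Suc m) u v)) * ennreal (g v) \<partial>\<mu>) = ennreal (discounted_step l g u)" for u
    proof -
      have "(\<Sum>m. ennreal (exp (- l) ^ Suc m * k (Suc m) u v)) = ennreal (laplace_kernel l u v)" for v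
        unfolding laplace_kernel_def using k_nonneg
        by (intro suminf_ennreal2 laplace_kernel_summable l) simp
      then have "(\<integral>\<^sup>+ v. (\<Sum>m. ennreal (exp (- l) ^ Suc m * k (Suc m) u v)) * ennreal (g v) \<partial>\<mu>)
          = (\<integral>\<^sup>+ v. ennreal (laplace_kernel l u v * g v) \<partial>\<mu>)"
        using laplace_kernel_bounds(1)[OF l] g0 by (simp add: ennreal_mult)
      also have "\<dots> = ennreal (discounted_step l g u)"
        unfolding discounted_step_def using laplace_kernel_bounds(1)[OF l] g0
        by (intro nn_integral_eq_integral integrable_laplace_kernel l g) simp
      finally show ?thesis .
    qed
    have "ennreal (discounted_mean l g (Suc j)) = ennreal (discounted_mean l (discounted_step l g) j)"
      unfolding discounted_mean_nn[OF g g0] discounted_mean_nn[OF bounded_borel_discounted_step[OF l g] Qg0]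
      using transform_one_step[of "exp (- l)" "\<lambda>u. ennreal (g u)" j, unfolded inner] l by simp
    moreover have "0 \<le> discounted_mean l g (Suc j)" "0 \<le> discounted_mean l (discounted_step l g) j"
      unfolding discounted_mean_def using g0 Qg0 by (auto intro!: Bochner_Integration.integral_nonneg)
    ultimately show ?thesis by simp
  qed
  obtain M where M: "\<And>u. \<bar>f u\<bar> \<le> M" using f by (auto simp: bounded_borel_def)
  have M0: "0 \<le> M" using M[of undefined] by linarith
  define g where "g u = f u - (- M)" for u
  have g: "bounded_borel g" unfolding g_def by (intro bounded_borel_diff f bounded_borel_const)
  have g0: "0 \<le> g u" for u using M[of u] by (simp add: g_def)
  have f_eq: "f = (\<lambda>u. g u - M)" by (auto simp: g_def)
  have Qf: "discounted_step l f = (\<lambda>u. discounted_step l g u - discounted_step l (\<lambda>_. M) u)"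
    unfolding discounted_step_def fun_eq_iff f_eq right_diff_distrib
    by (intro allI Bochner_Integration.integral_diff integrable_laplace_kernel l g bounded_borel_const)
  show ?thesis
    unfolding Qf discounted_mean_diff[OF l bounded_borel_discounted_step[OF l g] bounded_borel_discounted_step[OF l bounded_borel_const]]
    using nonneg[OF g g0] nonneg[OF bounded_borel_const, of M] M0
      discounted_mean_diff[OF l g bounded_borel_const[of M], of "Suc j"] f_eq by simp
qed

lemma discounted_mean_0:
  assumes [measurable]: "f \<in> borel_measurable borel"
  shows "discounted_mean l f 0 = f x"
proof -
  have "discounted_mean l f 0 = (\<integral> \<omega>. f x \<partial>P)"
    unfolding discounted_mean_def
  proof (rule integral_cong_AE)
    show "AE \<omega> in P. exp (- l) ^ \<tau> 0 \<omega> * f (J 0 \<omega>) = f x"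
      using start by eventually_elim simp
  qed measurable
  then show ?thesis by (simp add: prob_space)
qed

lemma potential_resolvent:
  assumes l: "0 < l" and f: "bounded_borel f"
  shows "potential l f = f x + potential l (discounted_step l f)"
proof -
  have "potential l f = discounted_mean l f 0 + (\<Sum>j. discounted_mean l f (Suc j))"
    unfolding potential_def using suminf_split_head[OF discounted_mean_summable[OF l f]] by simp
  then show ?thesis
    using f discounted_mean_step[OF less_imp_le[OF l] f]
    by (simp add: discounted_mean_0 bounded_borel_def potential_def)
qed

end

locale heavy_tailed_renewal = markov_renewal \<mu> \<pi> k x P \<tau> J
  for \<mu> \<pi> :: "'a::polish_space measure" and k x and P :: "'w measure" and \<tau> J +
  fixes \<Phi> :: "'a \<times> 'a \<Rightarrow> real" and L :: "real \<Rightarrow> real" and \<alpha> :: real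
  assumes \<alpha>: "0 < \<alpha>" "\<alpha> < 1"
    and \<Phi>_pos: "\<And>z. 0 < \<Phi> z" and \<Phi>_continuous: "continuous_on UNIV \<Phi>"
    and L: "slowly_varying L"
    and tail: "uniform_limit UNIV
           (\<lambda>n (x, y). k n x y / (\<Phi> (x, y) * L (real n) / real n powr (1 + \<alpha>)))
           (\<lambda>_. 1) sequentially"
begin

definition tail_mass :: "'a \<Rightarrow> real" where
  "tail_mass u = (\<integral> v. \<Phi> (u, v) \<partial>\<mu>)"

definition killing :: "real \<Rightarrow> 'a \<Rightarrow> real" where
  "killing l u = 1 - discounted_step l (\<lambda>_. 1) u"

lemma \<Phi>_continuous_curried: "continuous_on UNIV (\<lambda>(u, v). \<Phi> (u, v))"
  using \<Phi>_continuous by (simp add: case_prod_beta)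

lemma \<Phi>_integrable: "integrable \<mu> (\<lambda>v. \<Phi> (u, v))"
proof -
  obtain M where M: "\<And>u v. \<bar>\<Phi> (u, v)\<bar> \<le> M"
    using continuous_bounds[of "\<lambda>u v. \<Phi> (u, v)", OF \<Phi>_continuous_curried] by blast
  show ?thesis
    by (rule integrable_\<mu>[OF _ M]) (rule section_measurable[of "\<lambda>u v. \<Phi> (u, v)", OF \<Phi>_continuous_curried])
qed

lemma tail_mass_continuous: "continuous_on UNIV tail_mass"
  unfolding tail_mass_def[abs_def] by (rule continuous_on_integral) (rule \<Phi>_continuous_curried)

lemma tail_mass_lower: obtains c where "0 < c" "\<And>u. c \<le> tail_mass u"
proof -
  obtain c where c: "0 < c" "\<And>u v. c \<le> \<Phi> (u, v)"
    using continuous_pos_bound[of "\<lambda>u v. \<Phi> (u, v)", OF \<Phi>_continuous_curried] \<Phi>_pos by blast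
  show ?thesis
  proof (rule that)
    show "0 < c * measure \<mu> UNIV" using c measure_\<mu>_pos by simp
    fix u
    have "(\<integral> v. c \<partial>\<mu>) \<le> tail_mass u"
      unfolding tail_mass_def using c by (intro integral_mono \<Phi>_integrable) auto
    then show "c * measure \<mu> UNIV \<le> tail_mass u" by (simp add: mult.commute)
  qed
qed

lemma killing_eq:
  assumes "0 \<le> l"
  shows "killing l u = (\<integral> v. tot u v - laplace_kernel l u v \<partial>\<mu>)"
proof -
  have "integrable \<mu> (\<lambda>v. laplace_kernel l u v * 1)"
    by (rule integrable_laplace_kernel[OF assms bounded_borel_const])
  moreover have "integrable \<mu> (\<lambda>v. tot u v * 1)"
    by (rule integrable_total_mult[where M = 1]) simp_all
  ultimately show ?thesis
    unfolding killing_def discounted_step_def mult_1_right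
    by (subst Bochner_Integration.integral_diff) (simp_all only: integral_total)
qed

text \<open>The Abelian theorem is used with index set \<open>'a \<times> 'a\<close>: its uniformity in both variables allows the
integration over the second one.\<close>

lemma killing_uniform:
  assumes "0 < e"
  shows "\<forall>\<^sub>F t in at_top. \<forall>u. \<bar>t powr \<alpha> / L t * killing (1 / t) u - Gamma (1 - \<alpha>) / \<alpha> * tail_mass u\<bar> \<le> e"
proof -
  define g where "g = Gamma (1 - \<alpha>) / \<alpha>"
  define m where "m = measure \<mu> UNIV"
  have m: "0 < m" unfolding m_def by (rule measure_\<mu>_pos)
  obtain B where B: "\<And>u v. \<bar>\<Phi> (u, v)\<bar> \<le> B"
    using continuous_bounds[of "\<lambda>u v. \<Phi> (u, v)", OF \<Phi>_continuous_curried] by blast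
  obtain T where T: "0 \<le> T" "\<And>u v. tot u v \<le> T" using total_bounds by blast
  define \<kappa> where "\<kappa> z n = k n (fst z) (snd z)" for z n
  have "uniform_limit UNIV
    (\<lambda>t z. t powr \<alpha> / L t * (\<Sum>n. (1 - exp (- (real (Suc n) / t))) * \<kappa> z (Suc n)))
    (\<lambda>z. \<Phi> z * (Gamma (1 - \<alpha>) / \<alpha>)) at_top"
  proof (rule abelian_limit_uniform[OF L \<alpha> \<Phi>_pos])
    show "\<Phi> z \<le> B" for z using B[of "fst z" "snd z"] by simp
    show "0 \<le> \<kappa> z n" if "1 \<le> n" for z n
      using that k_nonneg[of "n - 1"] by (simp add: \<kappa>_def)
    show "summable (\<lambda>n. \<kappa> z (Suc n))" for z using k_summable by (simp add: \<kappa>_def)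
    show "(\<Sum>n. \<kappa> z (Suc n)) \<le> T" for z using T(2) by (simp add: \<kappa>_def total_density_def)
    show "uniform_limit UNIV (\<lambda>n z. \<kappa> z n / (\<Phi> z * L (real n) / real n powr (1 + \<alpha>))) (\<lambda>_. 1) sequentially"
      using tail by (simp add: \<kappa>_def case_prod_beta')
  qed
  from uniform_limitD[OF this, of "e / m"] assms m
  have "\<forall>\<^sub>F t in at_top. \<forall>z\<in>UNIV. dist (t powr \<alpha> / L t * (\<Sum>n. (1 - exp (- (real (Suc n) / t))) * \<kappa> z (Suc n))) (\<Phi> z * g) < e / m"
    by (simp add: g_def)
  then show ?thesis
    using eventually_gt_at_top[of 0]
  proof eventually_elim
    case (elim t)
    show ?case
    proof
      fix u
      define q where "q = t powr \<alpha> / L t"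
      have l: "0 \<le> 1 / t" using elim by simp
      have diff: "(\<Sum>n. (1 - exp (- (real (Suc n) / t))) * \<kappa> (u, v) (Suc n)) = tot u v - laplace_kernel (1 / t) u v" for v
      proof -
        have "exp (- (1 / t)) ^ Suc n = exp (- (real (Suc n) / t))" for n
          by (subst exp_of_nat_mult[symmetric]) (simp add: field_simps)
        then show ?thesis
          unfolding total_density_def laplace_kernel_def
          by (subst suminf_diff[OF k_summable laplace_kernel_summable[OF l]]) (simp add: \<kappa>_def left_diff_distrib)
      qed
      have close: "\<bar>q * (tot u v - laplace_kernel (1 / t) u v) - \<Phi> (u, v) * g\<bar> \<le> e / m" for v
        using elim(1) unfolding q_def diff[symmetric] by (auto simp: dist_real_def intro: less_imp_le)
      have int: "integrable \<mu> (\<lambda>v. tot u v - laplace_kernel (1 / t) u v)"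
        using integrable_laplace_kernel[OF l bounded_borel_const[of 1], of u] integrable_total_mult[of "\<lambda>_. 1" 1 u] by simp
      have "q * killing (1 / t) u - g * tail_mass u
          = (\<integral> v. q * (tot u v - laplace_kernel (1 / t) u v) - \<Phi> (u, v) * g \<partial>\<mu>)"
        unfolding killing_eq[OF l] tail_mass_def using int \<Phi>_integrable
        by (subst Bochner_Integration.integral_diff) (auto simp: mult.commute)
      also have "\<bar>\<dots>\<bar> \<le> (\<integral> v. \<bar>q * (tot u v - laplace_kernel (1 / t) u v) - \<Phi> (u, v) * g\<bar> \<partial>\<mu>)"
        by (rule integral_abs_bound)
      also have "\<dots> \<le> (\<integral> v. e / m \<partial>\<mu>)"
      proof (rule integral_mono)
        show "integrable \<mu> (\<lambda>v. \<bar>q * (tot u v - laplace_kernel (1 / t) u v) - \<Phi> (u, v) * g\<bar>)"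
          by (intro integrable_abs Bochner_Integration.integrable_diff integrable_mult_right
              integrable_mult_left int \<Phi>_integrable)
      qed (use close in simp_all)
      also have "\<dots> = e" using m by (simp add: m_def)
      finally show "\<bar>t powr \<alpha> / L t * killing (1 / t) u - Gamma (1 - \<alpha>) / \<alpha> * tail_mass u\<bar> \<le> e"
        by (simp add: q_def g_def)
    qed
  qed
qed

lemma bounded_borel_killing: "0 \<le> l \<Longrightarrow> bounded_borel (killing l)"
  unfolding killing_def[abs_def] by (intro bounded_borel_diff bounded_borel_const bounded_borel_discounted_step)

lemma potential_killing: "0 < l \<Longrightarrow> potential l (killing l) = 1"
  unfolding killing_def[abs_def]
  using potential_resolvent[of l "\<lambda>_. 1"] bounded_borel_const bounded_borel_discounted_step[of l "\<lambda>_. 1"]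
  by (simp add: potential_diff)

text \<open>Since \<open>V\<^sub>l(\<delta>\<^sub>l) = 1\<close> and \<open>\<delta>\<^sub>l\<close> is within a factor \<open>1 \<plusminus> \<eta>\<close> of \<open>d\<close> after normalisation, positivity of \<open>V\<^sub>l\<close>
gives \<open>|X - 1| \<le> \<eta> X\<close> for the normalised value \<open>X\<close> of \<open>V\<^sub>l(d)\<close>.\<close>

lemma potential_tail_mass:
  "((\<lambda>t. L t / t powr \<alpha> * potential (1 / t) (\<lambda>u. Gamma (1 - \<alpha>) / \<alpha> * tail_mass u)) \<longlongrightarrow> 1) at_top"
proof (rule tendstoI)
  fix e :: real assume "0 < e"
  define d where "d u = Gamma (1 - \<alpha>) / \<alpha> * tail_mass u" for u
  have g: "0 < Gamma (1 - \<alpha>) / \<alpha>" using \<alpha> by (simp add: Gamma_real_pos)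
  obtain c where c: "0 < c" "\<And>u. c \<le> tail_mass u" using tail_mass_lower by blast
  define d0 where "d0 = Gamma (1 - \<alpha>) / \<alpha> * c"
  have d0: "0 < d0" "\<And>u. d0 \<le> d u"
    unfolding d0_def d_def by (rule mult_pos_pos[OF g c(1)], rule mult_left_mono[OF c(2) less_imp_le[OF g]])
  have d_bb: "bounded_borel d"
    unfolding d_def by (intro bounded_borel_cmult bounded_borel_continuous tail_mass_continuous)
  define \<eta> where "\<eta> = min (1 / 2) (e / 3)"
  have \<eta>: "0 < \<eta>" "\<eta> \<le> 1 / 2" "\<eta> \<le> e / 3" using \<open>0 < e\<close> by (auto simp: \<eta>_def)
  obtain T where T: "1 \<le> T" "\<And>t. T \<le> t \<Longrightarrow> 0 < L t"
    using slowly_varying_uniform[OF L zero_less_one] by metis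
  have "0 < \<eta> * d0" using \<eta> d0 by simp
  from killing_uniform[OF this] show
    "\<forall>\<^sub>F t in at_top. dist (L t / t powr \<alpha> * potential (1 / t) (\<lambda>u. Gamma (1 - \<alpha>) / \<alpha> * tail_mass u)) 1 < e"
    using eventually_ge_at_top[of T]
  proof eventually_elim
    case (elim t)
    have t: "0 < t" "0 < L t" "0 < 1 / t" using elim(2) T by auto
    define q where "q = t powr \<alpha> / L t"
    have q: "0 < q" "L t / t powr \<alpha> = 1 / q" using t by (auto simp: q_def)
    have qk: "bounded_borel (\<lambda>u. q * killing (1 / t) u)"
      using t by (intro bounded_borel_cmult bounded_borel_killing) simp
    have close: "\<bar>d u - q * killing (1 / t) u\<bar> \<le> \<eta> * d u" for u
    proof -
      have "\<bar>d u - q * killing (1 / t) u\<bar> \<le> \<eta> * d0"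
        using elim(1) by (simp add: q_def d_def abs_minus_commute)
      also have "\<dots> \<le> \<eta> * d u" using \<eta> d0 by (intro mult_left_mono) auto
      finally show ?thesis .
    qed
    have "\<bar>potential (1 / t) (\<lambda>u. d u - q * killing (1 / t) u)\<bar> \<le> potential (1 / t) (\<lambda>u. \<eta> * d u)"
      by (intro potential_abs_le t bounded_borel_diff d_bb qk bounded_borel_cmult close)
    moreover have "potential (1 / t) (\<lambda>u. d u - q * killing (1 / t) u) = potential (1 / t) d - q"
      using potential_diff[OF t(3) d_bb qk] potential_killing[OF t(3)]
        potential_cmult[OF t(3) bounded_borel_killing[OF less_imp_le[OF t(3)]], where c = q] by simp
    moreover have "potential (1 / t) (\<lambda>u. \<eta> * d u) = \<eta> * potential (1 / t) d"
      by (intro potential_cmult t d_bb)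
    ultimately have V: "\<bar>potential (1 / t) d - q\<bar> \<le> \<eta> * potential (1 / t) d" by simp
    define X where "X = potential (1 / t) d / q"
    have "X - 1 = (potential (1 / t) d - q) / q" using q by (simp add: X_def diff_divide_distrib)
    then have "\<bar>X - 1\<bar> = \<bar>potential (1 / t) d - q\<bar> / q" using q(1) by (simp add: abs_divide)
    also have "\<dots> \<le> \<eta> * potential (1 / t) d / q" using V q by (intro divide_right_mono) auto
    finally have X: "\<bar>X - 1\<bar> \<le> \<eta> * X" by (simp add: X_def)
    then have "0 \<le> \<eta> * X" by (rule order_trans[OF abs_ge_zero])
    then have X0: "0 \<le> X" using \<eta> by (simp add: zero_le_mult_iff)
    have "\<eta> * X \<le> 1 / 2 * X" using \<eta> X0 by (intro mult_right_mono) auto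
    then have "X \<le> 2" using X by linarith
    then have "\<eta> * X \<le> \<eta> * 2" using \<eta> by (intro mult_left_mono) auto
    then have "\<bar>X - 1\<bar> < e" using X \<eta> \<open>0 < e\<close> by linarith
    then show ?case using q by (simp add: X_def d_def[abs_def] dist_real_def)
  qed
qed

text \<open>Subtracting the right multiple of \<open>d\<close> leaves a centred function, and on centred functions the potential is
bounded: the Poisson equation telescopes up to the killing error.\<close>

lemma potential_asymptotics:
  fixes f :: "'a \<Rightarrow> real"
  assumes f: "continuous_on UNIV f"
  shows "((\<lambda>t. L t / t powr \<alpha> * potential (1 / t) f) \<longlongrightarrow>
    (\<integral> u. f u \<partial>\<pi>) / (Gamma (1 - \<alpha>) / \<alpha> * (\<integral> u. tail_mass u \<partial>\<pi>))) at_top"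
proof -
  define d where "d u = Gamma (1 - \<alpha>) / \<alpha> * tail_mass u" for u
  have g: "0 < Gamma (1 - \<alpha>) / \<alpha>" using \<alpha> by (simp add: Gamma_real_pos)
  have d_cont: "continuous_on UNIV d" unfolding d_def by (intro continuous_on_mult continuous_on_const tail_mass_continuous)
  have int: "integrable \<pi> h" if h: "continuous_on UNIV h" for h :: "'a \<Rightarrow> real"
  proof -
    obtain H where "\<And>u. \<bar>h u\<bar> \<le> H" using continuous_bounded[OF h] by blast
    then show ?thesis
      using borel_measurable_continuous_onI[OF h] by (intro inv.integrable_const_bound[where B = H]) auto
  qed
  obtain c0 where c0: "0 < c0" "\<And>u. c0 \<le> tail_mass u" using tail_mass_lower by blast
  have "(\<integral> u. c0 \<partial>\<pi>) \<le> (\<integral> u. tail_mass u \<partial>\<pi>)"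
    using c0 by (intro integral_mono int tail_mass_continuous) auto
  then have "0 < (\<integral> u. tail_mass u \<partial>\<pi>)" using c0(1) inv.prob_space by simp
  then have d_pos: "0 < (\<integral> u. d u \<partial>\<pi>)"
    unfolding d_def integral_mult_right_zero by (rule mult_pos_pos[OF g])
  define c where "c = (\<integral> u. f u \<partial>\<pi>) / (\<integral> u. d u \<partial>\<pi>)"
  define r where "r u = f u - c * d u" for u
  have r_cont: "continuous_on UNIV r" unfolding r_def by (intro continuous_on_diff continuous_on_mult continuous_on_const f d_cont)
  have "(\<integral> u. r u \<partial>\<pi>) = 0"
    unfolding r_def using int[OF f] int[OF d_cont] d_pos by (simp add: c_def)
  then obtain h where h: "continuous_on UNIV h" "\<And>u. r u = h u - (\<integral> v. tot u v * h v \<partial>\<mu>)"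
    using poisson_equation[OF r_cont] by blast
  obtain H where H: "\<And>u. \<bar>h u\<bar> \<le> H" using continuous_bounded[OF h(1)] by blast
  note bb = bounded_borel_continuous[OF f] bounded_borel_continuous[OF d_cont]
    bounded_borel_continuous[OF r_cont] bounded_borel_continuous[OF h(1)]
  have r_bound: "\<bar>potential l r\<bar> \<le> 2 * H" if l: "0 < l" for l
  proof -
    have hm: "h \<in> borel_measurable borel" using bb(4) by (simp add: bounded_borel_def)
    \<comment> \<open>The error of using \<open>Q\<^sub>l\<close> instead of \<open>Q\<^sub>0\<close> in the Poisson equation; it equals \<open>(Q\<^sub>0 - Q\<^sub>l) h\<close>.\<close>
    define \<rho> where "\<rho> u = (h u - discounted_step l h u) - r u" for u
    have \<rho>_bb: "bounded_borel \<rho>" unfolding \<rho>_def using l by (intro bounded_borel_diff bb bounded_borel_discounted_step) simp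
    have \<rho>_le: "\<bar>\<rho> u\<bar> \<le> H * killing l u" for u
    proof -
      have int1: "integrable \<mu> (\<lambda>v. laplace_kernel l u v * h v)"
        using l by (intro integrable_laplace_kernel bb) simp
      have int2: "integrable \<mu> (\<lambda>v. tot u v * h v)" by (rule integrable_total_mult[OF hm H])
      have int3: "integrable \<mu> (\<lambda>v. tot u v - laplace_kernel l u v)"
        using integrable_laplace_kernel[OF less_imp_le[OF l] bounded_borel_const[of 1], of u]
          integrable_total_mult[of "\<lambda>_. 1" 1 u] by simp
      have "\<rho> u = (\<integral> v. (tot u v - laplace_kernel l u v) * h v \<partial>\<mu>)"
        unfolding \<rho>_def h(2) discounted_step_def left_diff_distrib using int1 int2 by simp
      also have "\<bar>\<dots>\<bar> \<le> (\<integral> v. \<bar>(tot u v - laplace_kernel l u v) * h v\<bar> \<partial>\<mu>)"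
        by (rule integral_abs_bound)
      also have "\<dots> \<le> (\<integral> v. H * (tot u v - laplace_kernel l u v) \<partial>\<mu>)"
      proof (rule integral_mono)
        show "integrable \<mu> (\<lambda>v. \<bar>(tot u v - laplace_kernel l u v) * h v\<bar>)"
          unfolding left_diff_distrib using int1 int2 by simp
        show "integrable \<mu> (\<lambda>v. H * (tot u v - laplace_kernel l u v))" using int3 by simp
        fix v
        show "\<bar>(tot u v - laplace_kernel l u v) * h v\<bar> \<le> H * (tot u v - laplace_kernel l u v)"
          using laplace_kernel_bounds(2)[OF less_imp_le[OF l], of u v]
            mult_left_mono[OF H[of v], of "tot u v - laplace_kernel l u v"] by (simp add: abs_mult mult.commute)
      qed
      also have "\<dots> = H * killing l u" using l by (simp add: killing_eq)
      finally show ?thesis .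
    qed
    have "potential l (\<lambda>u. h u - discounted_step l h u) = h x"
      using potential_resolvent[OF l bb(4)] potential_diff[OF l bb(4) bounded_borel_discounted_step[OF less_imp_le[OF l] bb(4)]] by simp
    moreover have "potential l \<rho> = potential l (\<lambda>u. h u - discounted_step l h u) - potential l r"
      unfolding \<rho>_def using l by (intro potential_diff bounded_borel_diff bb bounded_borel_discounted_step) auto
    moreover have "\<bar>potential l \<rho>\<bar> \<le> potential l (\<lambda>u. H * killing l u)"
      using l by (intro potential_abs_le \<rho>_bb \<rho>_le bounded_borel_cmult bounded_borel_killing) auto
    moreover have "potential l (\<lambda>u. H * killing l u) = H"
      using l by (simp add: potential_cmult bounded_borel_killing potential_killing)
    ultimately show ?thesis using H[of x] unfolding abs_le_iff by linarith
  qed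
  have small: "((\<lambda>t. L t / t powr \<alpha>) \<longlongrightarrow> 0) at_top"
    using slowly_varying_sub_powr(1)[OF L \<alpha>(1)] by (simp add: powr_minus divide_inverse)
  have r_lim: "((\<lambda>t. L t / t powr \<alpha> * potential (1 / t) r) \<longlongrightarrow> 0) at_top"
  proof (rule Lim_null_comparison)
    show "((\<lambda>t. \<bar>L t / t powr \<alpha>\<bar> * (2 * H)) \<longlongrightarrow> 0) at_top"
      by (intro tendsto_mult_left_zero tendsto_rabs_zero small)
    show "\<forall>\<^sub>F t in at_top. norm (L t / t powr \<alpha> * potential (1 / t) r) \<le> \<bar>L t / t powr \<alpha>\<bar> * (2 * H)"
      using eventually_gt_at_top[of 0]
    proof eventually_elim
      case (elim t)
      have "\<bar>potential (1 / t) r\<bar> \<le> 2 * H" using elim by (intro r_bound) simp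
      then show ?case unfolding real_norm_def abs_mult[of "L t / t powr \<alpha>"] by (intro mult_left_mono) auto
    qed
  qed
  have "((\<lambda>t. c * (L t / t powr \<alpha> * potential (1 / t) d) + L t / t powr \<alpha> * potential (1 / t) r) \<longlongrightarrow> c * 1 + 0) at_top"
    by (intro tendsto_add tendsto_mult tendsto_const r_lim potential_tail_mass[folded d_def])
  moreover have "\<forall>\<^sub>F t in at_top. c * (L t / t powr \<alpha> * potential (1 / t) d) + L t / t powr \<alpha> * potential (1 / t) r
      = L t / t powr \<alpha> * potential (1 / t) f"
    using eventually_gt_at_top[of 0]
  proof eventually_elim
    case (elim t)
    have "potential (1 / t) r = potential (1 / t) f - c * potential (1 / t) d"
      unfolding r_def using elim by (simp add: potential_diff potential_cmult bb bounded_borel_cmult)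
    then have "potential (1 / t) f = potential (1 / t) r + c * potential (1 / t) d" by simp
    then show ?case by (simp add: distrib_left add_divide_distrib mult_ac)
  qed
  ultimately show ?thesis by (simp add: tendsto_cong c_def d_def)
qed

end

section \<open>From potentials to the renewal measure\<close>

lemma measure_of_UNIV_borel_eqI:
  fixes M :: "'a::topological_space measure"
  assumes "sets M = sets (borel :: 'a measure)" "\<And>F. F \<in> sets borel \<Longrightarrow> g F = emeasure M F"
  shows "measure_of UNIV (sets borel) g = M"
proof -
  have "measure_of UNIV (sets borel) g = measure_of UNIV (sets (borel :: 'a measure)) (emeasure M)"
    using assms(2) sets.sigma_sets_eq[of "borel :: 'a measure"] by (intro measure_of_eq) auto
  also have "\<dots> = M"
    using measure_of_of_measure[of M] assms(1) sets_eq_imp_space_eq[OF assms(1)] by simp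
  finally show ?thesis .
qed

context markov_renewal
begin

text \<open>All pairs of a step and a sample point.  Realising the renewal masses as images of this measure yields
their countable additivity and the integration rule at once; \<open>occupation S\<close> collects the positions at the
renewal times \<open>\<tau>\<^sub>j \<in> S\<close> with \<open>j \<ge> 1\<close>.\<close>

definition visits :: "(nat \<times> 'w) measure" where
  "visits = count_space UNIV \<Otimes>\<^sub>M P"

definition occupation :: "nat set \<Rightarrow> 'a measure" where
  "occupation S = distr (density visits (\<lambda>(j, \<omega>). indicator S (\<tau> (Suc j) \<omega>))) borel (\<lambda>(j, \<omega>). J (Suc j) \<omega>)"

lemma measurable_visits:
  assumes "\<And>j. h j \<in> measurable P N"
  shows "(\<lambda>(j, \<omega>). h j \<omega>) \<in> measurable visits N"
  unfolding visits_def using assms by (intro measurable_pair_measure_countable1) auto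

lemma nn_integral_visits:
  assumes "\<And>j. h j \<in> borel_measurable P"
  shows "(\<integral>\<^sup>+ (j, \<omega>). h j \<omega> \<partial>visits) = (\<Sum>j. \<integral>\<^sup>+ \<omega>. h j \<omega> \<partial>P)"
proof -
  have "(\<lambda>(j, \<omega>). h j \<omega>) \<in> borel_measurable (count_space UNIV \<Otimes>\<^sub>M P)"
    using measurable_visits[of h borel] assms by (simp add: visits_def)
  from nn_integral_fst[OF this] show ?thesis
    by (simp add: visits_def nn_integral_count_space_nat)
qed

lemma sets_occupation [simp, measurable_cong]: "sets (occupation S) = sets borel"
  by (simp add: occupation_def)

lemma nn_integral_occupation:
  assumes [measurable]: "f \<in> borel_measurable borel"
  shows "(\<integral>\<^sup>+ y. f y \<partial>occupation S) = (\<integral>\<^sup>+ (j, \<omega>). indicator S (\<tau> (Suc j) \<omega>) * f (J (Suc j) \<omega>) \<partial>visits)"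
proof -
  have ind: "(\<lambda>(j, \<omega>). indicator S (\<tau> (Suc j) \<omega>) :: ennreal) \<in> borel_measurable visits"
    by (rule measurable_visits) measurable
  have J: "(\<lambda>(j, \<omega>). J (Suc j) \<omega>) \<in> measurable visits borel"
    by (rule measurable_visits) measurable
  have fJ: "(\<lambda>z. f ((\<lambda>(j, \<omega>). J (Suc j) \<omega>) z)) \<in> borel_measurable visits"
    using J by measurable
  have "(\<integral>\<^sup>+ y. f y \<partial>occupation S)
      = (\<integral>\<^sup>+ z. f ((\<lambda>(j, \<omega>). J (Suc j) \<omega>) z) \<partial>density visits (\<lambda>(j, \<omega>). indicator S (\<tau> (Suc j) \<omega>)))"
    unfolding occupation_def using J by (intro nn_integral_distr) auto
  also have "\<dots> = (\<integral>\<^sup>+ z. (\<lambda>(j, \<omega>). indicator S (\<tau> (Suc j) \<omega>)) z * f ((\<lambda>(j, \<omega>). J (Suc j) \<omega>) z) \<partial>visits)"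
    by (rule nn_integral_density[OF ind fJ])
  finally show ?thesis by (simp add: case_prod_beta')
qed

lemma visit_measurable:
  assumes [measurable]: "f \<in> borel_measurable borel"
  shows "(\<lambda>(j, \<omega>). indicator S (\<tau> (Suc j) \<omega>) * f (J (Suc j) \<omega>) :: ennreal) \<in> borel_measurable visits"
proof (rule measurable_visits)
  fix j
  have [measurable]: "(\<lambda>\<omega>. indicator S (\<tau> (Suc j) \<omega>) :: ennreal) \<in> borel_measurable P"
    by measurable
  show "(\<lambda>\<omega>. indicator S (\<tau> (Suc j) \<omega>) * f (J (Suc j) \<omega>)) \<in> borel_measurable P" by measurable
qed

lemma emeasure_occupation:
  assumes "F \<in> sets borel"
  shows "emeasure (occupation S) F = (\<Sum>j. emeasure P {\<omega> \<in> space P. \<tau> (Suc j) \<omega> \<in> S \<and> J (Suc j) \<omega> \<in> F})"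
proof -
  note [measurable] = assms
  have "emeasure (occupation S) F = (\<integral>\<^sup>+ y. indicator F y \<partial>occupation S)"
    using assms by simp
  also have "\<dots> = (\<Sum>j. \<integral>\<^sup>+ \<omega>. indicator S (\<tau> (Suc j) \<omega>) * indicator F (J (Suc j) \<omega>) \<partial>P)"
    by (subst nn_integral_occupation) (auto intro!: nn_integral_visits)
  also have "\<dots> = (\<Sum>j. \<integral>\<^sup>+ \<omega>. indicator {\<omega> \<in> space P. \<tau> (Suc j) \<omega> \<in> S \<and> J (Suc j) \<omega> \<in> F} \<omega> \<partial>P)"
    by (intro suminf_cong nn_integral_cong) (auto simp: indicator_def)
  also have "\<dots> = (\<Sum>j. emeasure P {\<omega> \<in> space P. \<tau> (Suc j) \<omega> \<in> S \<and> J (Suc j) \<omega> \<in> F})"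
    by (intro suminf_cong nn_integral_indicator) measurable
  finally show ?thesis .
qed

lemma renewal_mass_eq: "P' x = P \<Longrightarrow> renewal_mass P' \<tau> J i x = occupation {i}"
  unfolding renewal_mass_def by (rule measure_of_UNIV_borel_eqI) (auto simp: emeasure_occupation)

lemma nn_integral_occupation_sum:
  assumes [measurable]: "f \<in> borel_measurable borel"
  shows "(\<integral>\<^sup>+ y. f y \<partial>occupation {0..n}) = (\<Sum>i=0..n. \<integral>\<^sup>+ y. f y \<partial>occupation {i})"
proof -
  have m: "(\<lambda>(j, \<omega>). indicator {i} (\<tau> (Suc j) \<omega>) * f (J (Suc j) \<omega>)) \<in> borel_measurable visits" for i
    by (rule visit_measurable) fact
  have "indicator {0..n} m * c = (\<Sum>i=0..n. indicator {i} m * c)" for m :: nat and c :: ennreal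
    by (simp add: sum_distrib_right[symmetric] indicator_def)
  then show ?thesis
    unfolding nn_integral_occupation[OF assms]
    by (subst nn_integral_sum[OF m, symmetric]) (simp add: case_prod_beta')
qed

lemma renewal_measure_eq:
  assumes "P' x = P"
  shows "renewal_measure P' \<tau> J n x = occupation {0..n}"
  unfolding renewal_measure_def renewal_mass_eq[of P', OF assms]
proof (rule measure_of_UNIV_borel_eqI)
  fix F :: "'a set" assume F: "F \<in> sets borel"
  then show "(\<Sum>i = 0..n. emeasure (occupation {i}) F) = emeasure (occupation {0..n}) F"
    using nn_integral_occupation_sum[of "indicator F" n] by simp
qed simp

text \<open>The renewal masses start at \<open>j = 1\<close>, the potential at \<open>j = 0\<close>; hence the term \<open>f(x)\<close>.\<close>

lemma occupation_transform:
  assumes l: "0 < l" and f: "bounded_borel f" and f0: "\<And>u. 0 \<le> f u"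
  shows "(\<Sum>i. ennreal (exp (- l) ^ i) * (\<integral>\<^sup>+ y. ennreal (f y) \<partial>occupation {i})) = ennreal (potential l f - f x)"
proof -
  have [measurable]: "f \<in> borel_measurable borel" using f by (simp add: bounded_borel_def)
  have m: "(\<lambda>(j, \<omega>). indicator {i} (\<tau> (Suc j) \<omega>) * ennreal (f (J (Suc j) \<omega>))) \<in> borel_measurable visits" for i
    by (rule visit_measurable[of "\<lambda>u. ennreal (f u)"]) measurable
  have pick: "(\<Sum>i. ennreal (exp (- l) ^ i) * (indicator {i} n * c)) = ennreal (exp (- l) ^ n) * c" for n :: nat and c
  proof -
    have "(\<Sum>i. ennreal (exp (- l) ^ i) * (indicator {i} n * c)) = (\<Sum>i\<in>{n}. ennreal (exp (- l) ^ i) * (indicator {i} n * c))"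
      by (rule suminf_finite) auto
    then show ?thesis by simp
  qed
  have "(\<Sum>i. ennreal (exp (- l) ^ i) * (\<integral>\<^sup>+ y. ennreal (f y) \<partial>occupation {i}))
      = (\<Sum>i. \<integral>\<^sup>+ z. ennreal (exp (- l) ^ i) * (\<lambda>(j, \<omega>). indicator {i} (\<tau> (Suc j) \<omega>) * ennreal (f (J (Suc j) \<omega>))) z \<partial>visits)"
    by (subst nn_integral_occupation, simp) (intro suminf_cong nn_integral_cmult[symmetric] m)
  also have "\<dots> = (\<integral>\<^sup>+ z. (\<Sum>i. ennreal (exp (- l) ^ i) * (\<lambda>(j, \<omega>). indicator {i} (\<tau> (Suc j) \<omega>) * ennreal (f (J (Suc j) \<omega>))) z) \<partial>visits)"
    by (rule nn_integral_suminf[symmetric]) (intro borel_measurable_times_ennreal borel_measurable_const m)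
  also have "\<dots> = (\<integral>\<^sup>+ (j, \<omega>). ennreal (exp (- l) ^ \<tau> (Suc j) \<omega>) * ennreal (f (J (Suc j) \<omega>)) \<partial>visits)"
    by (intro nn_integral_cong) (simp add: case_prod_beta pick)
  also have "\<dots> = (\<Sum>j. \<integral>\<^sup>+ \<omega>. ennreal (exp (- l) ^ \<tau> (Suc j) \<omega>) * ennreal (f (J (Suc j) \<omega>)) \<partial>P)"
    by (rule nn_integral_visits) measurable
  also have "\<dots> = (\<Sum>j. ennreal (discounted_mean l f (Suc j)))"
    unfolding discounted_mean_def using l f0
    by (intro suminf_cong, subst nn_integral_eq_integral[OF discounted_mean_integrable[OF less_imp_le[OF l] f], symmetric])
      (auto simp: ennreal_mult)
  also have "\<dots> = ennreal (\<Sum>j. discounted_mean l f (Suc j))"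
  proof (rule suminf_ennreal2)
    show "0 \<le> discounted_mean l f (Suc j)" for j
      unfolding discounted_mean_def using f0 by (intro Bochner_Integration.integral_nonneg) simp
    show "summable (\<lambda>j. discounted_mean l f (Suc j))"
      using discounted_mean_summable[OF l f] by (rule summable_Suc_iff[THEN iffD2])
  qed
  also have "(\<Sum>j. discounted_mean l f (Suc j)) = potential l f - f x"
    unfolding potential_def using suminf_split_head[OF discounted_mean_summable[OF l f]] by (simp add: discounted_mean_0)
  finally show ?thesis .
qed

text \<open>Finite because the Laplace transform is finite at \<open>l = 1\<close>, say, where each mass has a positive weight.\<close>

lemma nn_integral_occupation_finite:
  assumes f: "bounded_borel f" and f0: "\<And>u. 0 \<le> f u"
  shows "(\<integral>\<^sup>+ y. ennreal (f y) \<partial>occupation {i}) < \<infinity>"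
proof (rule ccontr)
  assume "\<not> (\<integral>\<^sup>+ y. ennreal (f y) \<partial>occupation {i}) < \<infinity>"
  then have "(\<integral>\<^sup>+ y. ennreal (f y) \<partial>occupation {i}) = top" by (simp add: top_unique less_top[symmetric])
  then have "ennreal (exp (- 1) ^ i) * (\<integral>\<^sup>+ y. ennreal (f y) \<partial>occupation {i}) = top"
    by (simp add: ennreal_mult_top)
  moreover have "ennreal (exp (- 1) ^ i) * (\<integral>\<^sup>+ y. ennreal (f y) \<partial>occupation {i})
      \<le> (\<Sum>i. ennreal (exp (- 1) ^ i) * (\<integral>\<^sup>+ y. ennreal (f y) \<partial>occupation {i}))"
    using sum_le_suminf[of "\<lambda>i. ennreal (exp (- 1) ^ i) * (\<integral>\<^sup>+ y. ennreal (f y) \<partial>occupation {i})" "{i}"] by simp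
  ultimately show False
    unfolding occupation_transform[OF zero_less_one f f0] by (simp add: top_unique)
qed

lemma finite_measure_occupation: "finite_measure (occupation {0..n})"
proof
  have "emeasure (occupation {0..n}) (space (occupation {0..n})) = (\<integral>\<^sup>+ y. ennreal 1 \<partial>occupation {0..n})" by simp
  also have "\<dots> = (\<Sum>i=0..n. \<integral>\<^sup>+ y. ennreal 1 \<partial>occupation {i})"
    by (rule nn_integral_occupation_sum) simp
  also have "\<dots> < \<infinity>"
    using nn_integral_occupation_finite[OF bounded_borel_const[of 1]] by (simp add: less_top)
  finally show "emeasure (occupation {0..n}) (space (occupation {0..n})) \<noteq> \<infinity>" by simp
qed

lemma integral_occupation:
  assumes f: "bounded_borel f" and f0: "\<And>u. 0 \<le> f u"
  shows "(\<integral> y. f y \<partial>occupation {0..n}) = (\<Sum>i=0..n. enn2real (\<integral>\<^sup>+ y. ennreal (f y) \<partial>occupation {i}))"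
proof -
  have m: "f \<in> borel_measurable borel" using f by (simp add: bounded_borel_def)
  have "(\<integral> y. f y \<partial>occupation {0..n}) = enn2real (\<integral>\<^sup>+ y. ennreal (f y) \<partial>occupation {0..n})"
    using m f0 by (intro integral_eq_nn_integral) auto
  also have "(\<integral>\<^sup>+ y. ennreal (f y) \<partial>occupation {0..n}) = (\<Sum>i=0..n. \<integral>\<^sup>+ y. ennreal (f y) \<partial>occupation {i})"
    using m by (intro nn_integral_occupation_sum) simp
  also have "enn2real \<dots> = (\<Sum>i=0..n. enn2real (\<integral>\<^sup>+ y. ennreal (f y) \<partial>occupation {i}))"
    using nn_integral_occupation_finite[OF f f0] by (subst enn2real_sum) auto
  finally show ?thesis .
qed

lemma integrable_occupation:
  assumes "bounded_borel f"
  shows "integrable (occupation {0..n}) f"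
proof -
  interpret o: finite_measure "occupation {0..n}" by (rule finite_measure_occupation)
  obtain M where "\<And>u. \<bar>f u\<bar> \<le> M" using assms by (auto simp: bounded_borel_def)
  then show ?thesis
    using assms by (intro o.integrable_const_bound[where B = M]) (auto simp: bounded_borel_def)
qed

end

context heavy_tailed_renewal
begin

text \<open>The Tauberian theorem needs the transform only at \<open>l = (m + 1)/n\<close>, that is, the potential asymptotics at
\<open>t = n/(m + 1)\<close>; replacing \<open>L(t)\<close> by \<open>L(n)\<close> is the definition of slow variation.\<close>

lemma occupation_asymptotics_nonneg:
  fixes f :: "'a \<Rightarrow> real"
  assumes f: "continuous_on UNIV f" and f0: "\<And>u. 0 \<le> f u"
  shows "(\<lambda>n. L (real n) / real n powr \<alpha> * (\<integral> y. f y \<partial>occupation {0..n})) \<longlonglongrightarrow>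
    (\<integral> u. f u \<partial>\<pi>) / (Gamma (1 - \<alpha>) / \<alpha> * (\<integral> u. tail_mass u \<partial>\<pi>)) / Gamma (1 + \<alpha>)"
proof -
  define C where "C = (\<integral> u. f u \<partial>\<pi>) / (Gamma (1 - \<alpha>) / \<alpha> * (\<integral> u. tail_mass u \<partial>\<pi>))"
  define a where "a i = enn2real (\<integral>\<^sup>+ y. ennreal (f y) \<partial>occupation {i})" for i
  note fb = bounded_borel_continuous[OF f]
  have a0: "0 \<le> a i" for i by (simp add: a_def)
  have term_eq: "ennreal (exp (- l) ^ i) * (\<integral>\<^sup>+ y. ennreal (f y) \<partial>occupation {i}) = ennreal (a i * exp (- l * real i))" for l i
  proof -
    have "(\<integral>\<^sup>+ y. ennreal (f y) \<partial>occupation {i}) = ennreal (a i)"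
      unfolding a_def using nn_integral_occupation_finite[OF fb f0, of i] by simp
    moreover have "exp (- l) ^ i = exp (- l * real i)" by (simp add: exp_of_nat_mult[symmetric] mult.commute)
    ultimately show ?thesis using a0[of i] by (simp add: ennreal_mult[symmetric] mult.commute)
  qed
  have sum_eq: "(\<Sum>i. ennreal (a i * exp (- l * real i))) = ennreal (potential l f - f x)" if "0 < l" for l
    using occupation_transform[OF that fb f0] unfolding term_eq .
  have sm: "summable (\<lambda>i. a i * exp (- l * real i))" if "0 < l" for l
    using a0 sum_eq[OF that] by (intro summable_suminf_not_top) auto
  have transform: "(\<Sum>i. a i * exp (- l * real i)) = potential l f - f x" if l: "0 < l" for l
  proof -
    have "ennreal (\<Sum>i. a i * exp (- l * real i)) = ennreal (potential l f - f x)"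
      using a0 sm[OF l] sum_eq[OF l] by (subst suminf_ennreal2[symmetric]) auto
    moreover have "0 \<le> (\<Sum>i. a i * exp (- l * real i))" using a0 sm[OF l] by (intro suminf_nonneg) auto
    moreover have "0 \<le> potential l f - f x"
    proof -
      have "0 \<le> discounted_step l f u" for u
        unfolding discounted_step_def using laplace_kernel_bounds(1)[OF less_imp_le[OF l]] f0
        by (intro Bochner_Integration.integral_nonneg) simp
      then have "potential l (\<lambda>_. 0) \<le> potential l (discounted_step l f)"
        by (intro potential_mono l bounded_borel_const bounded_borel_discounted_step less_imp_le[OF l] fb)
      moreover have "potential l (\<lambda>_. 0) = 0" by (simp add: potential_def discounted_mean_def)
      ultimately show ?thesis using potential_resolvent[OF l fb] by simp
    qed
    ultimately show ?thesis by simp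
  qed
  obtain T where T: "1 \<le> T" "\<And>t. T \<le> t \<Longrightarrow> 0 < L t"
    using slowly_varying_uniform[OF L zero_less_one] by metis
  have w: "\<forall>\<^sub>F n in sequentially. 0 \<le> L (real n) / real n powr \<alpha>"
  proof -
    have "\<forall>\<^sub>F n in sequentially. T \<le> real n" by (rule eventually_ge_at_top[THEN filterlim_real_sequentially[unfolded filterlim_iff, rule_format]])
    then show ?thesis by eventually_elim (use T in \<open>auto intro!: divide_nonneg_nonneg less_imp_le\<close>)
  qed
  have small: "(\<lambda>n. L (real n) / real n powr \<alpha>) \<longlonglongrightarrow> 0"
  proof -
    have "((\<lambda>t. L t / t powr \<alpha>) \<longlongrightarrow> 0) at_top"
      using slowly_varying_sub_powr(1)[OF L \<alpha>(1)] by (simp add: powr_minus divide_inverse)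
    from filterlim_compose[OF this filterlim_real_sequentially] show ?thesis .
  qed
  have "(\<lambda>n. L (real n) / real n powr \<alpha> * (\<Sum>i=0..n. a i)) \<longlonglongrightarrow> C / Gamma (1 + \<alpha>)"
  proof (rule karamata_tauberian[OF \<alpha>(1) a0 sm w])
    fix m :: nat
    define c where "c = 1 / (real m + 1)"
    have c: "0 < c" by (simp add: c_def)
    have ct: "filterlim (\<lambda>n. c * real n) at_top sequentially"
      by (rule filterlim_tendsto_pos_mult_at_top[OF tendsto_const c filterlim_real_sequentially])
    have pot: "(\<lambda>n. L (c * real n) / (c * real n) powr \<alpha> * potential (1 / (c * real n)) f) \<longlonglongrightarrow> C"
      using filterlim_compose[OF potential_asymptotics[OF f] ct] by (simp add: C_def)
    have "((\<lambda>t. L (c * t) / L t) \<longlongrightarrow> 1) at_top" using L c by (auto simp: slowly_varying_def)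
    from filterlim_compose[OF this filterlim_real_sequentially]
    have ratio: "(\<lambda>n. L (c * real n) / L (real n)) \<longlonglongrightarrow> 1" .
    have lim: "(\<lambda>n. inverse (L (c * real n) / L (real n)) * c powr \<alpha> *
        (L (c * real n) / (c * real n) powr \<alpha> * potential (1 / (c * real n)) f) - L (real n) / real n powr \<alpha> * f x)
        \<longlonglongrightarrow> inverse 1 * c powr \<alpha> * C - 0 * f x"
      by (intro tendsto_intros pot small tendsto_inverse[OF ratio]) simp
    have ev: "\<forall>\<^sub>F n in sequentially. inverse (L (c * real n) / L (real n)) * c powr \<alpha> *
        (L (c * real n) / (c * real n) powr \<alpha> * potential (1 / (c * real n)) f) - L (real n) / real n powr \<alpha> * f x
      = L (real n) / real n powr \<alpha> * (\<Sum>i. a i * exp (- ((real m + 1) / real n) * real i))"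
    proof -
      have "\<forall>\<^sub>F n in sequentially. T \<le> c * real n"
        using ct by (auto simp: filterlim_at_top)
      then show ?thesis
        using eventually_gt_at_top[of 0]
      proof eventually_elim
        case (elim n)
        have n: "0 < real n" "0 < L (c * real n)" using elim T by auto
        have l: "1 / (c * real n) = (real m + 1) / real n" by (simp add: c_def)
        have "(\<Sum>i. a i * exp (- ((real m + 1) / real n) * real i)) = potential (1 / (c * real n)) f - f x"
          unfolding l using n by (intro transform) simp
        moreover have "(c * real n) powr \<alpha> = c powr \<alpha> * real n powr \<alpha>" using c n by (simp add: powr_mult)
        ultimately show ?case using n c by (simp add: right_diff_distrib)
      qed
    qed
    have eq: "inverse 1 * c powr \<alpha> * C - 0 * f x = C * (real m + 1) powr -\<alpha>"
    proof -
      have "c powr \<alpha> = (real m + 1) powr -\<alpha>"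
        unfolding c_def using powr_divide[of 1 "real m + 1" \<alpha>] by (simp add: powr_minus_divide)
      then show ?thesis by simp
    qed
    show "(\<lambda>n. L (real n) / real n powr \<alpha> * (\<Sum>i. a i * exp (- ((real m + 1) / real n) * real i)))
        \<longlonglongrightarrow> C * (real m + 1) powr -\<alpha>"
      by (rule Lim_transform_eventually[OF lim[unfolded eq] ev])
  qed
  then show ?thesis
    unfolding integral_occupation[OF fb f0] a_def[symmetric] C_def .
qed

lemma integral_tail_ratio:
  "(\<integral> (u, v). \<Phi> (u, v) / tot u v \<partial>(pair_invariant \<mu> k \<pi>)) = (\<integral> u. tail_mass u \<partial>\<pi>)"
proof -
  have cont: "continuous_on UNIV (\<lambda>(u, v). \<Phi> (u, v) / tot u v)"
    unfolding case_prod_beta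
  proof (rule continuous_on_divide)
    show "\<forall>z\<in>UNIV. tot (fst z) (snd z) \<noteq> 0"
    proof
      fix z :: "'a \<times> 'a"
      show "tot (fst z) (snd z) \<noteq> 0" using total_pos[of "fst z" "snd z"] by simp
    qed
  qed (use \<Phi>_continuous_curried total_continuous in \<open>simp_all add: case_prod_beta\<close>)
  obtain M where M: "\<And>u v. \<bar>\<Phi> (u, v) / tot u v\<bar> \<le> M"
    using continuous_bounds[of "\<lambda>u v. \<Phi> (u, v) / tot u v", OF cont] by blast
  have "(\<lambda>(u, v). \<Phi> (u, v) / tot u v) \<in> borel_measurable (borel \<Otimes>\<^sub>M borel)"
    using borel_measurable_continuous_onI[OF cont] by (simp add: borel_prod)
  note integral_pair_invariant[OF this M]
  moreover have "tot u v * (\<Phi> (u, v) / tot u v) = \<Phi> (u, v)" for u v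
    using total_pos[of u v] by simp
  ultimately show ?thesis by (simp only: tail_mass_def)
qed

lemma occupation_asymptotics:
  fixes f :: "'a \<Rightarrow> real"
  assumes f: "continuous_on UNIV f"
  shows "(\<lambda>n. L (real n) / real n powr \<alpha> * (\<integral> y. f y \<partial>occupation {0..n})) \<longlonglongrightarrow>
    \<alpha> / (Gamma (1 + \<alpha>) * Gamma (1 - \<alpha>)) *
      ((\<integral> y. f y \<partial>\<pi>) / (\<integral> (u, v). \<Phi> (u, v) / tot u v \<partial>(pair_invariant \<mu> k \<pi>)))"
proof -
  obtain M where M: "\<And>u. \<bar>f u\<bar> \<le> M" using continuous_bounded[OF f] by blast
  have M0: "0 \<le> M" using M[of undefined] by linarith
  define D where "D = Gamma (1 - \<alpha>) / \<alpha> * (\<integral> u. tail_mass u \<partial>\<pi>)"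
  have fM: "continuous_on UNIV (\<lambda>u. f u + M)" by (intro continuous_on_add f continuous_on_const)
  have fM0: "0 \<le> f u + M" for u using M[of u] by linarith
  have int: "integrable \<pi> f"
    using M borel_measurable_continuous_onI[OF f] by (intro inv.integrable_const_bound[where B = M]) auto
  have "(\<lambda>n. L (real n) / real n powr \<alpha> * (\<integral> y. f y + M \<partial>occupation {0..n})
        - L (real n) / real n powr \<alpha> * (\<integral> y. M \<partial>occupation {0..n}))
      \<longlonglongrightarrow> (\<integral> u. f u + M \<partial>\<pi>) / D / Gamma (1 + \<alpha>) - (\<integral> u. M \<partial>\<pi>) / D / Gamma (1 + \<alpha>)"
    unfolding D_def
    by (intro tendsto_diff occupation_asymptotics_nonneg fM fM0 continuous_on_const M0)
  moreover have "L (real n) / real n powr \<alpha> * (\<integral> y. f y + M \<partial>occupation {0..n})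
        - L (real n) / real n powr \<alpha> * (\<integral> y. M \<partial>occupation {0..n})
      = L (real n) / real n powr \<alpha> * (\<integral> y. f y \<partial>occupation {0..n})" for n
    unfolding right_diff_distrib[symmetric]
    using integrable_occupation[OF bounded_borel_continuous[OF f], of n] integrable_occupation[OF bounded_borel_const[of M], of n]
    by (subst Bochner_Integration.integral_add) auto
  moreover have "(\<integral> u. f u + M \<partial>\<pi>) / D / Gamma (1 + \<alpha>) - (\<integral> u. M \<partial>\<pi>) / D / Gamma (1 + \<alpha>)
      = \<alpha> / (Gamma (1 + \<alpha>) * Gamma (1 - \<alpha>)) *
      ((\<integral> y. f y \<partial>\<pi>) / (\<integral> (u, v). \<Phi> (u, v) / tot u v \<partial>(pair_invariant \<mu> k \<pi>)))"
  proof -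
    have "(\<integral> u. f u + M \<partial>\<pi>) - (\<integral> u. M \<partial>\<pi>) = (\<integral> u. f u \<partial>\<pi>)" using int by simp
    then show ?thesis
      unfolding diff_divide_distrib[symmetric] integral_tail_ratio D_def by (simp add: mult_ac)
  qed
  ultimately show ?thesis by simp
qed

end

section \<open>The renewal theorem\<close>

text \<open>For all large \<open>n\<close> the tail assumption bounds \<open>k\<^sub>n(u,v)\<close> from above and from below by positive multiples of
\<open>L(n) n\<^bsup>-1-\<alpha>\<^esup>\<close>, which is positive and at most \<open>n\<^bsup>-1-\<alpha>/2\<^esup>\<close>.\<close>

lemma densities_summable_and_positive:
  fixes \<Phi> :: "'a \<Rightarrow> 'a \<Rightarrow> real"
  assumes L: "slowly_varying L" and \<alpha>: "0 < \<alpha>" and \<Phi>: "\<And>u v. 0 < \<Phi> u v"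
    and k: "\<And>n u v. 0 \<le> k (Suc n) u v"
    and tail: "uniform_limit UNIV
           (\<lambda>n (u, v). k n u v / (\<Phi> u v * L (real n) / real n powr (1 + \<alpha>))) (\<lambda>_. 1) sequentially"
  shows "summable (\<lambda>n. k (Suc n) u v) \<and> 0 < total_density k u v"
proof
  define c where "c n = L (real n) / real n powr (1 + \<alpha>)" for n
  obtain T where T: "1 \<le> T" "\<And>t. T \<le> t \<Longrightarrow> 0 < L t"
    using slowly_varying_uniform[OF L zero_less_one] by metis
  have T_ev: "\<forall>\<^sub>F n in sequentially. T \<le> real n"
    using filterlim_real_sequentially by (auto simp: filterlim_at_top)
  have "((\<lambda>t. L t * t powr -(\<alpha> / 2)) \<longlongrightarrow> 0) at_top"
    using \<alpha> by (intro slowly_varying_sub_powr(1)[OF L]) simp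
  from filterlim_compose[OF this filterlim_real_sequentially]
  have "\<forall>\<^sub>F n in sequentially. L (real n) * real n powr -(\<alpha> / 2) < 1"
    by (intro order_tendstoD) auto
  with T_ev have c_le: "\<forall>\<^sub>F n in sequentially. 0 < c n \<and> c n \<le> real n powr (-1 - \<alpha> / 2)"
  proof eventually_elim
    case (elim n)
    have n: "0 < real n" using elim(1) T(1) by linarith
    have "real n powr -(1 + \<alpha>) = real n powr -(\<alpha> / 2) * real n powr (-1 - \<alpha> / 2)"
    proof -
      have "-(1 + \<alpha>) = -(\<alpha> / 2) + (-1 - \<alpha> / 2)" by simp
      then show ?thesis by (simp only: powr_add)
    qed
    then have "c n = (L (real n) * real n powr -(\<alpha> / 2)) * real n powr (-1 - \<alpha> / 2)"
      unfolding c_def divide_inverse powr_minus[symmetric] by simp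
    also have "\<dots> \<le> 1 * real n powr (-1 - \<alpha> / 2)" using elim(2) by (intro mult_right_mono) auto
    finally show ?case using n T(2)[OF elim(1)] by (simp add: c_def)
  qed
  have "\<forall>\<^sub>F n in sequentially. \<forall>z\<in>UNIV. dist ((\<lambda>(u, v). k n u v / (\<Phi> u v * L (real n) / real n powr (1 + \<alpha>))) z) 1 < 1 / 2"
    by (rule uniform_limitD[OF tail]) simp
  with c_le have k_ev: "\<forall>\<^sub>F n in sequentially. 0 < k n u v \<and> k n u v \<le> 2 * \<Phi> u v * real n powr (-1 - \<alpha> / 2)"
  proof eventually_elim
    case (elim n)
    define b where "b = \<Phi> u v * c n"
    have b: "0 < b" using elim(1) \<Phi>[of u v] by (simp add: b_def)
    have "\<bar>k n u v / b - 1\<bar> < 1 / 2" using bspec[OF elim(2), of "(u, v)"] by (simp add: b_def c_def dist_real_def)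
    then have "1 / 2 < k n u v / b" "k n u v / b < 2" unfolding abs_less_iff by linarith+
    then have "1 / 2 * b < k n u v" "k n u v < 2 * b"
      using b by (simp_all only: pos_less_divide_eq pos_divide_less_eq)
    moreover have "b \<le> \<Phi> u v * real n powr (-1 - \<alpha> / 2)"
      unfolding b_def using elim(1) \<Phi>[of u v] by (intro mult_left_mono) auto
    ultimately show ?case using b by (simp add: mult.assoc)
  qed
  have "summable (\<lambda>n. 2 * \<Phi> u v * real n powr (-1 - \<alpha> / 2))"
    using \<alpha> by (intro summable_mult) (simp add: summable_real_powr_iff)
  then have "summable (\<lambda>n. k n u v)"
    by (rule summable_comparison_test_ev[OF eventually_mono[OF k_ev], rotated]) auto
  then show sm: "summable (\<lambda>n. k (Suc n) u v)" by (rule summable_Suc_iff[THEN iffD2])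
  from k_ev obtain N where "\<And>n. N \<le> n \<Longrightarrow> 0 < k n u v" by (auto simp: eventually_sequentially)
  then have "0 < k (Suc N) u v" by simp
  then show "0 < total_density k u v"
    unfolding total_density_def using sm k by (intro suminf_pos2[where i = N]) auto
qed

theorem theorem1p2:
  fixes \<mu> \<pi> :: "'a::polish_space measure"
    and K :: "nat \<Rightarrow> 'a \<Rightarrow> 'a measure"
    and k :: "nat \<Rightarrow> 'a \<Rightarrow> 'a \<Rightarrow> real"
    and \<Phi> :: "'a \<times> 'a \<Rightarrow> real"
    and L :: "real \<Rightarrow> real"
    and \<alpha> :: real
    and P :: "'a \<Rightarrow> 'w measure"
    and \<tau> :: "nat \<Rightarrow> 'w \<Rightarrow> nat"
    and J :: "nat \<Rightarrow> 'w \<Rightarrow> 'a"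
  assumes "compact (UNIV :: 'a set)"
    and "renewal_kernel \<mu> K k"
    and "continuous_on UNIV (\<lambda>(x, y). total_density k x y)"
    and "0 < \<alpha>" and "\<alpha> < 1"
    and "\<And>z. \<Phi> z > 0" and "continuous_on UNIV \<Phi>" and "bounded (range \<Phi>)"
    and "slowly_varying L"
    and "uniform_limit UNIV
           (\<lambda>n (x, y). k n x y / (\<Phi> (x, y) * L (real n) / real n powr (1 + \<alpha>)))
           (\<lambda>_. 1) sequentially"
    and "\<And>x. (\<integral>\<^sup>+ y. (\<Sum>n. ennreal (k (Suc n) x y)) \<partial>\<mu>) = 1"
    and "\<And>x. markov_renewal_process \<mu> k x (P x) \<tau> J"
    and "invariant_probability \<mu> k \<pi>"
  shows "\<forall>x. \<forall>f :: 'a \<Rightarrow> real. continuous_on UNIV f \<longrightarrow> bounded (range f) \<longrightarrow>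
    (\<lambda>n. L (real n) / real n powr \<alpha> * (\<integral> y. f y \<partial>(renewal_measure P \<tau> J n x)))
      \<longlonglongrightarrow> \<alpha> / (Gamma (1 + \<alpha>) * Gamma (1 - \<alpha>)) *
          ((\<integral> y. f y \<partial>\<pi>) /
           (\<integral> (u, v). \<Phi> (u, v) / total_density k u v \<partial>(pair_invariant \<mu> k \<pi>)))"
proof (intro allI impI)
  fix x and f :: "'a \<Rightarrow> real"
  assume f: "continuous_on UNIV f"
  have kernel: "sets \<mu> = sets borel" "\<And>n. (\<lambda>(x, y). k (Suc n) x y) \<in> borel_measurable (borel \<Otimes>\<^sub>M borel)"
    "\<And>n x y. 0 \<le> k (Suc n) x y"
    using assms(2) by (auto simp: renewal_kernel_def)
  have pos_and_summable: "summable (\<lambda>n. k (Suc n) u v) \<and> 0 < total_density k u v" for u v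
    using densities_summable_and_positive[of L \<alpha> "\<lambda>u v. \<Phi> (u, v)" k, OF assms(9,4,6) kernel(3) assms(10)] by blast
  interpret heavy_tailed_renewal \<mu> \<pi> k x "P x" \<tau> J \<Phi> L \<alpha>
  proof unfold_locales
    show "summable (\<lambda>n. k (Suc n) u v)" "0 < total_density k u v" for u v
      using pos_and_summable by blast+
  qed (fact assms kernel)+
  show "(\<lambda>n. L (real n) / real n powr \<alpha> * (\<integral> y. f y \<partial>(renewal_measure P \<tau> J n x)))
      \<longlonglongrightarrow> \<alpha> / (Gamma (1 + \<alpha>) * Gamma (1 - \<alpha>)) *
          ((\<integral> y. f y \<partial>\<pi>) /
           (\<integral> (u, v). \<Phi> (u, v) / total_density k u v \<partial>(pair_invariant \<mu> k \<pi>)))"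
    unfolding renewal_measure_eq[of P, OF refl] by (rule occupation_asymptotics[OF f])
qed

end
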